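(* Let $|\psi\rangle$ be a truly tripartite entangled pure state of three qubits. Below, "decomposition" means a decomposition of $|\psi\rangle$ of the form $(\dagger)$, with $E_1=E(\psi_s)$ for that decomposition; $|\phi_1\rangle,|\phi_2\rangle,|\phi_3\rangle$ denote unit vectors in $\mathbb{R}^2\subset\mathbb{C}^2$ and $c\in\mathbb{R}$; and "$|\psi\rangle\propto|\Omega\rangle$" means that $|\psi\rangle$ is LU-equivalent to the normalization of $|\Omega\rangle$ for some choice of the $|\phi_i\rangle$ (and of $c$, where it appears). Then: 1. There is a decomposition with $E_1=\mathfrak{E}(C_{23})=\mathfrak{E}(C_{23}^a)$ if and only if $|\psi\rangle$ belongs to the W-class. 2. There is a decomposition with $E_1=\mathfrak{E}(C_{23}^a)\ne\mathfrak{E}(C_{23})$ if and only if $|\psi\rangle\propto|000\rangle+c|\phi_1\phi_2\phi_3\rangle$. 3. There is a decomposition with $E_1=\mathfrak{E}(C_{23})\neq\mathfrak{E}(C_{23}^a)$ if and only if $|\psi\rangle\propto|000\rangle+e^{ic}|\phi_1\phi_2\phi_3\rangle$. 4. $\mathfrak{E}(C_{23})\ne\mathfrak{E}(C_{23}^a)$ and there exist both a decomposition with $E_1=\mathfrak{E}(C_{23})$ and a decomposition with $E_1=\mathfrak{E}(C_{23}^a)$ if and only if $|\psi\rangle\propto|000\rangle+|\phi_1\phi_2\phi_3\rangle$.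
   Context: A pure three-qubit state is truly tripartite entangled if it is not a product state with respect to any of the bipartitions $1|23$, $2|13$, $3|12$. Two three-qubit states are LU-equivalent if they are related by $V_1\otimes V_2\otimes V_3$ with $V_i\in U(2)$. The W-class is the set of truly tripartite entangled states of the form $(A_1\otimes A_2\otimes A_3)(|001\rangle+|010\rangle+|100\rangle)$ with invertible $A_i\in GL_2(\mathbb{C})$ (equivalently, truly tripartite entangled states of vanishing three-tangle). A decomposition of $|\psi\rangle$ of the form $(\dagger)$ means that $|\psi\rangle$ is LU-equivalent to $$\tfrac1{\sqrt2}\big(|0\rangle_1|\psi_s\rangle_{23}+|1\rangle_1 (U_2\otimes U_3)|\psi_s\rangle_{23}\big),\qquad(\dagger)$$ where $|\psi_s\rangle=a|00\rangle+b|11\rangle$, $a\ge b\ge0$, $a^2+b^2=1$, $U_2=Z(\alpha)Y(\beta)Z(\gamma)$, $U_3=Y(\beta')$, $\alpha,\gamma\in(-\pi/2,\pi/2]$, $\beta,\beta'\in[0,\pi/2]$, $Y(\xi)=e^{i\xi\sigma_y}$, $Z(\xi)=e^{i\xi\sigma_z}$, with $\sigma_{x,y,z}$ the Pauli matrices. $E$ of a two-qubit pure state is the von Neumann entropy (base-2 logarithm) of a one-qubit reduced state. The concurrence of a two-qubit pure state is $C(\phi)=|\langle\tilde\phi|\phi\rangle|$, $|\tilde\phi\rangle=\sigma_y\otimes\sigma_y|\phi^*\rangle$ ($^*$ is complex conjugation in the computational basis), and $E(\phi)=\mathfrak{E}(C(\phi))$ with the strictly increasing function $\mathfrak{E}(C)=h\big(\tfrac{1+\sqrt{1-C^2}}2\big)$,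 $h(x)=-x\log_2x-(1-x)\log_2(1-x)$. For the reduced state $\rho_{23}$ of $|\psi\rangle$ on qubits $2,3$, $C_{23}=\min\sum_j\pi_jC(\phi_j)$ and $C_{23}^a=\max\sum_j\pi_jC(\phi_j)$ over all pure-state ensembles $\rho_{23}=\sum_j\pi_j|\phi_j\rangle\langle\phi_j|$. *)

theory Defs
  imports "HOL-Analysis.Analysis"
begin

section \<open>Qubit systems and tensor products\<close>

text \<open>
  Systems of qubits are vectors whose index type is a product of copies of \<open>2\<close>; products associate
  to the right, so that a three-qubit vector has components \<open>\<psi> $ (i, j, k)\<close>. Following the order
  of \<^const>\<open>vector\<close>, the computational basis vectors \<open>|0\<rangle>\<close>, \<open>|1\<rangle>\<close> carry the indices \<open>1\<close>, \<open>2\<close>.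
\<close>

type_synonym qubit = "complex ^ 2"
type_synonym two_qubit = "complex ^ (2 \<times> 2)"
type_synonym three_qubit = "complex ^ (2 \<times> 2 \<times> 2)"

definition ket0 :: qubit where "ket0 = axis 1 1"
definition ket1 :: qubit where "ket1 = axis 2 1"

definition vec_tensor :: "complex ^ 'a::finite \<Rightarrow> complex ^ 'b::finite \<Rightarrow> complex ^ ('a \<times> 'b)"
    (infixr "\<otimes>\<^sub>v" 75) where
  "u \<otimes>\<^sub>v v = (\<chi> i. u $ fst i * v $ snd i)"

definition mat_tensor ::
    "complex ^ 'a::finite ^ 'b::finite \<Rightarrow> complex ^ 'c::finite ^ 'd::finite \<Rightarrow> complex ^ ('a \<times> 'c) ^ ('b \<times> 'd)"
    (infixr "\<otimes>\<^sub>m" 75) where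
  "A \<otimes>\<^sub>m B = (\<chi> i j. A $ fst i $ fst j * B $ snd i $ snd j)"

definition conj_vec :: "complex ^ 'a::finite \<Rightarrow> complex ^ 'a" where
  "conj_vec v = (\<chi> i. cnj (v $ i))"

text \<open>The complex inner product \<open>\<langle>u|v\<rangle>\<close>, antilinear in the first argument.\<close>

definition braket :: "complex ^ 'a::finite \<Rightarrow> complex ^ 'a \<Rightarrow> complex" where
  "braket u v = (\<Sum>i\<in>UNIV. cnj (u $ i) * v $ i)"

text \<open>The operator \<open>|v\<rangle>\<langle>v|\<close>.\<close>

definition ketbra :: "complex ^ 'a::finite \<Rightarrow> complex ^ 'a ^ 'a" where
  "ketbra v = (\<chi> i j. v $ i * cnj (v $ j))"

definition mat_adjoint :: "complex ^ 'a::finite ^ 'b::finite \<Rightarrow> complex ^ 'b ^ 'a" where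
  "mat_adjoint A = (\<chi> i j. cnj (A $ j $ i))"

definition unitary :: "complex ^ 'a::finite ^ 'a \<Rightarrow> bool" where
  "unitary V \<longleftrightarrow> V ** mat_adjoint V = mat 1 \<and> mat_adjoint V ** V = mat 1"

text \<open>Partial trace over the first tensor factor.\<close>

definition partial_trace_fst ::
    "complex ^ ('a::finite \<times> 'b::finite) ^ ('a \<times> 'b) \<Rightarrow> complex ^ 'b ^ 'b" where
  "partial_trace_fst R = (\<chi> j j'. \<Sum>i\<in>UNIV. R $ (i, j) $ (i, j'))"

section \<open>Pauli matrices and the rotations they generate\<close>

text \<open>
  \<open>complex ^ 'a ^ 'a\<close> is not an instance of the normed algebras on which \<^const>\<open>exp\<close> is defined
  (its \<open>*\<close> is componentwise), so the exponential series is written out with the matrix product.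
\<close>

definition mat_exp :: "complex ^ 'a::finite ^ 'a \<Rightarrow> complex ^ 'a ^ 'a" where
  "mat_exp A = (\<Sum>n. (1 / fact n) *\<^sub>R (((**) A) ^^ n) (mat 1))"

definition sigma_y :: "complex ^ 2 ^ 2" where
  "sigma_y = vector [vector [0, - \<i>], vector [\<i>, 0]]"

definition sigma_z :: "complex ^ 2 ^ 2" where
  "sigma_z = vector [vector [1, 0], vector [0, - 1]]"

definition Y_rot :: "real \<Rightarrow> complex ^ 2 ^ 2" where
  "Y_rot \<xi> = mat_exp (\<chi> j k. \<i> * complex_of_real \<xi> * sigma_y $ j $ k)"

definition Z_rot :: "real \<Rightarrow> complex ^ 2 ^ 2" where
  "Z_rot \<xi> = mat_exp (\<chi> j k. \<i> * complex_of_real \<xi> * sigma_z $ j $ k)"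

section \<open>Classes of three-qubit states\<close>

definition truly_tripartite_entangled :: "three_qubit \<Rightarrow> bool" where
  "truly_tripartite_entangled \<psi> \<longleftrightarrow>
     \<not> (\<exists>(u :: qubit) (v :: two_qubit). \<forall>i j k. \<psi> $ (i, j, k) = u $ i * v $ (j, k)) \<and>
     \<not> (\<exists>(u :: qubit) (v :: two_qubit). \<forall>i j k. \<psi> $ (i, j, k) = u $ j * v $ (i, k)) \<and>
     \<not> (\<exists>(u :: qubit) (v :: two_qubit). \<forall>i j k. \<psi> $ (i, j, k) = u $ k * v $ (i, j))"

definition LU_equivalent :: "three_qubit \<Rightarrow> three_qubit \<Rightarrow> bool" where
  "LU_equivalent \<psi> \<psi>' \<longleftrightarrow>
     (\<exists>V\<^sub>1 V\<^sub>2 V\<^sub>3 :: complex ^ 2 ^ 2. unitary V\<^sub>1 \<and> unitary V\<^sub>2 \<and> unitary V\<^sub>3 \<and>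
        \<psi>' = (V\<^sub>1 \<otimes>\<^sub>m V\<^sub>2 \<otimes>\<^sub>m V\<^sub>3) *v \<psi>)"

definition W_class :: "three_qubit set" where
  "W_class = {\<psi>. norm \<psi> = 1 \<and> truly_tripartite_entangled \<psi> \<and>
     (\<exists>A\<^sub>1 A\<^sub>2 A\<^sub>3 :: complex ^ 2 ^ 2. invertible A\<^sub>1 \<and> invertible A\<^sub>2 \<and> invertible A\<^sub>3 \<and>
        \<psi> = (A\<^sub>1 \<otimes>\<^sub>m A\<^sub>2 \<otimes>\<^sub>m A\<^sub>3) *v
              (ket0 \<otimes>\<^sub>v ket0 \<otimes>\<^sub>v ket1 + ket0 \<otimes>\<^sub>v ket1 \<otimes>\<^sub>v ket0 + ket1 \<otimes>\<^sub>v ket0 \<otimes>\<^sub>v ket0))}"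

section \<open>Decompositions\<close>

definition psi_s :: "real \<Rightarrow> real \<Rightarrow> two_qubit" where
  "psi_s a b = complex_of_real a *s (ket0 \<otimes>\<^sub>v ket0) + complex_of_real b *s (ket1 \<otimes>\<^sub>v ket1)"

definition is_decomposition ::
    "three_qubit \<Rightarrow> real \<Rightarrow> real \<Rightarrow> real \<Rightarrow> real \<Rightarrow> real \<Rightarrow> real \<Rightarrow> bool" where
  "is_decomposition \<psi> a b \<alpha> \<beta> \<gamma> \<beta>' \<longleftrightarrow>
     a \<ge> b \<and> b \<ge> 0 \<and> a\<^sup>2 + b\<^sup>2 = 1 \<and>
     \<alpha> \<in> {- pi / 2 <.. pi / 2} \<and> \<gamma> \<in> {- pi / 2 <.. pi / 2} \<and>
     \<beta> \<in> {0 .. pi / 2} \<and> \<beta>' \<in> {0 .. pi / 2} \<and>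
     (let U\<^sub>2 = Z_rot \<alpha> ** Y_rot \<beta> ** Z_rot \<gamma>; U\<^sub>3 = Y_rot \<beta>' in
      LU_equivalent \<psi>
        ((1 / sqrt 2) *\<^sub>R
           (ket0 \<otimes>\<^sub>v psi_s a b + ket1 \<otimes>\<^sub>v ((U\<^sub>2 \<otimes>\<^sub>m U\<^sub>3) *v psi_s a b))))"

section \<open>Entropy and concurrence\<close>

text \<open>
  \<open>- tr (\<rho> log\<^sub>2 \<rho>)\<close> for a density matrix \<open>\<rho>\<close>, as a sum over its (real) eigenvalues weighted by the
  dimensions of the eigenspaces. The eigenvalue \<open>0\<close> contributes \<open>0\<close>.
\<close>

definition von_neumann_entropy :: "complex ^ 'a::finite ^ 'a \<Rightarrow> real" where
  "von_neumann_entropy \<rho> =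
     - (\<Sum>l \<in> {l :: real. \<exists>v. v \<noteq> 0 \<and> \<rho> *v v = complex_of_real l *s v}.
          real (vec.dim {v. \<rho> *v v = complex_of_real l *s v}) * (l * log 2 l))"

text \<open>The two one-qubit reduced states of a pure state have equal entropy.\<close>

definition entanglement :: "two_qubit \<Rightarrow> real" where
  "entanglement \<phi> = von_neumann_entropy (partial_trace_fst (ketbra \<phi>))"

definition concurrence :: "two_qubit \<Rightarrow> real" where
  "concurrence \<phi> = cmod (braket ((sigma_y \<otimes>\<^sub>m sigma_y) *v conj_vec \<phi>) \<phi>)"

text \<open>Since \<^term>\<open>log 2 0 = (0::real)\<close>, this has the conventional values at \<open>0\<close> and \<open>1\<close>.\<close>

definition binary_entropy :: "real \<Rightarrow> real" where
  "binary_entropy x = - x * log 2 x - (1 - x) * log 2 (1 - x)"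

definition EoC :: "real \<Rightarrow> real" where
  "EoC C = binary_entropy ((1 + sqrt (1 - C\<^sup>2)) / 2)"

definition rho23 :: "three_qubit \<Rightarrow> complex ^ (2 \<times> 2) ^ (2 \<times> 2)" where
  "rho23 \<psi> = partial_trace_fst (ketbra \<psi>)"

definition pure_ensemble ::
    "complex ^ 'a::finite ^ 'a \<Rightarrow> nat \<Rightarrow> (nat \<Rightarrow> real) \<Rightarrow> (nat \<Rightarrow> complex ^ 'a) \<Rightarrow> bool" where
  "pure_ensemble \<rho> n p \<phi> \<longleftrightarrow>
     (\<forall>j<n. p j \<ge> 0 \<and> norm (\<phi> j) = 1) \<and> (\<Sum>j<n. p j) = 1 \<and>
     \<rho> = (\<Sum>j<n. p j *\<^sub>R ketbra (\<phi> j))"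

definition average_concurrences :: "complex ^ (2 \<times> 2) ^ (2 \<times> 2) \<Rightarrow> real set" where
  "average_concurrences \<rho> = {\<Sum>j<n. p j * concurrence (\<phi> j) | n p \<phi>. pure_ensemble \<rho> n p \<phi>}"

definition C23 :: "three_qubit \<Rightarrow> real" where
  "C23 \<psi> = (LEAST C. C \<in> average_concurrences (rho23 \<psi>))"

definition C23a :: "three_qubit \<Rightarrow> real" where
  "C23a \<psi> = (GREATEST C. C \<in> average_concurrences (rho23 \<psi>))"

section \<open>Normal forms\<close>

definition real_unit_vec :: "qubit \<Rightarrow> bool" where
  "real_unit_vec \<phi> \<longleftrightarrow> norm \<phi> = 1 \<and> (\<forall>i. \<phi> $ i \<in> \<real>)"

text \<open>
  \<open>|\<psi>\<rangle> \<propto> |000\<rangle> + z|\<phi>\<^sub>1\<phi>\<^sub>2\<phi>\<^sub>3\<rangle>\<close> for some real unit vectors \<open>\<phi>\<^sub>i\<close>. Here \<^const>\<open>sgn\<close> normalizes; on the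
  zero vector it yields \<open>0\<close>, to which no unit vector is LU-equivalent.
\<close>

definition propto_form :: "three_qubit \<Rightarrow> complex \<Rightarrow> bool" where
  "propto_form \<psi> z \<longleftrightarrow>
     (\<exists>\<phi>\<^sub>1 \<phi>\<^sub>2 \<phi>\<^sub>3. real_unit_vec \<phi>\<^sub>1 \<and> real_unit_vec \<phi>\<^sub>2 \<and> real_unit_vec \<phi>\<^sub>3 \<and>
        LU_equivalent \<psi>
          (sgn (ket0 \<otimes>\<^sub>v ket0 \<otimes>\<^sub>v ket0 + z *s (\<phi>\<^sub>1 \<otimes>\<^sub>v \<phi>\<^sub>2 \<otimes>\<^sub>v \<phi>\<^sub>3))))"

end

theory Submission
  imports Defs
begin

text \<open>
  Write \<open>\<psi>\<close> as \<open>|0\<rangle>u + |1\<rangle>v\<close>. The concurrence is the modulus of the quadratic form \<open>2 det\<close> on two-qubit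
  vectors, and the bipartite states that measurements of qubit 1 leave behind span the pencil of \<open>u\<close>, \<open>v\<close>.
  A unitary on qubit 1 brings the form on this pencil to \<open>diag(l, m)\<close> with \<open>l, m \<ge> 0\<close> (Takagi), whence
  \<open>C\<^sub>2\<^sub>3 = |l - m|\<close> and \<open>C\<^sub>2\<^sub>3\<^sup>a = l + m\<close>. A decomposition with \<open>E\<^sub>1 = EoC(C)\<close> is a two-element ensemble with
  probabilities \<open>1/2\<close> and both concurrences equal to \<open>C\<close>. Equality in the triangle inequality fixes the
  phases and moduli of the coefficients of such an ensemble when \<open>C = l + m\<close> or \<open>C = |l - m|\<close>, and what remains of
  the norm condition is \<open>Re \<langle>u|v\<rangle> = 0\<close> or \<open>Im \<langle>u|v\<rangle> = 0\<close>, respectively. The two product vectors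
  \<open>\<surd>m u \<plusminus> i \<surd>l v\<close> of the pencil turn these conditions into the normal forms; the two vectors coincide iff \<open>l m = 0\<close>, which is
  the W-class.
\<close>

text \<open>The Takagi basis need not be unique, and this shapes the proof. If l and m are positive
  and distinct, it is fixed up to signs and order. If l = m, every real rotation of (u, v) gives
  another one; it preserves Im <u|v> but moves Re <u|v>, and some rotation makes Re <u|v> vanish. So
  the condition for C = l + m has an exception at l = m, which disappears once a basis with Re <u|v>
  = 0 is chosen in advance. Different Takagi forms of one state are compared only through |l - m|
  and l + m, which the state determines as its two concurrences. Both members of the ensemble are
  needed: the moduli of a 2x2 unitary satisfy |r| = |q| and |s| = |p|, so the triangle inequalities
  for the second vector bound the weights |p|^2, |q|^2 from the other side. Re <u|v> = 0 makes the
  overlap of the two product vectors real, hence the coefficient z real; Im <u|v> = 0 makes their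
  norms equal, hence |z| = 1. Both together leave z = 1 or z = -1, and the sign can be moved into a
  factor. In the W-class one of l, m is 0, the relative phase does not affect the concurrence, and
  it is spent on the norm condition.\<close>

lemma sum_prod_UNIV:
  "(\<Sum>i\<in>UNIV. f i) = (\<Sum>i\<in>UNIV. \<Sum>j\<in>UNIV. f (i :: 'a::finite, j :: 'b::finite))"
  by (simp add: sum.cartesian_product flip: UNIV_Times_UNIV)

lemma sum_two_qubit:
  "(\<Sum>i\<in>UNIV. f (i :: 2 \<times> 2)) = f (1,1) + f (1,2) + f (2,1) + (f (2,2) :: 'b::ab_group_add)"
  by (simp add: sum_prod_UNIV sum_2)

lemma two_qubit_eq_iff:
  "(u :: two_qubit) = v \<longleftrightarrow> u $ (1,1) = v $ (1,1) \<and> u $ (1,2) = v $ (1,2) \<and>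
     u $ (2,1) = v $ (2,1) \<and> u $ (2,2) = v $ (2,2)"
  by (auto simp: vec_eq_iff forall_2)

section \<open>Inner products, tensor products and unitaries\<close>

lemma braket_self: "braket v v = complex_of_real ((norm v)\<^sup>2)"
  by (simp add: braket_def norm_vec_def L2_set_def sum_nonneg complex_norm_square mult.commute
      flip: of_real_power)

lemma braket_add_left: "braket (u + v) w = braket u w + braket v w"
  by (simp add: braket_def distrib_right sum.distrib)

lemma braket_add_right: "braket w (u + v) = braket w u + braket w v"
  by (simp add: braket_def distrib_left sum.distrib)

lemma braket_scale_left: "braket (a *s u) w = cnj a * braket u w"
  by (simp add: braket_def sum_distrib_left mult_ac)

lemma braket_scale_right: "braket w (a *s u) = a * braket w u"
  by (simp add: braket_def sum_distrib_left mult_ac)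

lemma braket_commute: "braket v u = cnj (braket u v)"
  by (simp add: braket_def mult.commute)

text \<open>The relative phase of the coefficients enters the norm only through the cross term; the
  balance conditions on the real or imaginary part of \<open>braket u v\<close> originate
  here.\<close>

lemma norm_square_add_scaled:
  "(norm (a *s u + b *s v))\<^sup>2 =
     (cmod a)\<^sup>2 * (norm u)\<^sup>2 + (cmod b)\<^sup>2 * (norm v)\<^sup>2 + 2 * Re (cnj a * b * braket u v)"
proof -
  have "complex_of_real ((norm (a *s u + b *s v))\<^sup>2) = braket (a *s u + b *s v) (a *s u + b *s v)"
    by (simp only: braket_self)
  also have "\<dots> = a * cnj a * braket u u + b * cnj b * braket v v +
      (cnj a * b * braket u v + cnj (cnj a * b * braket u v))"
    by (simp add: braket_add_left braket_add_right braket_scale_left braket_scale_right braket_commute[of v u] algebra_simps)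
  also have "\<dots> = complex_of_real ((cmod a)\<^sup>2 * (norm u)\<^sup>2 + (cmod b)\<^sup>2 * (norm v)\<^sup>2) +
      (cnj a * b * braket u v + cnj (cnj a * b * braket u v))"
    by (simp only: braket_self complex_norm_square of_real_add of_real_mult)
  also have "\<dots> = complex_of_real ((cmod a)\<^sup>2 * (norm u)\<^sup>2 + (cmod b)\<^sup>2 * (norm v)\<^sup>2 +
      2 * Re (cnj a * b * braket u v))"
    by (subst complex_add_cnj) simp
  finally show ?thesis
    by (simp only: of_real_eq_iff)
qed

lemma norm_vscale: "norm (a *s (v :: complex ^ 'n::finite)) = cmod a * norm v"
  by (simp add: norm_vec_def norm_mult L2_set_right_distrib)

lemma braket_matrix: "braket (A *v u) v = braket u (mat_adjoint A *v v)"
proof -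
  have "braket (A *v u) v = (\<Sum>i\<in>UNIV. \<Sum>j\<in>UNIV. cnj (A $ i $ j) * cnj (u $ j) * v $ i)"
    by (simp add: braket_def matrix_vector_mult_def sum_distrib_right)
  also have "\<dots> = (\<Sum>j\<in>UNIV. \<Sum>i\<in>UNIV. cnj (A $ i $ j) * cnj (u $ j) * v $ i)"
    by (rule sum.swap)
  finally show ?thesis
    by (simp add: braket_def matrix_vector_mult_def mat_adjoint_def sum_distrib_left mult_ac)
qed

lemma braket_unitary: "unitary U \<Longrightarrow> braket (U *v u) (U *v v) = braket u v"
  by (simp add: braket_matrix matrix_vector_mul_assoc unitary_def)

lemma norm_unitary:
  assumes "unitary U" shows "norm (U *v u) = norm u"
proof -
  have "complex_of_real ((norm (U *v u))\<^sup>2) = complex_of_real ((norm u)\<^sup>2)"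
    using braket_unitary[OF assms, of u u] by (simp add: braket_self)
  then show ?thesis
    by (simp only: of_real_eq_iff power2_eq_iff_nonneg norm_ge_zero)
qed

lemma mat_adjoint_mult: "mat_adjoint (A ** B) = mat_adjoint B ** mat_adjoint A"
  by (simp add: mat_adjoint_def matrix_matrix_mult_def mult.commute)

lemma mat_adjoint_mat_adjoint [simp]: "mat_adjoint (mat_adjoint A) = A"
  by (simp add: mat_adjoint_def)

lemma mat_adjoint_one [simp]: "mat_adjoint (mat 1) = mat 1"
  by (simp add: mat_adjoint_def mat_def vec_eq_iff)

lemma unitary_one [simp]: "unitary (mat 1)"
  by (simp add: unitary_def)

lemma unitary_mult: "unitary A \<Longrightarrow> unitary B \<Longrightarrow> unitary (A ** B)"
  unfolding unitary_def mat_adjoint_mult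
  by (metis matrix_mul_assoc matrix_mul_rid)

lemma unitary_adjoint: "unitary A \<Longrightarrow> unitary (mat_adjoint A)"
  by (simp add: unitary_def)

lemma mat_tensor_mult: "(A \<otimes>\<^sub>m B) ** (C \<otimes>\<^sub>m D) = (A ** C) \<otimes>\<^sub>m (B ** D)"
  by (simp add: mat_tensor_def matrix_matrix_mult_def vec_eq_iff sum_prod_UNIV sum_product mult_ac)

lemma mat_tensor_vec_tensor: "(A \<otimes>\<^sub>m B) *v (u \<otimes>\<^sub>v v) = (A *v u) \<otimes>\<^sub>v (B *v v)"
  by (simp add: mat_tensor_def vec_tensor_def matrix_vector_mult_def vec_eq_iff sum_prod_UNIV
      sum_product mult_ac)

lemma mat_tensor_one [simp]: "mat 1 \<otimes>\<^sub>m mat 1 = mat 1"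
  by (auto simp: mat_tensor_def mat_def vec_eq_iff prod_eq_iff)

lemma mat_adjoint_tensor: "mat_adjoint (A \<otimes>\<^sub>m B) = mat_adjoint A \<otimes>\<^sub>m mat_adjoint B"
  by (simp add: mat_adjoint_def mat_tensor_def vec_eq_iff)

lemma unitary_tensor: "unitary A \<Longrightarrow> unitary B \<Longrightarrow> unitary (A \<otimes>\<^sub>m B)"
  by (simp add: unitary_def mat_adjoint_tensor mat_tensor_mult)

lemma LU_equivalent_trans:
  assumes "LU_equivalent \<psi> \<psi>'" "LU_equivalent \<psi>' \<psi>''" shows "LU_equivalent \<psi> \<psi>''"
proof -
  obtain A B C where A: "unitary A" "unitary B" "unitary C" "\<psi>' = (A \<otimes>\<^sub>m B \<otimes>\<^sub>m C) *v \<psi>"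
    using assms(1) unfolding LU_equivalent_def by blast
  obtain A' B' C' where
    A': "unitary A'" "unitary B'" "unitary C'" "\<psi>'' = (A' \<otimes>\<^sub>m B' \<otimes>\<^sub>m C') *v \<psi>'"
    using assms(2) unfolding LU_equivalent_def by blast
  have eq: "\<psi>'' = ((A' ** A) \<otimes>\<^sub>m (B' ** B) \<otimes>\<^sub>m (C' ** C)) *v \<psi>"
    using A A' by (simp add: matrix_vector_mul_assoc mat_tensor_mult)
  show ?thesis
    unfolding LU_equivalent_def
    by (intro exI conjI, rule unitary_mult[OF A'(1) A(1)], rule unitary_mult[OF A'(2) A(2)],
        rule unitary_mult[OF A'(3) A(3)], rule eq)
qed

lemma LU_equivalent_sym:
  assumes "LU_equivalent \<psi> \<psi>'" shows "LU_equivalent \<psi>' \<psi>"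
proof -
  obtain A B C where A: "unitary A" "unitary B" "unitary C" "\<psi>' = (A \<otimes>\<^sub>m B \<otimes>\<^sub>m C) *v \<psi>"
    using assms(1) unfolding LU_equivalent_def by blast
  then have "\<psi> = (mat_adjoint A \<otimes>\<^sub>m mat_adjoint B \<otimes>\<^sub>m mat_adjoint C) *v \<psi>'"
    by (simp add: matrix_vector_mul_assoc mat_tensor_mult unitary_def)
  then show ?thesis
    unfolding LU_equivalent_def using A unitary_adjoint by blast
qed

lemma norm_LU: "LU_equivalent \<psi> \<psi>' \<Longrightarrow> norm \<psi>' = norm \<psi>"
  unfolding LU_equivalent_def using norm_unitary unitary_tensor by metis

section \<open>Two-by-two matrices\<close>

definition mat22 :: "complex \<Rightarrow> complex \<Rightarrow> complex \<Rightarrow> complex \<Rightarrow> complex ^ 2 ^ 2" where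
  "mat22 a b c d = (\<chi> i j. if i = 1 then (if j = 1 then a else b) else (if j = 1 then c else d))"

lemma mat22_nth [simp]:
  "mat22 a b c d $ 1 $ 1 = a \<and> mat22 a b c d $ 1 $ 2 = b \<and>
   mat22 a b c d $ 2 $ 1 = c \<and> mat22 a b c d $ 2 $ 2 = d"
  by (simp add: mat22_def)

lemma mat22_eqI:
  assumes "A $ 1 $ 1 = a" "A $ 1 $ 2 = b" "A $ 2 $ 1 = c" "A $ 2 $ 2 = d"
  shows "A = mat22 a b c d"
  using assms by (simp add: vec_eq_iff forall_2)

lemma mat22_cases: obtains a b c d where "A = mat22 a b c d"
  using mat22_eqI by blast

lemma mat22_eq_iff: "mat22 a b c d = mat22 a' b' c' d' \<longleftrightarrow> a = a' \<and> b = b' \<and> c = c' \<and> d = d'"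
  by (auto dest: arg_cong[of _ _ "\<lambda>A. A $ _ $ _"] simp: vec_eq_iff forall_2)

lemma mat22_one: "mat 1 = mat22 1 0 0 1"
  by (rule mat22_eqI) (simp_all add: mat_def)

lemma mat22_mult: "mat22 a b c d ** mat22 a' b' c' d' =
    mat22 (a * a' + b * c') (a * b' + b * d') (c * a' + d * c') (c * b' + d * d')"
  by (rule mat22_eqI) (simp_all add: matrix_matrix_mult_def sum_2)

lemma mat22_adjoint: "mat_adjoint (mat22 a b c d) = mat22 (cnj a) (cnj c) (cnj b) (cnj d)"
  by (rule mat22_eqI) (simp_all add: mat_adjoint_def)

lemma det_mat22: "det (mat22 a b c d) = a * d - b * c"
  by (simp add: det_2)

lemma mat22_mult_vec_nth:
  "(mat22 a b c d *v v) $ 1 = a * v $ 1 + b * v $ 2 \<and>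
   (mat22 a b c d *v v) $ 2 = c * v $ 1 + d * v $ 2"
  by (simp add: matrix_vector_mult_def sum_2)

lemma unitary_mat22_iff:
  "unitary (mat22 a b c d) \<longleftrightarrow>
     (cmod a)\<^sup>2 + (cmod b)\<^sup>2 = 1 \<and> (cmod c)\<^sup>2 + (cmod d)\<^sup>2 = 1 \<and> a * cnj c + b * cnj d = 0"
proof -
  have sq: "z * cnj z + w * cnj w = 1 \<longleftrightarrow> (cmod z)\<^sup>2 + (cmod w)\<^sup>2 = 1" for z w
  proof -
    have "z * cnj z + w * cnj w = complex_of_real ((cmod z)\<^sup>2 + (cmod w)\<^sup>2)"
      by (simp only: complex_norm_square of_real_add)
    then show ?thesis by (metis of_real_1 of_real_eq_iff)
  qed
  have cj: "c * cnj a + d * cnj b = 0 \<longleftrightarrow> a * cnj c + b * cnj d = 0"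
  proof -
    have "c * cnj a + d * cnj b = cnj (a * cnj c + b * cnj d)"
      by (simp add: mult.commute)
    then show ?thesis by (simp only: complex_cnj_zero_iff)
  qed
  have "unitary (mat22 a b c d) \<longleftrightarrow> mat22 a b c d ** mat_adjoint (mat22 a b c d) = mat 1"
    by (auto simp: unitary_def matrix_left_right_inverse)
  also have "\<dots> \<longleftrightarrow> a * cnj a + b * cnj b = 1 \<and> c * cnj c + d * cnj d = 1 \<and> a * cnj c + b * cnj d = 0"
    by (auto simp: mat22_adjoint mat22_mult mat22_one mat22_eq_iff cj)
  finally show ?thesis by (simp add: sq)
qed

lemma unitary_mat22_SU:
  "(cmod a)\<^sup>2 + (cmod b)\<^sup>2 = 1 \<Longrightarrow> unitary (mat22 a b (- cnj b) (cnj a))"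
  by (simp add: unitary_mat22_iff add.commute)

lemma unitary_mat22_real:
  "unitary (mat22 (complex_of_real (cos t)) (complex_of_real (sin t))
     (- complex_of_real (sin t)) (complex_of_real (cos t)))"
  using unitary_mat22_SU[of "complex_of_real (cos t)" "complex_of_real (sin t)"]
  by (simp)

lemma cmod_det_unitary:
  assumes "unitary (A :: complex ^ 2 ^ 2)" shows "cmod (det A) = 1"
proof -
  obtain a b c d where A: "A = mat22 a b c d" by (rule mat22_cases)
  have "det (mat_adjoint A) = cnj (det A)"
    by (simp add: A mat22_adjoint det_mat22 mult.commute)
  then have "det A * cnj (det A) = 1"
    using assms by (metis det_I det_mul unitary_def)
  then have "complex_of_real ((cmod (det A))\<^sup>2) = 1"
    by (simp only: complex_norm_square)
  then have "(cmod (det A))\<^sup>2 = 1"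
    by (metis of_real_1 of_real_eq_iff)
  then show ?thesis
    by (simp add: power2_eq_1_iff) (smt (verit) norm_ge_zero)
qed

text \<open>The adjoint is unitary too, so columns as well as rows have norm one. This lets
  estimates for the second member of an ensemble be read as estimates for the coefficients of the
  first.\<close>

lemma unitary_mat22_second_row:
  assumes "unitary (mat22 a b c d)"
  shows "(cmod c)\<^sup>2 = (cmod b)\<^sup>2 \<and> (cmod d)\<^sup>2 = (cmod a)\<^sup>2"
proof -
  have "unitary (mat_adjoint (mat22 a b c d))" using assms by (rule unitary_adjoint)
  then have "(cmod a)\<^sup>2 + (cmod c)\<^sup>2 = 1" "(cmod b)\<^sup>2 + (cmod d)\<^sup>2 = 1"
    by (auto simp: mat22_adjoint unitary_mat22_iff)
  moreover have "(cmod a)\<^sup>2 + (cmod b)\<^sup>2 = 1"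
    using assms by (simp add: unitary_mat22_iff)
  ultimately show "(cmod c)\<^sup>2 = (cmod b)\<^sup>2 \<and> (cmod d)\<^sup>2 = (cmod a)\<^sup>2"
    by (intro conjI; linarith)
qed

section \<open>Pencils\<close>

text \<open>The vectors \<open>u\<close>, \<open>v\<close> are the unnormalized states of qubits 2,
  3 after a measurement of qubit 1. A unitary on qubit 1 only recombines the pair, and one on qubits
  2, 3 acts on both members alike.\<close>

definition pencil :: "two_qubit \<Rightarrow> two_qubit \<Rightarrow> three_qubit" where
  "pencil u v = ket0 \<otimes>\<^sub>v u + ket1 \<otimes>\<^sub>v v"

lemma ket_nth [simp]: "ket0 $ 1 = 1 \<and> ket0 $ 2 = 0 \<and> ket1 $ 1 = 0 \<and> ket1 $ 2 = 1"
  by (simp add: ket0_def ket1_def axis_def)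

lemma pencil_nth [simp]: "pencil u v $ (1, jk) = u $ jk \<and> pencil u v $ (2, jk) = v $ jk"
  by (simp add: pencil_def vec_tensor_def)

lemma pencil_eqI:
  assumes "\<And>jk. \<psi> $ (1, jk) = u $ jk" "\<And>jk. \<psi> $ (2, jk) = v $ jk" shows "\<psi> = pencil u v"
  using assms by (simp add: vec_eq_iff forall_2 split_paired_all)

lemma pencil_cases: obtains u v where "\<psi> = pencil u v"
  by (rule that[of "\<chi> jk. \<psi> $ (1, jk)" "\<chi> jk. \<psi> $ (2, jk)"], rule pencil_eqI) simp_all

lemma tensor_pencil:
  "(mat22 p q r s \<otimes>\<^sub>m W) *v pencil u v =
     pencil (p *s (W *v u) + q *s (W *v v)) (r *s (W *v u) + s *s (W *v v))"
  by (rule pencil_eqI)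
    (simp_all add: matrix_vector_mult_def mat_tensor_def sum_prod_UNIV sum_2 sum_distrib_left
      algebra_simps)

lemma LU_pencilI:
  assumes "unitary (mat22 p q r s)" "unitary V" "unitary W"
  shows "LU_equivalent (pencil u v)
    (pencil (p *s ((V \<otimes>\<^sub>m W) *v u) + q *s ((V \<otimes>\<^sub>m W) *v v))
            (r *s ((V \<otimes>\<^sub>m W) *v u) + s *s ((V \<otimes>\<^sub>m W) *v v)))"
  unfolding LU_equivalent_def using assms tensor_pencil by metis

lemma LU_pencilI1:
  assumes "unitary (mat22 p q r s)"
  shows "LU_equivalent (pencil u v) (pencil (p *s u + q *s v) (r *s u + s *s v))"
  using LU_pencilI[OF assms unitary_one unitary_one] by simp

lemma LU_pencilE:
  assumes "LU_equivalent (pencil u v) \<psi>"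
  obtains p q r s V W where "unitary (mat22 p q r s)" "unitary V" "unitary W"
    "\<psi> = pencil (p *s ((V \<otimes>\<^sub>m W) *v u) + q *s ((V \<otimes>\<^sub>m W) *v v))
            (r *s ((V \<otimes>\<^sub>m W) *v u) + s *s ((V \<otimes>\<^sub>m W) *v v))"
  using assms unfolding LU_equivalent_def by (metis mat22_cases tensor_pencil)

lemma norm_pencil: "(norm (pencil u v))\<^sup>2 = (norm u)\<^sup>2 + (norm v)\<^sup>2"
  by (simp add: norm_vec_def L2_set_def sum_nonneg sum_prod_UNIV[of "\<lambda>i. (cmod (pencil u v $ i))\<^sup>2"] sum_2)

section \<open>The concurrence form\<close>

text \<open>The polarization of 2 det, a two-qubit vector being read as a 2x2 matrix. It is
  bilinear, not sesquilinear, so a unitary change of basis acts on it by congruence; hence Takagi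
  and not the spectral theorem.\<close>

definition cform :: "two_qubit \<Rightarrow> two_qubit \<Rightarrow> complex" where
  "cform u v = u $ (1,1) * v $ (2,2) + u $ (2,2) * v $ (1,1) - u $ (1,2) * v $ (2,1) - u $ (2,1) * v $ (1,2)"

lemma cform_add_left: "cform (u + v) w = cform u w + cform v w"
  by (simp add: cform_def algebra_simps)

lemma cform_add_right: "cform w (u + v) = cform w u + cform w v"
  by (simp add: cform_def algebra_simps)

lemma cform_scale_left: "cform (a *s u) w = a * cform u w"
  by (simp add: cform_def algebra_simps)

lemma cform_scale_right: "cform w (a *s u) = a * cform w u"
  by (simp add: cform_def algebra_simps)

lemma cform_commute: "cform v u = cform u v"
  by (simp add: cform_def algebra_simps)

lemma cform_lincomb:
  "cform (a *s u + b *s v) (c *s u + d *s v) =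
     a * c * cform u u + (a * d + b * c) * cform u v + b * d * cform v v"
  by (simp add: cform_add_left cform_add_right cform_scale_left cform_scale_right cform_commute[of v u] algebra_simps)

text \<open>The conjugation in the spin flip cancels the one in \<open>braket\<close>, which leaves
  a bilinear form; the sign disappears in the modulus.\<close>

lemma concurrence_cform: "concurrence \<phi> = cmod (cform \<phi> \<phi>)"
proof -
  have "braket ((sigma_y \<otimes>\<^sub>m sigma_y) *v conj_vec \<phi>) \<phi> = - cform \<phi> \<phi>"
    by (simp add: braket_def matrix_vector_mult_def mat_tensor_def conj_vec_def sum_two_qubit
        sigma_y_def cform_def algebra_simps)
  then show ?thesis by (simp add: concurrence_def)
qed

text \<open>On 2x2 matrices the local action is M to A M B^T, and determinants multiply. Local
  unitaries thus change the form by a common phase only.\<close>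

lemma cform_tensor: "cform ((A \<otimes>\<^sub>m B) *v u) ((A \<otimes>\<^sub>m B) *v v) = det A * det B * cform u v"
proof -
  have left: "cform ((A \<otimes>\<^sub>m mat 1) *v u) ((A \<otimes>\<^sub>m mat 1) *v v) = det A * cform u v" for A u v
    by (simp add: matrix_vector_mult_def mat_tensor_def sum_two_qubit mat_def cform_def det_2)
      (simp add: algebra_simps)
  have right: "cform ((mat 1 \<otimes>\<^sub>m B) *v u) ((mat 1 \<otimes>\<^sub>m B) *v v) = det B * cform u v" for B u v
    by (simp add: matrix_vector_mult_def mat_tensor_def sum_two_qubit mat_def cform_def det_2)
      (simp add: algebra_simps)
  have "A \<otimes>\<^sub>m B = (A \<otimes>\<^sub>m mat 1) ** (mat 1 \<otimes>\<^sub>m B)"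
    by (simp add: mat_tensor_mult)
  then show ?thesis
    by (simp add: left right flip: matrix_vector_mul_assoc)
qed

text \<open>The inequality 2xy \<le> x^2 + y^2 for each of the two products in the determinant. It
  keeps l + m in the interval on which \<open>EoC\<close> is injective.\<close>

lemma cmod_cform_le: "cmod (cform u u) \<le> (norm u)\<^sup>2"
proof -
  let ?a = "u $ (1,1)" and ?b = "u $ (1,2)" and ?c = "u $ (2,1)" and ?d = "u $ (2,2)"
  have "cform u u = 2 * (?a * ?d - ?b * ?c)"
    by (simp add: cform_def)
  then have "cmod (cform u u) = 2 * cmod (?a * ?d - ?b * ?c)"
    by (metis norm_mult norm_numeral)
  also have "\<dots> \<le> 2 * (cmod (?a * ?d) + cmod (?b * ?c))"
    by (intro mult_left_mono norm_triangle_ineq4) simp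
  also have "\<dots> = 2 * cmod ?a * cmod ?d + 2 * cmod ?b * cmod ?c"
    by (simp add: norm_mult)
  also have "\<dots> \<le> ((cmod ?a)\<^sup>2 + (cmod ?d)\<^sup>2) + ((cmod ?b)\<^sup>2 + (cmod ?c)\<^sup>2)"
    by (intro add_mono sum_squares_bound)
  also have "\<dots> = (norm u)\<^sup>2"
    by (simp add: norm_vec_def L2_set_def sum_nonneg sum_two_qubit)
  finally show ?thesis .
qed

lemma cform_vec_tensor:
  "cform (f \<otimes>\<^sub>v g) (f' \<otimes>\<^sub>v g') = (f $ 1 * f' $ 2 - f $ 2 * f' $ 1) * (g $ 1 * g' $ 2 - g $ 2 * g' $ 1)"
  by (simp add: cform_def vec_tensor_def algebra_simps)

lemma braket_vec_tensor: "braket (f \<otimes>\<^sub>v g) (f' \<otimes>\<^sub>v g') = braket f f' * braket g g'"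
  by (simp add: braket_def vec_tensor_def sum_prod_UNIV sum_product mult_ac)

lemma norm_vec_tensor: "norm (f \<otimes>\<^sub>v g) = norm f * norm g"
proof -
  have "complex_of_real ((norm (f \<otimes>\<^sub>v g))\<^sup>2) = complex_of_real ((norm f * norm g)\<^sup>2)"
    using braket_vec_tensor[of f g f g] by (simp add: braket_self power_mult_distrib)
  then show ?thesis
    by (simp only: of_real_eq_iff power2_eq_iff_nonneg norm_ge_zero mult_nonneg_nonneg)
qed

lemma cform_self_zeroE:
  assumes "cform u u = 0" obtains f g where "u = f \<otimes>\<^sub>v g"
proof -
  have det: "u $ (1,1) * u $ (2,2) = u $ (1,2) * u $ (2,1)"
    using assms by (simp add: cform_def)
  show thesis
  proof (cases "u $ (1,1) = 0 \<and> u $ (1,2) = 0")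
    case True
    then show thesis
      by (intro that[of ket1 "vector [u $ (2,1), u $ (2,2)]"])
        (simp add: two_qubit_eq_iff vec_tensor_def)
  next
    case False
    then consider "u $ (1,1) \<noteq> 0" | "u $ (1,2) \<noteq> 0" by blast
    then show thesis
    proof cases
      case 1
      then show thesis using det
        by (intro that[of "vector [1, u $ (2,1) / u $ (1,1)]" "vector [u $ (1,1), u $ (1,2)]"])
          (simp add: two_qubit_eq_iff vec_tensor_def field_simps)
    next
      case 2
      then show thesis using det
        by (intro that[of "vector [1, u $ (2,2) / u $ (1,2)]" "vector [u $ (1,1), u $ (1,2)]"])
          (simp add: two_qubit_eq_iff vec_tensor_def field_simps)
    qed
  qed
qed

section \<open>Takagi form of the concurrence form\<close>

text \<open>Unlike in the usual Takagi factorization, the two singular values are not ordered.\<close>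

definition takagi :: "three_qubit \<Rightarrow> two_qubit \<Rightarrow> two_qubit \<Rightarrow> real \<Rightarrow> real \<Rightarrow> bool" where
  "takagi \<psi> u v l m \<longleftrightarrow> LU_equivalent \<psi> (pencil u v) \<and> l \<ge> 0 \<and> m \<ge> 0 \<and>
     cform u u = complex_of_real l \<and> cform v v = complex_of_real m \<and> cform u v = 0"

lemma braket_lincomb:
  "braket (a *s u + b *s v) (c *s u + d *s v) =
     cnj a * c * complex_of_real ((norm u)\<^sup>2) + cnj a * d * braket u v +
     cnj b * c * cnj (braket u v) + cnj b * d * complex_of_real ((norm v)\<^sup>2)"
  by (simp add: braket_add_left braket_add_right braket_scale_left braket_scale_right braket_commute[of v u] braket_self algebra_simps)

text \<open>A Jacobi rotation: the angle that annihilates an off-diagonal entry. Taking minus half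
  the argument of y + ix avoids a division and a case distinction on y = 0.\<close>

lemma rotation_angle: "\<exists>t :: real. x * cos (2 * t) + y * sin (2 * t) = 0"
proof
  let ?z = "Complex y x"
  have "y = cmod ?z * cos (Arg ?z)" "x = cmod ?z * sin (Arg ?z)"
    by (metis Re_rcis complex.sel(1) rcis_cmod_Arg) (metis Im_rcis complex.sel(2) rcis_cmod_Arg)
  then have "x * cos (2 * (- Arg ?z / 2)) + y * sin (2 * (- Arg ?z / 2)) =
      (cmod ?z * sin (Arg ?z)) * cos (Arg ?z) - (cmod ?z * cos (Arg ?z)) * sin (Arg ?z)"
    by simp
  then show "x * cos (2 * (- Arg ?z / 2)) + y * sin (2 * (- Arg ?z / 2)) = 0"
    by simp
qed

text \<open>Scaling a vector by \<omega> scales its quadratic form by the square of \<omega>, so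
  half the argument has to be removed.\<close>

lemma phase_root: "\<exists>\<omega>. cmod \<omega> = 1 \<and> \<omega>\<^sup>2 * X = complex_of_real (cmod X)"
proof (intro exI conjI)
  let ?\<omega> = "cis (- Arg X / 2)"
  show "cmod ?\<omega> = 1" by simp
  have "?\<omega>\<^sup>2 = cis (- Arg X)"
    by (simp add: power2_eq_square cis_mult)
  moreover have "X = complex_of_real (cmod X) * cis (Arg X)"
    by (metis rcis_cmod_Arg rcis_def)
  ultimately have "?\<omega>\<^sup>2 * X = complex_of_real (cmod X) * (cis (- Arg X) * cis (Arg X))"
    by (metis mult.left_commute)
  then show "?\<omega>\<^sup>2 * X = complex_of_real (cmod X)"
    by (simp add: cis_mult)
qed

lemma LU_pencil_recombine:
  assumes "LU_equivalent \<psi> (pencil u v)" "unitary (mat22 p q r s)"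
  shows "LU_equivalent \<psi> (pencil (p *s u + q *s v) (r *s u + s *s v))"
  using LU_equivalent_trans LU_pencilI1 assms by blast

lemma LU_pencil_phases:
  assumes "LU_equivalent \<psi> (pencil u v)" "cmod \<omega> = 1" "cmod \<omega>' = 1"
  shows "LU_equivalent \<psi> (pencil (\<omega> *s u) (\<omega>' *s v))"
  using LU_pencil_recombine[OF assms(1), of \<omega> 0 0 \<omega>'] assms by (simp add: unitary_mat22_iff)

lemma takagi_swap:
  assumes "takagi \<psi> u v l m" shows "takagi \<psi> v u m l"
proof -
  have "LU_equivalent \<psi> (pencil v u)"
    using LU_pencil_recombine[of \<psi> u v 0 1 1 0] assms by (simp add: takagi_def unitary_mat22_iff)
  then show ?thesis using assms by (simp add: takagi_def cform_commute)
qed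

lemma takagi_of_diagonal:
  assumes "LU_equivalent \<psi> (pencil u v)" "cform u v = 0"
  shows "\<exists>\<omega> \<omega>'. takagi \<psi> (\<omega> *s u) (\<omega>' *s v) (cmod (cform u u)) (cmod (cform v v))"
proof -
  obtain \<omega> where w: "cmod \<omega> = 1" "\<omega>\<^sup>2 * cform u u = complex_of_real (cmod (cform u u))"
    using phase_root by blast
  obtain \<omega>' where w': "cmod \<omega>' = 1" "\<omega>'\<^sup>2 * cform v v = complex_of_real (cmod (cform v v))"
    using phase_root by blast
  have "takagi \<psi> (\<omega> *s u) (\<omega>' *s v) (cmod (cform u u)) (cmod (cform v v))"
    using LU_pencil_phases[OF assms(1) w(1) w'(1)] w(2) w'(2) assms(2)
    by (simp add: takagi_def cform_add_left cform_add_right cform_scale_left cform_scale_right power2_eq_square mult.assoc)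
  then show ?thesis by blast
qed

text \<open>Two real parameters suffice. With p = cos \<theta> and q = w sin \<theta>, the
  off-diagonal entry is B cos 2\<theta> + (K/2) sin 2\<theta>, where K = D w - A cnj w. A real
  \<theta> can annihilate it once K is a real multiple of B, and the relative phase w is chosen for
  that.\<close>

lemma takagi_exists: "\<exists>u v l m. takagi \<psi> u v l m"
proof -
  obtain v\<^sub>0 v\<^sub>1 where psi: "\<psi> = pencil v\<^sub>0 v\<^sub>1" by (rule pencil_cases)
  define A B D where "A = cform v\<^sub>0 v\<^sub>0" and "B = cform v\<^sub>0 v\<^sub>1" and "D = cform v\<^sub>1 v\<^sub>1"
  \<comment> \<open>The left-hand side is the imaginary part of cnj B * K for w = cis (2t), written
    out.\<close>
  obtain t where t: "(Im (cnj B * D) - Im (cnj B * A)) * cos (2 * t) +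
      (Re (cnj B * D) + Re (cnj B * A)) * sin (2 * t) = 0"
    using rotation_angle by blast
  define w where "w = cis (2 * t)"
  have w: "w * cnj w = 1" "cmod w = 1"
    by (simp_all add: w_def cis_cnj cis_mult)
  define K where "K = D * w - A * cnj w"
  have "Im (cnj B * K) = (Im (cnj B * D) - Im (cnj B * A)) * cos (2 * t) +
      (Re (cnj B * D) + Re (cnj B * A)) * sin (2 * t)"
    by (simp add: K_def w_def algebra_simps)
  then have real: "Im (cnj B * K) = 0" using t by simp
  obtain \<theta> :: real where \<theta>: "B * complex_of_real (cos (2 * \<theta>)) + K * complex_of_real (sin (2 * \<theta>) / 2) = 0"
  proof (cases "B = 0")
    case True
    \<comment> \<open>For B = 0 the form is already diagonal, so no rotation is made.\<close>
    then show ?thesis using that[of 0] by simp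
  next
    case False
    define k where "k = Re (cnj B * K) / (cmod B)\<^sup>2"
    have "cnj B * K = complex_of_real (Re (cnj B * K))"
      using real by (simp add: complex_eq_iff)
    then have "complex_of_real ((cmod B)\<^sup>2) * K = B * complex_of_real (Re (cnj B * K))"
      by (simp only: complex_norm_square mult.assoc)
    then have K: "K = B * complex_of_real k"
      using False by (simp add: k_def field_simps)
    obtain \<theta> where "1 * cos (2 * \<theta>) + (k / 2) * sin (2 * \<theta>) = 0"
      using rotation_angle by blast
    then have "B * complex_of_real (1 * cos (2 * \<theta>) + (k / 2) * sin (2 * \<theta>)) = 0" by simp
    then show ?thesis
      by (intro that[of \<theta>]) (simp add: K algebra_simps)
  qed
  define p q where "p = complex_of_real (cos \<theta>)" and "q = complex_of_real (sin \<theta>) * w"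
  have U: "unitary (mat22 p q (- cnj q) (cnj p))"
    by (rule unitary_mat22_SU) (simp add: p_def q_def norm_mult w)
  let ?u = "p *s v\<^sub>0 + q *s v\<^sub>1" and ?v = "- cnj q *s v\<^sub>0 + cnj p *s v\<^sub>1"
  have "cform ?u ?v = - p * cnj q * A + (p * cnj p - q * cnj q) * B + q * cnj p * D"
    unfolding cform_lincomb A_def B_def D_def by simp
  also have "\<dots> = complex_of_real (cos \<theta>) * complex_of_real (sin \<theta>) * K +
      ((complex_of_real (cos \<theta>))\<^sup>2 - (complex_of_real (sin \<theta>))\<^sup>2 * (w * cnj w)) * B"
    by (simp add: p_def q_def K_def algebra_simps power2_eq_square)
  also have "\<dots> = B * complex_of_real (cos (2 * \<theta>)) + K * complex_of_real (sin (2 * \<theta>) / 2)"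
    unfolding cos_double sin_double by (simp add: w algebra_simps)
  finally have "cform ?u ?v = 0" using \<theta> by simp
  moreover have "LU_equivalent \<psi> (pencil ?u ?v)"
    unfolding psi using U by (rule LU_pencilI1)
  ultimately show ?thesis
    using takagi_of_diagonal by blast
qed

text \<open>For l = m the form is a multiple of the identity and every real rotation preserves it.
  Such a rotation acts by congruence on the Gram matrix of (u, v): it can diagonalize the real
  symmetric part, while the imaginary part, being antisymmetric of size two, is invariant.\<close>

lemma takagi_rotate:
  assumes "takagi \<psi> u v l l"
  obtains u' v' where "takagi \<psi> u' v' l l" "Re (braket u' v') = 0" "Im (braket u' v') = Im (braket u v)"
proof -
  obtain t where t: "Re (braket u v) * cos (2 * t) + ((norm v)\<^sup>2 - (norm u)\<^sup>2) / 2 * sin (2 * t) = 0"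
    using rotation_angle by blast
  define c s where "c = complex_of_real (cos t)" and "s = complex_of_real (sin t)"
  define s' where "s' = - s"
  let ?u = "c *s u + s *s v" and ?v = "s' *s u + c *s v"
  have one: "c * c + s * s = 1"
    unfolding c_def s_def by (metis of_real_1 of_real_add of_real_mult sin_cos_squared_add3)
  have "LU_equivalent \<psi> (pencil ?u ?v)"
    using LU_pencil_recombine[OF _ unitary_mat22_real[of t]] assms
    by (simp add: takagi_def c_def s_def s'_def del: vector_smult_lneg)
  moreover have "cform ?u ?u = complex_of_real l" "cform ?v ?v = complex_of_real l" "cform ?u ?v = 0"
    using assms one unfolding cform_lincomb takagi_def s'_def by (simp_all flip: distrib_right add: add.commute)
  ultimately have "takagi \<psi> ?u ?v l l"
    using assms by (simp add: takagi_def)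
  moreover have inner: "braket ?u ?v =
      c * s * (complex_of_real ((norm v)\<^sup>2) - complex_of_real ((norm u)\<^sup>2)) + c * c * braket u v - s * s * cnj (braket u v)"
    unfolding braket_lincomb by (simp add: c_def s_def s'_def algebra_simps)
  have "Re (braket ?u ?v) = cos t * sin t * ((norm v)\<^sup>2 - (norm u)\<^sup>2) + (cos t * cos t - sin t * sin t) * Re (braket u v)"
    and Im: "Im (braket ?u ?v) = cos t * cos t * Im (braket u v) + sin t * sin t * Im (braket u v)"
    unfolding inner by (simp_all add: c_def s_def algebra_simps flip: of_real_mult of_real_power)
  then have "Re (braket ?u ?v) = 0"
    using t unfolding cos_double sin_double by (simp add: field_simps power2_eq_square)
  moreover have "Im (braket ?u ?v) = Im (braket u v)"
    unfolding Im by (simp flip: distrib_right)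
  ultimately show thesis using that by blast
qed

section \<open>Tripartite entanglement\<close>

text \<open>A factorization of \<psi>' across any of the three cuts is carried back to \<psi> by the
  inverse local operators.\<close>

lemma LU_truly_tripartite:
  assumes "LU_equivalent \<psi> \<psi>'" "truly_tripartite_entangled \<psi>"
  shows "truly_tripartite_entangled \<psi>'"
proof -
  obtain A B C where psi: "\<psi> = (A \<otimes>\<^sub>m B \<otimes>\<^sub>m C) *v \<psi>'"
    using LU_equivalent_sym[OF assms(1)] unfolding LU_equivalent_def by blast
  have nth: "\<psi> $ (i,j,k) = (\<Sum>i'\<in>UNIV. \<Sum>j'\<in>UNIV. \<Sum>k'\<in>UNIV.
      A $ i $ i' * (B $ j $ j' * C $ k $ k') * \<psi>' $ (i',j',k'))" for i j k
    by (simp add: psi matrix_vector_mult_def mat_tensor_def sum_prod_UNIV)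
  have "\<exists>(u :: qubit) (v :: two_qubit). \<forall>i j k. \<psi> $ (i, j, k) = u $ i * v $ (j, k)"
    if "\<forall>i j k. \<psi>' $ (i, j, k) = u $ i * v $ (j, k)" for u :: qubit and v :: two_qubit
    by (rule exI[of _ "A *v u"], rule exI[of _ "(B \<otimes>\<^sub>m C) *v v"])
      (simp add: nth that matrix_vector_mult_def mat_tensor_def sum_prod_UNIV sum_2 algebra_simps)
  moreover have "\<exists>(u :: qubit) (v :: two_qubit). \<forall>i j k. \<psi> $ (i, j, k) = u $ j * v $ (i, k)"
    if "\<forall>i j k. \<psi>' $ (i, j, k) = u $ j * v $ (i, k)" for u :: qubit and v :: two_qubit
    by (rule exI[of _ "B *v u"], rule exI[of _ "(A \<otimes>\<^sub>m C) *v v"])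
      (simp add: nth that matrix_vector_mult_def mat_tensor_def sum_prod_UNIV sum_2 algebra_simps)
  moreover have "\<exists>(u :: qubit) (v :: two_qubit). \<forall>i j k. \<psi> $ (i, j, k) = u $ k * v $ (i, j)"
    if "\<forall>i j k. \<psi>' $ (i, j, k) = u $ k * v $ (i, j)" for u :: qubit and v :: two_qubit
    by (rule exI[of _ "C *v u"], rule exI[of _ "(A \<otimes>\<^sub>m B) *v v"])
      (simp add: nth that matrix_vector_mult_def mat_tensor_def sum_prod_UNIV sum_2 algebra_simps)
  ultimately show ?thesis
    using assms(2) unfolding truly_tripartite_entangled_def by blast
qed

lemma truly_tripartite_pencil_proportional:
  assumes "truly_tripartite_entangled (pencil u v)" shows "\<not> (u = a *s w \<and> v = b *s w)"
proof
  assume *: "u = a *s w \<and> v = b *s w"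
  have "\<exists>(f :: qubit) (g :: two_qubit). \<forall>i j k. pencil u v $ (i, j, k) = f $ i * g $ (j, k)"
    by (rule exI[of _ "vector [a, b]"], rule exI[of _ w]) (simp add: forall_2 *)
  then show False using assms unfolding truly_tripartite_entangled_def by blast
qed

lemma truly_tripartite_pencil_common_fst:
  assumes "truly_tripartite_entangled (pencil u v)" shows "\<not> (u = f \<otimes>\<^sub>v g \<and> v = f \<otimes>\<^sub>v g')"
proof
  assume *: "u = f \<otimes>\<^sub>v g \<and> v = f \<otimes>\<^sub>v g'"
  have "\<exists>(h :: qubit) (w :: two_qubit). \<forall>i j k. pencil u v $ (i, j, k) = h $ j * w $ (i, k)"
    by (rule exI[of _ f], rule exI[of _ "ket0 \<otimes>\<^sub>v g + ket1 \<otimes>\<^sub>v g'"]) (simp add: forall_2 * vec_tensor_def)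
  then show False using assms unfolding truly_tripartite_entangled_def by blast
qed

lemma truly_tripartite_pencil_common_snd:
  assumes "truly_tripartite_entangled (pencil u v)" shows "\<not> (u = f \<otimes>\<^sub>v g \<and> v = f' \<otimes>\<^sub>v g)"
proof
  assume *: "u = f \<otimes>\<^sub>v g \<and> v = f' \<otimes>\<^sub>v g"
  have "\<exists>(h :: qubit) (w :: two_qubit). \<forall>i j k. pencil u v $ (i, j, k) = h $ k * w $ (i, j)"
    by (rule exI[of _ g], rule exI[of _ "ket0 \<otimes>\<^sub>v f + ket1 \<otimes>\<^sub>v f'"]) (simp add: forall_2 * vec_tensor_def)
  then show False using assms unfolding truly_tripartite_entangled_def by blast
qed

text \<open>Entanglement across 1|23 makes \<open>u\<close>, \<open>v\<close> linearly independent.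
  A nonzero minor is the form of independence that Cramer's rule needs for a dual basis.\<close>

lemma truly_tripartite_pencil_minor:
  assumes "truly_tripartite_entangled (pencil u v)" obtains i j where "u $ i * v $ j \<noteq> u $ j * v $ i"
proof -
  have False if minors: "\<forall>i j. u $ i * v $ j = u $ j * v $ i"
  proof (cases "u = 0")
    case True
    then show False
      using truly_tripartite_pencil_proportional[OF assms, of 0 v 1] by simp
  next
    case False
    then obtain i where i: "u $ i \<noteq> 0" by (auto simp: vec_eq_iff)
    have "v $ j = v $ i / u $ i * u $ j" for j
    proof -
      have "v $ j = (u $ i * v $ j) / u $ i" using i by simp
      also have "u $ i * v $ j = v $ i * u $ j" using minors by (simp only: mult.commute)
      finally show ?thesis by (simp only: times_divide_eq_left)
    qed
    then have "v = (v $ i / u $ i) *s u"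
      unfolding vec_eq_iff vector_smult_component by blast
    then show False
      using truly_tripartite_pencil_proportional[OF assms, of 1 u "v $ i / u $ i"] by simp
  qed
  then show thesis using that by blast
qed

section \<open>Concurrence and concurrence of assistance\<close>

definition lin :: "complex ^ 'n::finite \<Rightarrow> complex ^ 'n \<Rightarrow> complex" where
  "lin F x = (\<Sum>i\<in>UNIV. F $ i * x $ i)"

lemma lin_diff: "lin (F - G) x = lin F x - lin G x"
  by (simp add: lin_def left_diff_distrib sum_subtractf)

lemma lin_scale: "lin (a *s F) x = a * lin F x"
  by (simp add: lin_def sum_distrib_left mult.assoc)

lemma lin_axis: "lin (axis i 1) x = x $ i"
proof -
  have "lin (axis i 1) x = (\<Sum>j\<in>UNIV. if j = i then x $ j else 0)"
    unfolding lin_def by (rule sum.cong) (auto simp: axis_def)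
  then show ?thesis by simp
qed

lemma ketbra_lin: "(\<Sum>i\<in>UNIV. \<Sum>k\<in>UNIV. F $ i * cnj (G $ k) * ketbra x $ i $ k) = lin F x * cnj (lin G x)"
  by (simp add: lin_def ketbra_def sum_product mult_ac)

text \<open>The two decompositions of the density matrix are sandwiched between the functionals F
  and G. Suitable F and G then extract any statement about the ensemble without further matrix
  algebra.\<close>

lemma pure_ensemble_lin:
  assumes "pure_ensemble (ketbra u + ketbra v) n p \<phi>"
  shows "(\<Sum>j<n. complex_of_real (p j) * (lin F (\<phi> j) * cnj (lin G (\<phi> j)))) =
    lin F u * cnj (lin G u) + lin F v * cnj (lin G v)"
proof -
  have nth: "(ketbra u + ketbra v) $ i $ k = (\<Sum>j<n. complex_of_real (p j) * ketbra (\<phi> j) $ i $ k)" for i k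
    using assms by (simp add: pure_ensemble_def scaleR_conv_of_real[where 'a=complex])
  have "lin F u * cnj (lin G u) + lin F v * cnj (lin G v) =
      (\<Sum>i\<in>UNIV. \<Sum>k\<in>UNIV. F $ i * cnj (G $ k) * (ketbra u + ketbra v) $ i $ k)"
    by (simp add: ketbra_lin[symmetric] sum.distrib distrib_left)
  also have "\<dots> = (\<Sum>i\<in>UNIV. \<Sum>k\<in>UNIV. \<Sum>j<n. complex_of_real (p j) * (F $ i * cnj (G $ k) * ketbra (\<phi> j) $ i $ k))"
    unfolding nth by (simp add: sum_distrib_left mult_ac)
  also have "\<dots> = (\<Sum>i\<in>UNIV. \<Sum>j<n. \<Sum>k\<in>UNIV. complex_of_real (p j) * (F $ i * cnj (G $ k) * ketbra (\<phi> j) $ i $ k))"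
    by (rule sum.cong[OF refl], rule sum.swap)
  also have "\<dots> = (\<Sum>j<n. \<Sum>i\<in>UNIV. \<Sum>k\<in>UNIV. complex_of_real (p j) * (F $ i * cnj (G $ k) * ketbra (\<phi> j) $ i $ k))"
    by (rule sum.swap)
  finally show ?thesis
    by (simp add: ketbra_lin[symmetric] sum_distrib_left)
qed

lemma pure_ensemble_lin_norm:
  assumes "pure_ensemble (ketbra u + ketbra v) n p \<phi>"
  shows "(\<Sum>j<n. p j * (cmod (lin F (\<phi> j)))\<^sup>2) = (cmod (lin F u))\<^sup>2 + (cmod (lin F v))\<^sup>2"
proof -
  have "complex_of_real (\<Sum>j<n. p j * (cmod (lin F (\<phi> j)))\<^sup>2) =
      complex_of_real ((cmod (lin F u))\<^sup>2 + (cmod (lin F v))\<^sup>2)"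
    using pure_ensemble_lin[OF assms, of F F]
    by (simp only: of_real_sum of_real_add of_real_mult complex_norm_square)
  then show ?thesis by (simp only: of_real_eq_iff)
qed

text \<open>Ensemble vectors lie in the range of the density matrix, the span of \<open>u\<close>
  and \<open>v\<close>. The functionals F and G read off the coefficients, and evaluating them on
  both decompositions gives the two normalizations.\<close>

lemma pure_ensemble_coefficients:
  assumes ens: "pure_ensemble (ketbra u + ketbra v) n p \<phi>"
    and minor: "u $ i * v $ j \<noteq> u $ j * v $ i"
  obtains \<alpha> \<beta> where "\<forall>k<n. p k \<noteq> 0 \<longrightarrow> \<phi> k = \<alpha> k *s u + \<beta> k *s v"
    "(\<Sum>k<n. p k * (cmod (\<alpha> k))\<^sup>2) = 1" "(\<Sum>k<n. p k * (cmod (\<beta> k))\<^sup>2) = 1"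
proof -
  let ?d = "u $ i * v $ j - u $ j * v $ i"
  \<comment> \<open>The dual basis of (u, v), by Cramer's rule in the coordinates i and j.\<close>
  define F where "F = (v $ j / ?d) *s axis i 1 + (- v $ i / ?d) *s axis j 1"
  define G where "G = (- u $ j / ?d) *s axis i 1 + (u $ i / ?d) *s axis j 1"
  have FG: "lin F u = 1" "lin F v = 0" "lin G u = 0" "lin G v = 1"
    using minor by (simp_all add: F_def G_def lin_diff lin_scale lin_axis flip: diff_divide_distrib)
  \<comment> \<open>\<open>H k\<close> measures the deviation of coordinate k from the span. It
    vanishes on \<open>u\<close> and \<open>v\<close>, so its weighted squares over the ensemble sum
    to 0 and each of them is 0.\<close>
  define H where "H k = axis k 1 - u $ k *s F - v $ k *s G" for k
  have H: "lin (H k) x = x $ k - u $ k * lin F x - v $ k * lin G x" for k x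
    by (simp add: H_def lin_diff lin_scale lin_axis)
  have p: "p k \<ge> 0" if "k < n" for k
    using ens that by (simp add: pure_ensemble_def)
  show thesis
  proof (rule that[of "\<lambda>k. lin F (\<phi> k)" "\<lambda>k. lin G (\<phi> k)"], intro allI impI)
    fix k assume k: "k < n" "p k \<noteq> 0"
    have "lin (H e) (\<phi> k) = 0" for e
    proof -
      have "(\<Sum>k<n. p k * (cmod (lin (H e) (\<phi> k)))\<^sup>2) = 0"
        unfolding pure_ensemble_lin_norm[OF ens] by (simp add: H FG)
      then have "p k * (cmod (lin (H e) (\<phi> k)))\<^sup>2 = 0"
        using k p by (subst (asm) sum_nonneg_eq_0_iff) auto
      then show ?thesis using k by simp
    qed
    then show "\<phi> k = lin F (\<phi> k) *s u + lin G (\<phi> k) *s v"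
      by (simp add: vec_eq_iff H algebra_simps)
  qed (simp_all add: pure_ensemble_lin_norm[OF ens] FG)
qed

text \<open>Each member has concurrence |\<alpha>^2 cform u u + \<beta>^2 cform v v|, bounded on
  both sides by triangle inequalities. Since the weighted sums of |\<alpha>|^2 and |\<beta>|^2 are
  1, the summed bounds no longer depend on the ensemble.\<close>

lemma average_concurrence_bounds:
  assumes x: "x \<in> average_concurrences (ketbra u + ketbra v)"
    and "truly_tripartite_entangled (pencil u v)" and diag: "cform u v = 0"
  defines "l \<equiv> cmod (cform u u)" and "m \<equiv> cmod (cform v v)"
  shows "\<bar>l - m\<bar> \<le> x \<and> x \<le> l + m"
proof -
  obtain n p \<phi> where ens: "pure_ensemble (ketbra u + ketbra v) n p \<phi>"
    and x: "x = (\<Sum>j<n. p j * concurrence (\<phi> j))"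
    using x unfolding average_concurrences_def by blast
  obtain i j where minor: "u $ i * v $ j \<noteq> u $ j * v $ i"
    using truly_tripartite_pencil_minor assms(2) by blast
  obtain \<alpha> \<beta> where span: "\<forall>k<n. p k \<noteq> 0 \<longrightarrow> \<phi> k = \<alpha> k *s u + \<beta> k *s v"
    and \<alpha>: "(\<Sum>k<n. p k * (cmod (\<alpha> k))\<^sup>2) = 1" and \<beta>: "(\<Sum>k<n. p k * (cmod (\<beta> k))\<^sup>2) = 1"
    by (rule pure_ensemble_coefficients[OF ens minor])
  have p: "p k \<ge> 0" if "k < n" for k
    using ens that by (simp add: pure_ensemble_def)
  define c where "c k = (\<alpha> k)\<^sup>2 * cform u u + (\<beta> k)\<^sup>2 * cform v v" for k
  have conc: "p k * concurrence (\<phi> k) = p k * cmod (c k)" if "k < n" for k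
    using span that unfolding concurrence_cform
    by (cases "p k = 0") (simp_all add: cform_lincomb diag c_def power2_eq_square)
  have abs: "cmod ((\<alpha> k)\<^sup>2 * cform u u) = (cmod (\<alpha> k))\<^sup>2 * l" "cmod ((\<beta> k)\<^sup>2 * cform v v) = (cmod (\<beta> k))\<^sup>2 * m" for k
    by (simp_all add: norm_mult norm_power l_def m_def)
  have upper: "p k * concurrence (\<phi> k) \<le> l * (p k * (cmod (\<alpha> k))\<^sup>2) + m * (p k * (cmod (\<beta> k))\<^sup>2)" if "k < n" for k
  proof -
    have "cmod (c k) \<le> (cmod (\<alpha> k))\<^sup>2 * l + (cmod (\<beta> k))\<^sup>2 * m"
      unfolding c_def abs[symmetric] by (rule norm_triangle_ineq)
    from mult_left_mono[OF this p[OF that]] show ?thesis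
      by (simp add: conc[OF that] algebra_simps)
  qed
  have lower: "l * (p k * (cmod (\<alpha> k))\<^sup>2) - m * (p k * (cmod (\<beta> k))\<^sup>2) \<le> p k * concurrence (\<phi> k)"
    "m * (p k * (cmod (\<beta> k))\<^sup>2) - l * (p k * (cmod (\<alpha> k))\<^sup>2) \<le> p k * concurrence (\<phi> k)" if "k < n" for k
  proof -
    have "(cmod (\<alpha> k))\<^sup>2 * l - (cmod (\<beta> k))\<^sup>2 * m \<le> cmod (c k)"
      unfolding c_def abs[symmetric] by (metis norm_diff_ineq)
    from mult_left_mono[OF this p[OF that]]
    show "l * (p k * (cmod (\<alpha> k))\<^sup>2) - m * (p k * (cmod (\<beta> k))\<^sup>2) \<le> p k * concurrence (\<phi> k)"
      by (simp add: conc[OF that] algebra_simps)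
    have "(cmod (\<beta> k))\<^sup>2 * m - (cmod (\<alpha> k))\<^sup>2 * l \<le> cmod (c k)"
      unfolding c_def abs[symmetric] by (metis norm_diff_ineq add.commute)
    from mult_left_mono[OF this p[OF that]]
    show "m * (p k * (cmod (\<beta> k))\<^sup>2) - l * (p k * (cmod (\<alpha> k))\<^sup>2) \<le> p k * concurrence (\<phi> k)"
      by (simp add: conc[OF that] algebra_simps)
  qed
  have "x \<le> (\<Sum>k<n. l * (p k * (cmod (\<alpha> k))\<^sup>2) + m * (p k * (cmod (\<beta> k))\<^sup>2))"
    unfolding x by (rule sum_mono) (simp add: upper)
  then have "x \<le> l + m"
    by (simp add: sum.distrib \<alpha> \<beta> flip: sum_distrib_left)
  moreover have "(\<Sum>k<n. l * (p k * (cmod (\<alpha> k))\<^sup>2) - m * (p k * (cmod (\<beta> k))\<^sup>2)) \<le> x"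
    "(\<Sum>k<n. m * (p k * (cmod (\<beta> k))\<^sup>2) - l * (p k * (cmod (\<alpha> k))\<^sup>2)) \<le> x"
    unfolding x by (rule sum_mono, simp add: lower)+
  then have "\<bar>l - m\<bar> \<le> x"
    by (simp add: sum_subtractf \<alpha> \<beta> flip: sum_distrib_left)
  ultimately show ?thesis by simp
qed

section \<open>Two-element ensembles that attain the bounds\<close>

lemma ketbra_scale: "ketbra (a *s x) = (cmod a)\<^sup>2 *\<^sub>R ketbra x"
  by (simp add: ketbra_def vec_eq_iff scaleR_conv_of_real[where 'a=complex] complex_norm_square mult_ac del: of_real_power)

lemma ketbra_normalized:
  obtains \<phi> where "norm \<phi> = 1" "ketbra x = (norm x)\<^sup>2 *\<^sub>R ketbra \<phi>"
    "cmod (cform x x) = (norm x)\<^sup>2 * concurrence \<phi>"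
proof (cases "x = 0")
  case True
  \<comment> \<open>A vanishing vector has probability 0, so any unit vector may stand for
    it.\<close>
  then show thesis
    by (intro that[of "axis (1,1) 1"]) (simp_all add: ketbra_def vec_eq_iff cform_def norm_axis_1)
next
  case False
  define \<phi> where "\<phi> = complex_of_real (1 / norm x) *s x"
  have x: "x = complex_of_real (norm x) *s \<phi>"
    using False by (simp add: \<phi>_def)
  have "norm \<phi> = 1"
    using False by (simp add: \<phi>_def norm_vscale norm_divide)
  moreover have "ketbra x = (norm x)\<^sup>2 *\<^sub>R ketbra \<phi>"
    by (subst x) (simp add: ketbra_scale)
  moreover have "cform x x = complex_of_real (norm x) * (complex_of_real (norm x) * cform \<phi> \<phi>)"
    by (subst (1 2) x) (simp only: cform_add_left cform_add_right cform_scale_left cform_scale_right)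
  then have "cmod (cform x x) = (norm x)\<^sup>2 * concurrence \<phi>"
    by (simp add: norm_mult concurrence_cform power2_eq_square)
  ultimately show thesis by (rule that)
qed

lemma average_concurrence_pair:
  assumes "(norm x)\<^sup>2 + (norm y)\<^sup>2 = 1"
  shows "cmod (cform x x) + cmod (cform y y) \<in> average_concurrences (ketbra x + ketbra y)"
proof -
  obtain f where f: "norm f = 1" "ketbra x = (norm x)\<^sup>2 *\<^sub>R ketbra f" "cmod (cform x x) = (norm x)\<^sup>2 * concurrence f"
    by (rule ketbra_normalized)
  obtain g where g: "norm g = 1" "ketbra y = (norm y)\<^sup>2 *\<^sub>R ketbra g" "cmod (cform y y) = (norm y)\<^sup>2 * concurrence g"
    by (rule ketbra_normalized)
  let ?p = "\<lambda>j::nat. if j = 0 then (norm x)\<^sup>2 else (norm y)\<^sup>2" and ?\<phi> = "\<lambda>j::nat. if j = 0 then f else g"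
  have "pure_ensemble (ketbra x + ketbra y) 2 ?p ?\<phi>"
    using f g assms by (simp add: pure_ensemble_def numeral_2_eq_2)
  moreover have "cmod (cform x x) + cmod (cform y y) = (\<Sum>j<2. ?p j * concurrence (?\<phi> j))"
    using f g by (simp add: numeral_2_eq_2)
  ultimately show ?thesis unfolding average_concurrences_def by (intro CollectI exI conjI)
qed

text \<open>The unitary freedom of ensembles: orthonormality of the columns removes the mixed terms.
  In terms of the three-qubit state, a unitary on qubit 1 does not change the reduced state of
  qubits 2, 3.\<close>

lemma ketbra_recombine:
  assumes "unitary (mat22 p q r s)"
  shows "ketbra (p *s u + q *s v) + ketbra (r *s u + s *s v) = ketbra u + ketbra v"
proof -
  have "mat_adjoint (mat22 p q r s) ** mat22 p q r s = mat 1"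
    using assms by (simp add: unitary_def)
  then have eq: "cnj p * p + cnj r * r = 1" "cnj p * q + cnj r * s = 0" "cnj q * p + cnj s * r = 0"
    "cnj q * q + cnj s * s = 1"
    by (simp_all add: mat22_adjoint mat22_mult mat22_one mat22_eq_iff)
  have "(p * a + q * b) * cnj (p * c + q * d) + (r * a + s * b) * cnj (r * c + s * d) =
      (cnj p * p + cnj r * r) * (a * cnj c) + (cnj p * q + cnj r * s) * (b * cnj c) +
      (cnj q * p + cnj s * r) * (a * cnj d) + (cnj q * q + cnj s * s) * (b * cnj d)" for a b c d
    by (simp add: algebra_simps)
  then show ?thesis
    by (simp add: ketbra_def vec_eq_iff eq)
qed

lemma rho23_pencil: "rho23 (pencil u v) = ketbra u + ketbra v"
  by (simp add: rho23_def partial_trace_fst_def ketbra_def vec_eq_iff sum_2)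

lemma takagi_concurrences:
  assumes "takagi \<psi> u v l m" "truly_tripartite_entangled \<psi>" "norm \<psi> = 1"
  shows "C23 \<psi> = \<bar>l - m\<bar> \<and> C23a \<psi> = l + m"
proof -
  have "LU_equivalent (pencil u v) \<psi>"
    using assms(1) LU_equivalent_sym by (simp add: takagi_def)
  then obtain p q r s V W where U: "unitary (mat22 p q r s)" "unitary V" "unitary W" and psi:
    "\<psi> = pencil (p *s ((V \<otimes>\<^sub>m W) *v u) + q *s ((V \<otimes>\<^sub>m W) *v v))
            (r *s ((V \<otimes>\<^sub>m W) *v u) + s *s ((V \<otimes>\<^sub>m W) *v v))"
    by (rule LU_pencilE)
  \<comment> \<open>The unitaries on qubits 2, 3 do change \<open>rho23\<close>, so the Takagi
    vectors are moved to where they form an ensemble of \<psi> itself. The form stays diagonal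
    there, up to a common phase d.\<close>
  define x y where "x = (V \<otimes>\<^sub>m W) *v u" and "y = (V \<otimes>\<^sub>m W) *v v"
  have psi: "\<psi> = pencil (p *s x + q *s y) (r *s x + s *s y)"
    by (simp add: psi x_def y_def)
  have rho: "rho23 \<psi> = ketbra x + ketbra y"
    unfolding psi rho23_pencil by (rule ketbra_recombine[OF U(1)])
  have LU: "LU_equivalent \<psi> (pencil x y)"
    unfolding psi by (rule LU_equivalent_sym, rule LU_pencilI1, rule U)
  then have truly: "truly_tripartite_entangled (pencil x y)"
    using assms(2) LU_truly_tripartite by blast
  have norm: "(norm x)\<^sup>2 + (norm y)\<^sup>2 = 1"
    using norm_LU[OF LU] assms(3) by (simp flip: norm_pencil)
  obtain d where d: "cmod d = 1" "cform x x = d * l" "cform y y = d * m" "cform x y = 0"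
    using assms(1) U by (intro that[of "det V * det W"])
      (simp_all add: x_def y_def cform_tensor takagi_def norm_mult cmod_det_unitary)
  have lm: "cmod (cform x x) = l" "cmod (cform y y) = m" "l \<ge> 0" "m \<ge> 0"
    using d assms(1) by (simp_all add: norm_mult takagi_def)
  have upper: "l + m \<in> average_concurrences (rho23 \<psi>)"
    using average_concurrence_pair[OF norm] by (simp add: rho lm)
  define h where "h = complex_of_real (1 / sqrt 2)"
  have hh: "h * h = 1 / 2"
    unfolding h_def
    by (metis of_real_mult of_real_divide of_real_1 of_real_numeral real_sqrt_mult_self times_divide_times_eq mult_1 abs_numeral)
  \<comment> \<open>The pair (x, y) attains l + m. Here the factor i squares to -1 in the form, so
    both (x + iy)/sqrt 2 and (x - iy)/sqrt 2 have concurrence |l - m|/2.\<close>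
  have H: "unitary (mat22 h (\<i> * h) h (- \<i> * h))"
    by (simp add: unitary_mat22_iff h_def norm_divide norm_mult power_divide)
  let ?x = "h *s x + (\<i> * h) *s y" and ?y = "h *s x + (- \<i> * h) *s y"
  have "(norm (pencil ?x ?y))\<^sup>2 = 1"
    using norm_LU[OF LU_pencil_recombine[OF LU H]] assms(3) by simp
  then have "(norm ?x)\<^sup>2 + (norm ?y)\<^sup>2 = 1"
    by (simp only: norm_pencil)
  then have "cmod (cform ?x ?x) + cmod (cform ?y ?y) \<in> average_concurrences (ketbra ?x + ketbra ?y)"
    by (rule average_concurrence_pair)
  then have "cmod (cform ?x ?x) + cmod (cform ?y ?y) \<in> average_concurrences (rho23 \<psi>)"
    by (simp only: ketbra_recombine[OF H] rho)
  moreover have "cform ?x ?x = (h * h) * d * (l - m)" "cform ?y ?y = (h * h) * d * (l - m)"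
    unfolding cform_lincomb d by (simp_all add: algebra_simps)
  then have "cmod (cform ?x ?x) = \<bar>l - m\<bar> / 2" "cmod (cform ?y ?y) = \<bar>l - m\<bar> / 2"
    unfolding hh by (simp_all only: norm_mult norm_divide d norm_of_real norm_one norm_numeral)
  ultimately have lower: "\<bar>l - m\<bar> \<in> average_concurrences (rho23 \<psi>)"
    by (simp only: field_sum_of_halves)
  have bounds: "\<bar>l - m\<bar> \<le> z" "z \<le> l + m" if "z \<in> average_concurrences (rho23 \<psi>)" for z
    using average_concurrence_bounds[OF _ truly d(4)] that by (simp_all add: rho lm)
  have "C23 \<psi> = \<bar>l - m\<bar>"
    unfolding C23_def using lower bounds(1) by (rule Least_equality)
  moreover have "C23a \<psi> = l + m"
    unfolding C23a_def using upper bounds(2) by (rule Greatest_equality)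
  ultimately show ?thesis ..
qed

section \<open>Rotations\<close>

text \<open>A real-linear multiplicative embedding of the complex numbers commutes with the
  exponential series. Both Pauli exponentials reduce in this way to the complex exponential.\<close>

lemma mat_exp_hom:
  fixes R :: "complex \<Rightarrow> complex ^ 'n::finite ^ 'n"
  assumes "bounded_linear R" "R 1 = mat 1" and mult: "\<And>w. R (z * w) = R z ** R w"
  shows "mat_exp (R z) = R (exp z)"
proof -
  interpret R: bounded_linear R by fact
  have pow: "(((**) (R z)) ^^ n) (mat 1) = R (z ^ n)" for n
    by (induction n) (simp_all add: assms(2) mult)
  have "R (exp z) = (\<Sum>n. R (z ^ n /\<^sub>R fact n))"
    unfolding exp_def by (rule R.suminf[OF summable_exp_generic])
  then show ?thesis
    by (simp add: mat_exp_def pow R.scaleR divide_inverse)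
qed

lemma Z_rot: "Z_rot \<xi> = mat22 (cis \<xi>) 0 0 (cis (- \<xi>))"
proof -
  \<comment> \<open>The two eigenvalues of i \<xi> \<sigma>_z are conjugate, so the matrix is the
    image of i \<xi>.\<close>
  let ?R = "\<lambda>w. mat22 w 0 0 (cnj w)"
  have "linear ?R"
    by (rule linearI) (simp_all add: vec_eq_iff forall_2)
  then have "mat_exp (?R (\<i> * complex_of_real \<xi>)) = ?R (exp (\<i> * complex_of_real \<xi>))"
    by (intro mat_exp_hom) (simp_all add: linear_conv_bounded_linear mat22_one mat22_mult)
  moreover have "(\<chi> j k. \<i> * complex_of_real \<xi> * sigma_z $ j $ k) = ?R (\<i> * complex_of_real \<xi>)"
    by (simp add: vec_eq_iff forall_2 sigma_z_def)
  ultimately show ?thesis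
    by (simp add: Z_rot_def cis_conv_exp exp_cnj)
qed

lemma Y_rot:
  "Y_rot \<xi> = mat22 (complex_of_real (cos \<xi>)) (complex_of_real (sin \<xi>))
     (- complex_of_real (sin \<xi>)) (complex_of_real (cos \<xi>))"
proof -
  \<comment> \<open>The matrix i \<sigma>_y is real with square -1 and plays the part of the
    imaginary unit.\<close>
  let ?R = "\<lambda>w. mat22 (complex_of_real (Re w)) (complex_of_real (Im w))
     (- complex_of_real (Im w)) (complex_of_real (Re w))"
  have "linear ?R"
    by (rule linearI) (simp_all add: vec_eq_iff forall_2 scaleR_conv_of_real[where 'a=complex])
  then have "mat_exp (?R (\<i> * complex_of_real \<xi>)) = ?R (exp (\<i> * complex_of_real \<xi>))"
    by (intro mat_exp_hom) (simp_all add: linear_conv_bounded_linear mat22_one mat22_mult)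
  moreover have "(\<chi> j k. \<i> * complex_of_real \<xi> * sigma_y $ j $ k) = ?R (\<i> * complex_of_real \<xi>)"
    by (simp add: vec_eq_iff forall_2 sigma_y_def mult.assoc mult.left_commute[of \<i>])
  moreover have "exp (\<i> * complex_of_real \<xi>) = cis \<xi>"
    by (simp add: cis_conv_exp)
  ultimately show ?thesis
    by (simp add: Y_rot_def)
qed

lemma unitary_Z_rot: "unitary (Z_rot \<xi>)"
  by (simp add: Z_rot unitary_mat22_iff)

lemma unitary_Y_rot: "unitary (Y_rot \<xi>)"
  by (simp only: Y_rot unitary_mat22_real)

lemma Z_rot_add: "Z_rot a ** Z_rot b = Z_rot (a + b)"
  by (simp add: Z_rot mat22_mult cis_mult)

lemma ZYZ:
  "Z_rot \<alpha> ** Y_rot \<beta> ** Z_rot \<gamma> =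
     mat22 (complex_of_real (cos \<beta>) * cis (\<alpha> + \<gamma>)) (complex_of_real (sin \<beta>) * cis (\<alpha> - \<gamma>))
       (- complex_of_real (sin \<beta>) * cis (\<gamma> - \<alpha>)) (complex_of_real (cos \<beta>) * cis (- \<alpha> - \<gamma>))"
  by (simp add: Z_rot Y_rot mat22_mult mat22_eq_iff cis_mult mult_ac add_ac flip: diff_conv_add_uminus)

text \<open>Dividing by a square root \<omega> of the determinant leaves an SU(2) matrix with first
  row (x, y). The moduli of x and y determine \<beta>, and their arguments are \<alpha> + \<gamma>
  and \<alpha> - \<gamma>.\<close>

lemma unitary_ZYZ:
  assumes "unitary (U :: complex ^ 2 ^ 2)"
  obtains \<omega> \<alpha> \<beta> \<gamma> where "cmod \<omega> = 1" "0 \<le> \<beta>" "\<beta> \<le> pi / 2"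
    "U = mat22 \<omega> 0 0 \<omega> ** (Z_rot \<alpha> ** Y_rot \<beta> ** Z_rot \<gamma>)"
proof -
  obtain p q r s where U: "U = mat22 p q r s" by (rule mat22_cases)
  define d where "d = det U"
  have d: "d = p * s - q * r" "cmod d = 1"
    using cmod_det_unitary[OF assms] by (simp_all add: d_def U det_mat22)
  have "U ** mat_adjoint U = mat 1" "mat_adjoint U ** U = mat 1"
    using assms by (simp_all add: unitary_def)
  then have eq: "p * cnj p + q * cnj q = 1" "r * cnj p + s * cnj q = 0" "r * cnj r + s * cnj s = 1"
    "p * cnj r + q * cnj s = 0"
    by (simp_all add: U mat22_adjoint mat22_mult mat22_one mat22_eq_iff)
  have s: "s = d * cnj p"
  proof -
    have "d * cnj p = s * (p * cnj p) - q * (r * cnj p)" by (simp add: d algebra_simps)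
    also have "r * cnj p = - (s * cnj q)" using eq(2) by (simp add: eq_neg_iff_add_eq_0)
    also have "s * (p * cnj p) - q * - (s * cnj q) = s * (p * cnj p + q * cnj q)" by (simp add: algebra_simps)
    finally show ?thesis using eq by simp
  qed
  have r: "r = - d * cnj q"
  proof -
    have "- d * cnj q = r * (q * cnj q) - p * (s * cnj q)" by (simp add: d algebra_simps)
    also have "s * cnj q = - (r * cnj p)" using eq(2) by (simp add: eq_neg_iff_add_eq_0 add.commute)
    also have "r * (q * cnj q) - p * - (r * cnj p) = r * (p * cnj p + q * cnj q)" by (simp add: algebra_simps)
    finally show ?thesis using eq by simp
  qed
  define \<omega> where "\<omega> = cis (Arg d / 2)"
  have w: "\<omega> * \<omega> = d" "\<omega> * cnj \<omega> = 1" "cmod \<omega> = 1"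
  proof -
    have "\<omega> * \<omega> = cis (Arg d)" by (simp add: \<omega>_def cis_mult)
    then show "\<omega> * \<omega> = d" using d(2) rcis_cmod_Arg[of d] by (simp add: rcis_def)
  qed (simp_all add: \<omega>_def cis_cnj cis_mult)
  define x y where "x = cnj \<omega> * p" and "y = cnj \<omega> * q"
  have p: "p = \<omega> * x" and q: "q = \<omega> * y"
    using w by (simp_all add: x_def y_def flip: mult.assoc)
  have s': "s = \<omega> * cnj x" and r': "r = - \<omega> * cnj y"
    unfolding s r x_def y_def w(1)[symmetric] by simp_all
  have "(cmod x)\<^sup>2 + (cmod y)\<^sup>2 = 1"
    using assms by (simp add: U unitary_mat22_iff x_def y_def norm_mult w)
  then obtain \<beta> where \<beta>: "0 \<le> \<beta>" "\<beta> \<le> pi / 2" "cmod x = cos \<beta>" "cmod y = sin \<beta>"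
    using sincos_total_pi_half[of "cmod x" "cmod y"] by (metis norm_ge_zero)
  define \<alpha> \<gamma> where "\<alpha> = (Arg x + Arg y) / 2" and "\<gamma> = (Arg x - Arg y) / 2"
  have ag: "\<alpha> + \<gamma> = Arg x" "\<alpha> - \<gamma> = Arg y" "\<gamma> - \<alpha> = - Arg y" "- \<alpha> - \<gamma> = - Arg x"
    by (simp_all add: \<alpha>_def \<gamma>_def field_simps)
  have x: "x = complex_of_real (cos \<beta>) * cis (Arg x)" and y: "y = complex_of_real (sin \<beta>) * cis (Arg y)"
    using rcis_cmod_Arg[of x] rcis_cmod_Arg[of y] \<beta> by (simp_all add: rcis_def)
  have cx: "cnj x = complex_of_real (cos \<beta>) * cis (- Arg x)"
    by (subst x) (simp add: cis_cnj)
  have cy: "cnj y = complex_of_real (sin \<beta>) * cis (- Arg y)"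
    by (subst y) (simp add: cis_cnj)
  have "U = mat22 \<omega> 0 0 \<omega> ** (Z_rot \<alpha> ** Y_rot \<beta> ** Z_rot \<gamma>)"
    unfolding ZYZ ag U mat22_mult mat22_eq_iff using p q s' r' x y cx cy by simp
  then show thesis using that w \<beta> by blast
qed

text \<open>Shifting the angle by \<pi> only changes the sign of the rotation, so reduction modulo
  \<pi> costs a scalar.\<close>

lemma Z_rot_mod_pi:
  obtains \<epsilon> \<alpha>' where "cmod \<epsilon> = 1" "\<alpha>' \<in> {- pi / 2 <.. pi / 2}" "Z_rot \<alpha> = mat22 \<epsilon> 0 0 \<epsilon> ** Z_rot \<alpha>'"
proof -
  \<comment> \<open>The ceiling, not the floor, because the target interval is open on the left and
    closed on the right.\<close>
  define n where "n = \<lceil>\<alpha> / pi - 1 / 2\<rceil>"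
  define \<alpha>' where "\<alpha>' = \<alpha> - of_int n * pi"
  have "of_int n - 1 < \<alpha> / pi - 1 / 2" "\<alpha> / pi - 1 / 2 \<le> of_int n"
    unfolding n_def by linarith+
  moreover have "(\<alpha> / pi - 1 / 2) * pi = \<alpha> - pi / 2"
    by (simp add: left_diff_distrib)
  ultimately have "(of_int n - 1) * pi < \<alpha> - pi / 2" "\<alpha> - pi / 2 \<le> of_int n * pi"
    by (metis mult_strict_right_mono pi_gt_zero, metis mult_right_mono pi_ge_zero)
  then have "\<alpha>' \<in> {- pi / 2 <.. pi / 2}"
    by (simp add: \<alpha>'_def field_simps)
  moreover have n: "cis (- (of_int n * pi)) = cis (of_int n * pi)"
    by (simp add: complex_eq_iff sin_integer_2pi sin_times_pi_eq_0 mult.commute)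
  then have "Z_rot \<alpha> = mat22 (cis (of_int n * pi)) 0 0 (cis (of_int n * pi)) ** Z_rot \<alpha>'"
  proof -
    have "cis \<alpha> = cis (of_int n * pi) * cis \<alpha>'" "cis (- \<alpha>) = cis (- (of_int n * pi)) * cis (- \<alpha>')"
      by (simp_all add: cis_mult \<alpha>'_def)
    then show ?thesis
      by (simp only: n Z_rot mat22_mult mat22_eq_iff) simp
  qed
  ultimately show thesis by (intro that[of "cis (of_int n * pi)"]) simp_all
qed

section \<open>Schmidt decomposition\<close>

lemma psi_s_nth [simp]:
  "psi_s a b $ (1,1) = complex_of_real a \<and> psi_s a b $ (1,2) = 0 \<and>
   psi_s a b $ (2,1) = 0 \<and> psi_s a b $ (2,2) = complex_of_real b"
  by (simp add: psi_s_def vec_tensor_def)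

lemma norm_psi_s: "(norm (psi_s a b))\<^sup>2 = a\<^sup>2 + b\<^sup>2"
  by (simp add: norm_vec_def L2_set_def sum_nonneg sum_two_qubit)

lemma cform_psi_s: "cform (psi_s a b) (psi_s a b) = complex_of_real (2 * a * b)"
  by (simp add: cform_def)

lemma tensor_psi_s:
  "(mat22 p q r s \<otimes>\<^sub>m mat22 p' q' r' s') *v psi_s a b =
     (\<chi> i. a * mat22 p q r s $ fst i $ 1 * mat22 p' q' r' s' $ snd i $ 1 +
          b * mat22 p q r s $ fst i $ 2 * mat22 p' q' r' s' $ snd i $ 2)"
  by (simp add: two_qubit_eq_iff matrix_vector_mult_def mat_tensor_def sum_two_qubit)

lemma column_unitary:
  obtains F a where "unitary F" "a \<ge> 0" "r = complex_of_real a *s (F *v ket0)"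
proof (cases "r = (0 :: qubit)")
  case True
  then show thesis by (intro that[of "mat 1" 0]) simp_all
next
  case False
  have n: "(norm r)\<^sup>2 = (cmod (r $ 1))\<^sup>2 + (cmod (r $ 2))\<^sup>2"
    by (simp add: norm_vec_def L2_set_def sum_2)
  let ?n = "complex_of_real (norm r)"
  let ?x = "r $ 1 / ?n" and ?y = "r $ 2 / ?n"
  have one: "(cmod ?x)\<^sup>2 + (cmod ?y)\<^sup>2 = 1"
    using False by (simp add: norm_divide power_divide n flip: add_divide_distrib)
      (use False in \<open>auto simp: vec_eq_iff forall_2\<close>)
  let ?F = "mat22 ?x (- cnj ?y) ?y (cnj ?x)"
  have "unitary (mat22 (cnj ?x) (cnj ?y) (- cnj (cnj ?y)) (cnj (cnj ?x)))"
    by (rule unitary_mat22_SU) (simp only: complex_mod_cnj one)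
  then have "unitary (mat_adjoint ?F)"
    by (simp add: mat22_adjoint)
  then have "unitary ?F" by (metis mat_adjoint_mat_adjoint unitary_adjoint)
  moreover have "r = ?n *s (?F *v ket0)"
    using False by (simp add: vec_eq_iff forall_2 mat22_mult_vec_nth)
  ultimately show thesis by (intro that[of ?F "norm r"]) simp_all
qed

lemma schmidt_swap: "psi_s b a = (mat22 0 1 1 0 \<otimes>\<^sub>m mat22 0 1 1 0) *v psi_s a b"
  by (simp add: tensor_psi_s two_qubit_eq_iff)

text \<open>In a basis whose first vector points along f, the orthogonal g has only a second
  component, whose phase is absorbed into the basis. If f = 0, the vector is a product, and a flip
  of the first qubit brings it to \<open>psi_s b 0\<close>.\<close>

lemma schmidt_orthogonal:
  assumes "braket f g = 0"
  obtains V W a b where "unitary V" "unitary W" "a \<ge> 0" "b \<ge> 0"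
    "ket0 \<otimes>\<^sub>v f + ket1 \<otimes>\<^sub>v g = (V \<otimes>\<^sub>m W) *v psi_s a b"
proof (cases "f = 0")
  case True
  obtain F b where F: "unitary F" "b \<ge> 0" "g = complex_of_real b *s (F *v ket0)"
    by (rule column_unitary)
  show thesis
  proof (rule that[of "mat22 0 1 1 0" F b 0])
    show "unitary (mat22 0 1 1 0)" by (simp add: unitary_mat22_iff)
    obtain p q r s where "F = mat22 p q r s" by (rule mat22_cases)
    then show "ket0 \<otimes>\<^sub>v f + ket1 \<otimes>\<^sub>v g = (mat22 0 1 1 0 \<otimes>\<^sub>m F) *v psi_s b 0"
      using True F by (simp add: tensor_psi_s two_qubit_eq_iff vec_tensor_def mat22_mult_vec_nth)
  qed (use F in simp_all)
next
  case False
  obtain F a where F: "unitary F" "a \<ge> 0" "f = complex_of_real a *s (F *v ket0)"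
    by (rule column_unitary)
  then have "a \<noteq> 0" using False by auto
  define h where "h = mat_adjoint F *v g"
  have g: "g = F *v h"
    using F by (simp add: h_def matrix_vector_mul_assoc unitary_def)
  have "complex_of_real a * braket ket0 h = 0"
    using assms F by (simp add: g braket_scale_left braket_unitary)
  then have h1: "h $ 1 = 0"
    using \<open>a \<noteq> 0\<close> by (simp add: braket_def sum_2)
  obtain \<omega> where w: "cmod \<omega> = 1" "h $ 2 = complex_of_real (cmod (h $ 2)) * \<omega>"
    by (metis norm_cis rcis_cmod_Arg rcis_def)
  show thesis
  proof (rule that[of "mat 1" "F ** mat22 1 0 0 \<omega>" a "cmod (h $ 2)"])
    show "unitary (F ** mat22 1 0 0 \<omega>)"
      using F w by (intro unitary_mult) (simp_all add: unitary_mat22_iff)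
    obtain p q r s where F': "F = mat22 p q r s" by (rule mat22_cases)
    show "ket0 \<otimes>\<^sub>v f + ket1 \<otimes>\<^sub>v g = (mat 1 \<otimes>\<^sub>m (F ** mat22 1 0 0 \<omega>)) *v psi_s a (cmod (h $ 2))"
      unfolding F g F' mat22_one mat22_mult tensor_psi_s
      using h1 w(2) by (simp add: two_qubit_eq_iff vec_tensor_def mat22_mult_vec_nth mult_ac)
  qed (use F in simp_all)
qed

text \<open>One Jacobi rotation of the first qubit makes the rows f, g of the coefficient matrix
  orthogonal; a simultaneous flip of both qubits then orders the coefficients.\<close>

lemma schmidt:
  obtains V W a b where "unitary V" "unitary W" "a \<ge> b" "b \<ge> 0"
    "(w :: two_qubit) = (V \<otimes>\<^sub>m W) *v psi_s a b"
proof -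
  define f g :: qubit where "f = vector [w $ (1,1), w $ (1,2)]" and "g = vector [w $ (2,1), w $ (2,2)]"
  have w: "w = ket0 \<otimes>\<^sub>v f + ket1 \<otimes>\<^sub>v g"
    by (simp add: two_qubit_eq_iff vec_tensor_def f_def g_def)
  let ?z = "braket f g"
  \<comment> \<open>This phase makes the overlap of f with e g real, after which a real rotation
    angle suffices.\<close>
  define e where "e = cis (- Arg ?z)"
  have e: "e * cnj e = 1" "cmod e = 1" "e * ?z = complex_of_real (cmod ?z)"
  proof -
    have "e * ?z = cis (- Arg ?z) * (complex_of_real (cmod ?z) * cis (Arg ?z))"
      by (metis e_def rcis_cmod_Arg rcis_def)
    then show "e * ?z = complex_of_real (cmod ?z)" by (simp add: cis_mult mult.left_commute)
  qed (simp_all add: e_def cis_cnj cis_mult)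
  obtain t where t: "cmod ?z * cos (2 * t) + ((norm g)\<^sup>2 - (norm f)\<^sup>2) / 2 * sin (2 * t) = 0"
    using rotation_angle by blast
  define p q where "p = complex_of_real (cos t)" and "q = complex_of_real (sin t) * e"
  have U: "unitary (mat22 p q (- cnj q) (cnj p))"
    by (rule unitary_mat22_SU) (simp add: p_def q_def norm_mult e)
  let ?f = "p *s f + q *s g" and ?g = "- cnj q *s f + cnj p *s g"
  have rc: "(mat22 p q (- cnj q) (cnj p) \<otimes>\<^sub>m mat 1) *v w = ket0 \<otimes>\<^sub>v ?f + ket1 \<otimes>\<^sub>v ?g"
    unfolding w mat22_one
    by (simp add: two_qubit_eq_iff vec_tensor_def matrix_vector_mult_def mat_tensor_def sum_two_qubit algebra_simps)
  have cnj_e: "cnj e * cnj ?z = complex_of_real (cmod ?z)"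
    using arg_cong[OF e(3), of cnj] by simp
  have "e * braket ?f ?g =
      (e * cnj e) * (complex_of_real (cos t) * complex_of_real (sin t) *
        (complex_of_real ((norm g)\<^sup>2) - complex_of_real ((norm f)\<^sup>2))) +
      (complex_of_real (cos t))\<^sup>2 * (e * ?z) - (complex_of_real (sin t))\<^sup>2 * ((e * cnj e) * (cnj e * cnj ?z))"
    unfolding braket_lincomb by (simp add: p_def q_def algebra_simps power2_eq_square)
  also have "\<dots> = complex_of_real (cos t * sin t * ((norm g)\<^sup>2 - (norm f)\<^sup>2) +
      ((cos t)\<^sup>2 - (sin t)\<^sup>2) * cmod ?z)"
    unfolding e cnj_e by (simp add: algebra_simps)
  also have "cos t * sin t * ((norm g)\<^sup>2 - (norm f)\<^sup>2) + ((cos t)\<^sup>2 - (sin t)\<^sup>2) * cmod ?z = 0"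
    using t unfolding cos_double sin_double by (simp add: field_simps)
  finally have "braket ?f ?g = 0"
    using e(2) by auto
  then obtain V W a b where VW: "unitary V" "unitary W" and ab: "a \<ge> 0" "b \<ge> 0"
    and fg: "ket0 \<otimes>\<^sub>v ?f + ket1 \<otimes>\<^sub>v ?g = (V \<otimes>\<^sub>m W) *v psi_s a b"
    by (rule schmidt_orthogonal)
  define V' where "V' = mat_adjoint (mat22 p q (- cnj q) (cnj p)) ** V"
  have V': "unitary V'"
    unfolding V'_def using U VW by (intro unitary_mult unitary_adjoint)
  have "w = (mat_adjoint (mat22 p q (- cnj q) (cnj p)) \<otimes>\<^sub>m mat 1) *v
      ((mat22 p q (- cnj q) (cnj p) \<otimes>\<^sub>m mat 1) *v w)"
    using U by (simp add: matrix_vector_mul_assoc mat_tensor_mult unitary_def)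
  then have w': "w = (V' \<otimes>\<^sub>m W) *v psi_s a b"
    unfolding rc fg by (simp add: matrix_vector_mul_assoc mat_tensor_mult V'_def)
  show thesis
  proof (cases "a \<ge> b")
    case True
    then show thesis using that V' VW ab w' by blast
  next
    case False
    have X: "unitary (mat22 0 1 1 0)" by (simp add: unitary_mat22_iff)
    have "w = ((V' ** mat22 0 1 1 0) \<otimes>\<^sub>m (W ** mat22 0 1 1 0)) *v psi_s b a"
      unfolding w' schmidt_swap[of a b] by (simp add: matrix_vector_mul_assoc mat_tensor_mult)
    then show thesis
      using that[of "V' ** mat22 0 1 1 0" "W ** mat22 0 1 1 0" a b] False V' VW ab X unitary_mult by auto
  qed
qed

section \<open>Entropy of entanglement\<close>

lemma diag_mult_vec: "mat22 x 0 0 y *v v = z *s v \<longleftrightarrow> (x = z \<or> v $ 1 = 0) \<and> (y = z \<or> v $ 2 = 0)"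
  by (auto simp: vec_eq_iff forall_2 mat22_mult_vec_nth)

lemma vec_dim_axis: "vec.dim {v :: complex ^ 2. v $ 2 = 0} = 1 \<and> vec.dim {v :: complex ^ 2. v $ 1 = 0} = 1"
proof -
  have "{v :: complex ^ 2. v $ 2 = 0} = vec.span {ket0}" "{v :: complex ^ 2. v $ 1 = 0} = vec.span {ket1}"
    by (auto simp: vec.span_singleton vec_eq_iff forall_2)
  moreover have "ket0 \<noteq> 0" "ket1 \<noteq> 0"
    by (simp_all add: vec_eq_iff forall_2)
  then have "vec.independent {ket0}" "vec.independent {ket1}"
    by simp_all
  ultimately show ?thesis
    by (simp_all only: vec.dim_span vec.dim_eq_card_independent) simp_all
qed

lemma von_neumann_entropy_diag:
  "von_neumann_entropy (mat22 (complex_of_real x) 0 0 (complex_of_real y)) = - (x * log 2 x + y * log 2 y)"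
proof -
  let ?D = "mat22 (complex_of_real x) 0 0 (complex_of_real y)"
  have "{l :: real. \<exists>v. v \<noteq> 0 \<and> ?D *v v = complex_of_real l *s v} = {x, y}"
  proof (intro set_eqI iffI)
    fix l assume "l \<in> {x, y}"
    moreover have "ket0 \<noteq> 0" "?D *v ket0 = complex_of_real x *s ket0"
      "ket1 \<noteq> 0" "?D *v ket1 = complex_of_real y *s ket1"
      by (simp_all add: vec_eq_iff forall_2 mat22_mult_vec_nth)
    ultimately show "l \<in> {l. \<exists>v. v \<noteq> 0 \<and> ?D *v v = complex_of_real l *s v}"
      by blast
  qed (auto simp: diag_mult_vec, auto simp: vec_eq_iff forall_2)
  moreover have "(\<Sum>l\<in>{x, y}. real (vec.dim {v. ?D *v v = complex_of_real l *s v}) * (l * log 2 l)) =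
      x * log 2 x + y * log 2 y"
  \<comment> \<open>For equal eigenvalues the index set collapses to one element, and the eigenspace
    dimension 2 restores the missing term.\<close>
  proof (cases "x = y")
    case True
    then have "{v. ?D *v v = complex_of_real x *s v} = UNIV"
      by (auto simp: diag_mult_vec)
    moreover have "vec.dim (UNIV :: (complex ^ 2) set) = CARD(2)"
      by (rule vec_dim_card)
    ultimately show ?thesis using True by (simp del: vec.dim_UNIV)
  next
    case False
    then have "{v. ?D *v v = complex_of_real x *s v} = {v. v $ 2 = 0}"
      "{v. ?D *v v = complex_of_real y *s v} = {v. v $ 1 = 0}"
      by (auto simp: diag_mult_vec)
    then show ?thesis using False by (simp add: vec_dim_axis)
  qed
  ultimately show ?thesis by (simp add: von_neumann_entropy_def)
qed

text \<open>With C = 2ab, 1 - C^2 is the square of a^2 - b^2, which is nonnegative because a \<ge>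
  b. The argument of the binary entropy in \<open>EoC\<close> is therefore the larger eigenvalue
  a^2.\<close>

lemma entanglement_psi_s:
  assumes "a \<ge> b" "b \<ge> 0" "a\<^sup>2 + b\<^sup>2 = 1"
  shows "entanglement (psi_s a b) = EoC (2 * a * b)"
proof -
  have "partial_trace_fst (ketbra (psi_s a b)) = mat22 (complex_of_real (a\<^sup>2)) 0 0 (complex_of_real (b\<^sup>2))"
    by (rule mat22_eqI) (simp_all add: partial_trace_fst_def ketbra_def sum_2 power2_eq_square)
  then have E: "entanglement (psi_s a b) = - (a\<^sup>2 * log 2 (a\<^sup>2) + b\<^sup>2 * log 2 (b\<^sup>2))"
    by (simp only: entanglement_def von_neumann_entropy_diag)
  have "1 - (2 * a * b)\<^sup>2 = (a\<^sup>2 + b\<^sup>2)\<^sup>2 - (2 * a * b)\<^sup>2"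
    using assms by simp
  also have "\<dots> = (a\<^sup>2 - b\<^sup>2)\<^sup>2"
    by (simp add: power2_eq_square algebra_simps)
  finally have "sqrt (1 - (2 * a * b)\<^sup>2) = a\<^sup>2 - b\<^sup>2"
    using assms by (simp add: power_mono)
  moreover have b: "b\<^sup>2 = 1 - a\<^sup>2" using assms by simp
  ultimately have "(1 + sqrt (1 - (2 * a * b)\<^sup>2)) / 2 = a\<^sup>2" by simp
  then show ?thesis
    unfolding E EoC_def binary_entropy_def by (simp add: b)
qed

lemma binary_entropy_decreasing:
  assumes "1 / 2 \<le> x" "x < y" "y \<le> 1" shows "binary_entropy y < binary_entropy x"
\<comment> \<open>At the endpoint the summand (1 - z) ln (1 - z) is not covered by the continuity
  rules for \<open>ln\<close>. There the entropy is 0, against a positive value at x.\<close>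
proof (cases "y = 1")
  case True
  have "log 2 x < 0" "log 2 (1 - x) < 0"
    using assms by simp_all
  then have "x * log 2 x < 0" "(1 - x) * log 2 (1 - x) < 0"
    using assms by (simp_all add: mult_pos_neg)
  then show ?thesis using True by (simp add: binary_entropy_def)
next
  case False
  let ?f = "\<lambda>z. - z * ln z - (1 - z) * ln (1 - z)"
  have der: "(?f has_real_derivative ln (1 - z) - ln z) (at z)" if "0 < z" "z < 1" for z
    using that by (auto intro!: derivative_eq_intros simp: left_diff_distrib)
      (simp add: field_simps)
  have "?f y < ?f x"
  proof (rule DERIV_neg_imp_decreasing_open[OF \<open>x < y\<close>])
    fix z assume "x < z" "z < y"
    then show "\<exists>d. (?f has_real_derivative d) (at z) \<and> d < 0"
      using assms False by (intro exI[of _ "ln (1 - z) - ln z"] conjI der) auto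
  next
    show "continuous_on {x..y} ?f"
      using assms False by (intro continuous_intros) auto
  qed
  then have "?f y / ln 2 < ?f x / ln 2"
    by (intro divide_strict_right_mono) simp_all
  then show ?thesis
    by (simp add: binary_entropy_def log_def diff_divide_distrib)
qed

lemma EoC_inject:
  assumes "0 \<le> C" "C \<le> 1" "0 \<le> C'" "C' \<le> 1"
  shows "EoC C = EoC C' \<longleftrightarrow> C = C'"
proof
  assume eq: "EoC C = EoC C'"
  have range: "1 / 2 \<le> (1 + sqrt (1 - c\<^sup>2)) / 2 \<and> (1 + sqrt (1 - c\<^sup>2)) / 2 \<le> 1"
    if "0 \<le> c" "c \<le> 1" for c :: real
    using that power_le_one[of c 2] by (simp add: real_sqrt_le_1_iff)
  have "(1 + sqrt (1 - C\<^sup>2)) / 2 = (1 + sqrt (1 - C'\<^sup>2)) / 2"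
    using eq binary_entropy_decreasing range assms unfolding EoC_def
    by (metis less_irrefl linorder_neqE_linordered_idom)
  then have "C\<^sup>2 = C'\<^sup>2" by simp
  then show "C = C'" using assms by (simp add: power2_eq_iff_nonneg)
qed simp

section \<open>Decompositions as balanced ensembles\<close>

text \<open>Measuring qubit 1 yields two equiprobable states of concurrence \<open>C\<close>; the vectors are not normalized.\<close>

definition balanced :: "three_qubit \<Rightarrow> real \<Rightarrow> bool" where
  "balanced \<psi> C \<longleftrightarrow> (\<exists>x y. LU_equivalent \<psi> (pencil x y) \<and> (norm x)\<^sup>2 = 1 / 2 \<and> (norm y)\<^sup>2 = 1 / 2 \<and>
     cmod (cform x x) = C / 2 \<and> cmod (cform y y) = C / 2)"

lemma tensor_scale:
  "((mat22 \<omega> 0 0 \<omega> ** A) \<otimes>\<^sub>m (mat22 \<omega>' 0 0 \<omega>' ** B)) *v x = (\<omega> * \<omega>') *s ((A \<otimes>\<^sub>m B) *v x)"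
proof -
  have "(mat22 \<omega> 0 0 \<omega> \<otimes>\<^sub>m mat22 \<omega>' 0 0 \<omega>') *v y = (\<omega> * \<omega>') *s y" for y
    by (simp add: two_qubit_eq_iff matrix_vector_mult_def mat_tensor_def sum_two_qubit)
  then show ?thesis
    by (simp flip: mat_tensor_mult matrix_vector_mul_assoc)
qed

lemma matrix_vector_vscale: "A *v (c *s x) = c *s (A *v x)" for x :: "complex ^ 'n::finite"
  by (simp add: vec_eq_iff matrix_vector_mult_def sum_distrib_left mult_ac)

lemma LU_pencil_local:
  assumes "LU_equivalent \<psi> (pencil x y)" "unitary V" "unitary W"
  shows "LU_equivalent \<psi> (pencil ((V \<otimes>\<^sub>m W) *v x) ((V \<otimes>\<^sub>m W) *v y))"
proof -
  have "unitary (mat22 1 0 0 1)" by (simp add: unitary_mat22_iff)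
  from LU_pencilI[OF this assms(2,3), of x y] show ?thesis
    using LU_equivalent_trans[OF assms(1)] by simp
qed

text \<open>Absorbs the outer \<open>Z\<close>-rotations: \<open>Z(t) \<otimes> Z(-t)\<close> fixes \<open>|\<psi>\<^sub>s\<rangle>\<close>.\<close>

lemma LU_pencil_canonical:
  assumes LU: "LU_equivalent \<psi> (pencil (h *s psi_s a b) (h *s ((U \<otimes>\<^sub>m V) *v psi_s a b)))"
    and "unitary U" "unitary V"
  obtains \<alpha> \<beta> \<gamma> \<beta>' where "\<alpha> \<in> {- pi / 2 <.. pi / 2}" "\<gamma> \<in> {- pi / 2 <.. pi / 2}"
    "\<beta> \<in> {0 .. pi / 2}" "\<beta>' \<in> {0 .. pi / 2}"
    "LU_equivalent \<psi> (pencil (h *s psi_s a b)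
       (h *s (((Z_rot \<alpha> ** Y_rot \<beta> ** Z_rot \<gamma>) \<otimes>\<^sub>m Y_rot \<beta>') *v psi_s a b)))"
proof -
  obtain \<omega> \<alpha> \<beta> \<gamma> where U: "cmod \<omega> = 1" "0 \<le> \<beta>" "\<beta> \<le> pi / 2"
    "U = mat22 \<omega> 0 0 \<omega> ** (Z_rot \<alpha> ** Y_rot \<beta> ** Z_rot \<gamma>)"
    by (rule unitary_ZYZ[OF assms(2)])
  obtain \<omega>' \<alpha>' \<beta>' \<gamma>' where V: "cmod \<omega>' = 1" "0 \<le> \<beta>'" "\<beta>' \<le> pi / 2"
    "V = mat22 \<omega>' 0 0 \<omega>' ** (Z_rot \<alpha>' ** Y_rot \<beta>' ** Z_rot \<gamma>')"
    by (rule unitary_ZYZ[OF assms(3)])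
  obtain \<epsilon> \<alpha>'' where A: "cmod \<epsilon> = 1" "\<alpha>'' \<in> {- pi / 2 <.. pi / 2}"
    "Z_rot (\<alpha>' + \<alpha>) = mat22 \<epsilon> 0 0 \<epsilon> ** Z_rot \<alpha>''"
    by (rule Z_rot_mod_pi)
  obtain \<epsilon>' \<gamma>'' where G: "cmod \<epsilon>' = 1" "\<gamma>'' \<in> {- pi / 2 <.. pi / 2}"
    "Z_rot (\<gamma> + \<gamma>') = mat22 \<epsilon>' 0 0 \<epsilon>' ** Z_rot \<gamma>''"
    by (rule Z_rot_mod_pi)
  have scalar: "A ** mat22 c 0 0 c = mat22 c 0 0 c ** A" for A c
    by (rule mat22_cases[of A]) (simp add: mat22_mult mult.commute)
  \<comment> \<open>On the span of |00> and |11> a pair of Z-rotations acts only through the sum of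
    the angles.\<close>
  have right: "(Z_rot \<gamma> \<otimes>\<^sub>m Z_rot \<gamma>') *v psi_s a b = (Z_rot (\<gamma> + \<gamma>') \<otimes>\<^sub>m mat 1) *v psi_s a b"
    unfolding Z_rot mat22_one tensor_psi_s by (simp add: two_qubit_eq_iff cis_mult)
  have inv: "(Z_rot \<alpha>' \<otimes>\<^sub>m Z_rot (- \<alpha>')) *v psi_s a b = psi_s a b"
    unfolding Z_rot tensor_psi_s by (simp add: two_qubit_eq_iff cis_mult)
  have "(Z_rot \<alpha>' \<otimes>\<^sub>m Z_rot (- \<alpha>')) *v ((U \<otimes>\<^sub>m V) *v psi_s a b) =
      (\<omega> * \<omega>') *s ((Z_rot \<alpha>' \<otimes>\<^sub>m Z_rot (- \<alpha>')) *v
        (((Z_rot \<alpha> ** Y_rot \<beta>) \<otimes>\<^sub>m (Z_rot \<alpha>' ** Y_rot \<beta>')) *v ((Z_rot \<gamma> \<otimes>\<^sub>m Z_rot \<gamma>') *v psi_s a b)))"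
    unfolding U V tensor_scale matrix_vector_vscale by (simp add: matrix_vector_mul_assoc mat_tensor_mult)
  also have "\<dots> = (\<omega> * \<omega>') *s (((Z_rot (\<alpha>' + \<alpha>) ** Y_rot \<beta> ** Z_rot (\<gamma> + \<gamma>')) \<otimes>\<^sub>m
      (Z_rot (- \<alpha>' + \<alpha>') ** Y_rot \<beta>')) *v psi_s a b)"
    unfolding right by (simp only: matrix_vector_mul_assoc mat_tensor_mult matrix_mul_assoc Z_rot_add matrix_mul_rid)
  also have "Z_rot (\<alpha>' + \<alpha>) ** Y_rot \<beta> ** Z_rot (\<gamma> + \<gamma>') =
      mat22 (\<epsilon> * \<epsilon>') 0 0 (\<epsilon> * \<epsilon>') ** (Z_rot \<alpha>'' ** Y_rot \<beta> ** Z_rot \<gamma>'')"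
  proof -
    have "Z_rot (\<alpha>' + \<alpha>) ** Y_rot \<beta> ** Z_rot (\<gamma> + \<gamma>') =
        mat22 \<epsilon> 0 0 \<epsilon> ** (((Z_rot \<alpha>'' ** Y_rot \<beta>) ** mat22 \<epsilon>' 0 0 \<epsilon>') ** Z_rot \<gamma>'')"
      by (simp only: A G matrix_mul_assoc)
    also have "\<dots> = (mat22 \<epsilon> 0 0 \<epsilon> ** mat22 \<epsilon>' 0 0 \<epsilon>') ** (Z_rot \<alpha>'' ** Y_rot \<beta> ** Z_rot \<gamma>'')"
      unfolding scalar[of "Z_rot \<alpha>'' ** Y_rot \<beta>"] by (simp only: matrix_mul_assoc)
    finally show ?thesis by (simp only: mat22_mult) simp
  qed
  also have "Z_rot (- \<alpha>' + \<alpha>') ** Y_rot \<beta>' = mat22 1 0 0 1 ** Y_rot \<beta>'"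
    by (simp add: Z_rot)
  finally have *: "(Z_rot \<alpha>' \<otimes>\<^sub>m Z_rot (- \<alpha>')) *v ((U \<otimes>\<^sub>m V) *v psi_s a b) = (\<omega> * \<omega>' * (\<epsilon> * \<epsilon>')) *s
      (((Z_rot \<alpha>'' ** Y_rot \<beta> ** Z_rot \<gamma>'') \<otimes>\<^sub>m Y_rot \<beta>') *v psi_s a b)"
    unfolding tensor_scale by simp
  define \<Omega> where "\<Omega> = \<omega> * \<omega>' * (\<epsilon> * \<epsilon>')"
  let ?x = "((Z_rot \<alpha>'' ** Y_rot \<beta> ** Z_rot \<gamma>'') \<otimes>\<^sub>m Y_rot \<beta>') *v psi_s a b"
  have \<Omega>: "cmod \<Omega> = 1"
    using U(1) V(1) A(1) G(1) by (simp add: \<Omega>_def norm_mult)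
  then have \<Omega>': "\<Omega> * cnj \<Omega> = 1"
    using complex_norm_square[of \<Omega>] by simp
  have "LU_equivalent \<psi> (pencil (h *s psi_s a b) (h *s (\<Omega> *s ?x)))"
    using LU_pencil_local[OF LU unitary_Z_rot unitary_Z_rot, of \<alpha>' "- \<alpha>'"]
    unfolding matrix_vector_vscale inv * \<Omega>_def .
  \<comment> \<open>All scalars split off so far multiply the branch |1> of qubit 1 only, so a
    diagonal unitary on that qubit removes them.\<close>
  from LU_pencil_phases[OF this, of 1 "cnj \<Omega>"]
  have "LU_equivalent \<psi> (pencil (h *s psi_s a b) ((\<Omega> * cnj \<Omega> * h) *s ?x))"
    using \<Omega> by (simp add: mult_ac)
  then have "LU_equivalent \<psi> (pencil (h *s psi_s a b) (h *s ?x))"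
    unfolding \<Omega>' by simp
  then show thesis
    using that A G U V by simp
qed

lemma decomposition_state:
  "(1 / sqrt 2) *\<^sub>R (ket0 \<otimes>\<^sub>v x + ket1 \<otimes>\<^sub>v y) =
     pencil (complex_of_real (1 / sqrt 2) *s x) (complex_of_real (1 / sqrt 2) *s y)"
  by (rule pencil_eqI) (simp_all add: vec_tensor_def scaleR_conv_of_real[where 'a=complex])

text \<open>Norm and concurrence determine the ordered Schmidt coefficients of a two-qubit vector.
  Two vectors with equal values thus differ by local unitaries, and undoing those of the first
  vector produces the required shape.\<close>

lemma decomposition_iff_balanced:
  assumes "0 \<le> C" "C \<le> 1"
  shows "(\<exists>a b \<alpha> \<beta> \<gamma> \<beta>'. is_decomposition \<psi> a b \<alpha> \<beta> \<gamma> \<beta>' \<and> entanglement (psi_s a b) = EoC C) \<longleftrightarrow> balanced \<psi> C"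
proof
  let ?h = "complex_of_real (1 / sqrt 2)"
  have h: "?h * ?h = complex_of_real (1 / 2)"
    by (simp flip: of_real_mult)
  have normh: "(norm (?h *s x))\<^sup>2 = (norm x)\<^sup>2 / 2" for x :: two_qubit
    by (simp add: norm_vscale norm_divide power_mult_distrib power_divide)
  have cformh: "cmod (cform (?h *s x) (?h *s x)) = cmod (cform x x) / 2" for x
  proof -
    have "cform (?h *s x) (?h *s x) = complex_of_real (1 / 2) * cform x x"
      by (simp only: cform_add_left cform_add_right cform_scale_left cform_scale_right mult.assoc[symmetric] h)
    then show ?thesis by (simp only: norm_mult norm_of_real)
  qed
  {
    assume "\<exists>a b \<alpha> \<beta> \<gamma> \<beta>'. is_decomposition \<psi> a b \<alpha> \<beta> \<gamma> \<beta>' \<and> entanglement (psi_s a b) = EoC C"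
    then obtain a b \<alpha> \<beta> \<gamma> \<beta>' where dec: "is_decomposition \<psi> a b \<alpha> \<beta> \<gamma> \<beta>'"
      and E: "entanglement (psi_s a b) = EoC C" by blast
    let ?U = "Z_rot \<alpha> ** Y_rot \<beta> ** Z_rot \<gamma>" and ?V = "Y_rot \<beta>'"
    have ab: "a \<ge> b" "b \<ge> 0" "a\<^sup>2 + b\<^sup>2 = 1"
      and LU: "LU_equivalent \<psi> (pencil (?h *s psi_s a b) (?h *s ((?U \<otimes>\<^sub>m ?V) *v psi_s a b)))"
      using dec unfolding is_decomposition_def Let_def decomposition_state by simp_all
    have "0 \<le> 2 * a * b" "2 * a * b \<le> 1"
      using ab sum_squares_bound[of a b] by simp_all
    then have C: "2 * a * b = C"
      using E assms EoC_inject unfolding entanglement_psi_s[OF ab] by blast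
    have U: "unitary ?U" "unitary ?V"
      by (intro unitary_mult unitary_Z_rot unitary_Y_rot)+
    have conc: "cmod (cform (psi_s a b) (psi_s a b)) = C"
      using C assms by (simp only: cform_psi_s norm_of_real abs_of_nonneg)
    show "balanced \<psi> C"
      unfolding balanced_def
      by (intro exI conjI, rule LU)
        (simp_all only: normh cformh norm_unitary[OF unitary_tensor[OF U]] norm_psi_s cform_tensor ab(3) conc
          norm_mult cmod_det_unitary[OF U(1)] cmod_det_unitary[OF U(2)] mult_1)
  next
    assume "balanced \<psi> C"
    then obtain x y where LU: "LU_equivalent \<psi> (pencil x y)" and n: "(norm x)\<^sup>2 = 1 / 2" "(norm y)\<^sup>2 = 1 / 2"
      and c: "cmod (cform x x) = C / 2" "cmod (cform y y) = C / 2"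
      unfolding balanced_def by blast
    define s where "s = complex_of_real (sqrt 2)"
    have hs: "?h * s = 1" by (simp add: s_def)
    obtain U V a b where UV: "unitary U" "unitary V" and ab: "a \<ge> b" "b \<ge> 0"
      and x: "s *s x = (U \<otimes>\<^sub>m V) *v psi_s a b" by (rule schmidt)
    obtain U' V' a' b' where UV': "unitary U'" "unitary V'" and ab': "a' \<ge> b'" "b' \<ge> 0"
      and y: "s *s y = (U' \<otimes>\<^sub>m V') *v psi_s a' b'" by (rule schmidt)
    have x': "x = ?h *s ((U \<otimes>\<^sub>m V) *v psi_s a b)" and y': "y = ?h *s ((U' \<otimes>\<^sub>m V') *v psi_s a' b')"
      unfolding x[symmetric] y[symmetric] by (simp_all only: vector_smult_assoc hs vector_smult_lid)
    have one: "a\<^sup>2 + b\<^sup>2 = 1" "a'\<^sup>2 + b'\<^sup>2 = 1"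
      using n unfolding x' y' normh norm_unitary[OF unitary_tensor[OF UV]] norm_unitary[OF unitary_tensor[OF UV']]
        norm_psi_s by simp_all
    have "2 * a * b = C" "2 * a' * b' = C"
      using c ab ab' unfolding x' y' cformh cform_tensor cform_psi_s norm_mult norm_of_real
        cmod_det_unitary[OF UV(1)] cmod_det_unitary[OF UV(2)] cmod_det_unitary[OF UV'(1)] cmod_det_unitary[OF UV'(2)]
      by simp_all
    \<comment> \<open>These squares are 1 + C and 1 - C, and the ordering of the coefficients fixes
      the signs of the roots.\<close>
    with one have "(a' + b')\<^sup>2 = (a + b)\<^sup>2" "(a' - b')\<^sup>2 = (a - b)\<^sup>2"
      by (simp_all add: power2_sum power2_diff)
    then have "a' + b' = a + b" "a' - b' = a - b"
      using ab ab' by (simp_all add: power2_eq_iff_nonneg)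
    then have eq: "a' = a" "b' = b"
      by simp_all
    let ?U = "mat_adjoint U ** U'" and ?V = "mat_adjoint V ** V'"
    have "LU_equivalent \<psi> (pencil ((mat_adjoint U \<otimes>\<^sub>m mat_adjoint V) *v x) ((mat_adjoint U \<otimes>\<^sub>m mat_adjoint V) *v y))"
      using LU UV by (intro LU_pencil_local unitary_adjoint)
    moreover have "(mat_adjoint U \<otimes>\<^sub>m mat_adjoint V) *v x = ?h *s psi_s a b"
      using UV unfolding x' matrix_vector_vscale by (simp add: matrix_vector_mul_assoc mat_tensor_mult unitary_def)
    moreover have "(mat_adjoint U \<otimes>\<^sub>m mat_adjoint V) *v y = ?h *s ((?U \<otimes>\<^sub>m ?V) *v psi_s a b)"
      unfolding y' matrix_vector_vscale eq by (simp add: matrix_vector_mul_assoc mat_tensor_mult)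
    ultimately have "LU_equivalent \<psi> (pencil (?h *s psi_s a b) (?h *s ((?U \<otimes>\<^sub>m ?V) *v psi_s a b)))"
      by simp
    moreover have "unitary ?U" "unitary ?V"
      using UV UV' by (simp_all add: unitary_mult unitary_adjoint)
    ultimately obtain \<alpha> \<beta> \<gamma> \<beta>' where "\<alpha> \<in> {- pi / 2 <.. pi / 2}" "\<gamma> \<in> {- pi / 2 <.. pi / 2}"
      "\<beta> \<in> {0 .. pi / 2}" "\<beta>' \<in> {0 .. pi / 2}"
      "LU_equivalent \<psi> (pencil (?h *s psi_s a b)
         (?h *s (((Z_rot \<alpha> ** Y_rot \<beta> ** Z_rot \<gamma>) \<otimes>\<^sub>m Y_rot \<beta>') *v psi_s a b)))"
      by (rule LU_pencil_canonical)
    then have "is_decomposition \<psi> a b \<alpha> \<beta> \<gamma> \<beta>'"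
      unfolding is_decomposition_def Let_def decomposition_state using ab one by simp
    moreover have "entanglement (psi_s a b) = EoC C"
      using entanglement_psi_s[OF ab one(1)] \<open>2 * a * b = C\<close> by simp
    ultimately show "\<exists>a b \<alpha> \<beta> \<gamma> \<beta>'. is_decomposition \<psi> a b \<alpha> \<beta> \<gamma> \<beta>' \<and> entanglement (psi_s a b) = EoC C"
      by blast
  }
qed

section \<open>Balanced ensembles in terms of the Takagi form\<close>

lemma norm_ket0: "norm ket0 = 1"
  by (simp add: ket0_def norm_axis_1)

lemma braket_ket0: "braket ket0 x = x $ 1"
  by (simp add: braket_def sum_2)

lemma takagi_norms:
  assumes "takagi \<psi> u v l m" "norm \<psi> = 1" shows "(norm u)\<^sup>2 + (norm v)\<^sup>2 = 1"
  using norm_LU[of \<psi> "pencil u v"] assms by (simp add: takagi_def flip: norm_pencil)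

lemma takagi_le_one:
  assumes "takagi \<psi> u v l m" "norm \<psi> = 1" shows "l + m \<le> 1"
  using cmod_cform_le[of u] cmod_cform_le[of v] takagi_norms[OF assms] assms(1) by (simp add: takagi_def)

text \<open>The ensemble is (u + \<omega> v)/sqrt 2 and (u - \<omega> v)/sqrt 2. The hypothesis
  removes the cross terms, so both norms agree; the form sees only the square of \<omega>, so both
  concurrences agree as well.\<close>

lemma balancedI:
  assumes T: "takagi \<psi> u v l m" and "norm \<psi> = 1" and \<omega>: "cmod \<omega> = 1" "Re (\<omega> * braket u v) = 0"
  shows "balanced \<psi> (cmod (complex_of_real l + \<omega>\<^sup>2 * complex_of_real m))"
proof -
  define h where "h = complex_of_real (1 / sqrt 2)"
  have h: "h * h = 1 / 2" "cnj h = h" "(cmod h)\<^sup>2 = 1 / 2"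
    unfolding h_def by (simp_all add: norm_divide power_divide flip: of_real_mult)
  have U: "unitary (mat22 h (h * \<omega>) h (- h * \<omega>))"
  proof -
    have "\<omega> * cnj \<omega> = 1" using \<omega>(1) complex_norm_square[of \<omega>] by simp
    then have "h * cnj h + h * \<omega> * cnj (- h * \<omega>) = 0"
      by (simp add: mult_ac)
    then show ?thesis
      using h(3) \<omega>(1) by (simp add: unitary_mat22_iff norm_mult)
  qed
  let ?x = "h *s u + (h * \<omega>) *s v" and ?y = "h *s u + (- h * \<omega>) *s v"
  have "LU_equivalent \<psi> (pencil ?x ?y)"
    using T U by (intro LU_pencil_recombine) (simp_all add: takagi_def)
  moreover have r: "Re (cnj h * (h * \<omega>) * braket u v) = 0" "Re (cnj h * (- h * \<omega>) * braket u v) = 0"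
  proof -
    have e: "cnj h * (h * \<omega>) * braket u v = (\<omega> * braket u v) / 2"
      "cnj h * (- h * \<omega>) * braket u v = - (\<omega> * braket u v) / 2"
      using h by (simp_all add: mult.assoc[symmetric])
    show "Re (cnj h * (h * \<omega>) * braket u v) = 0" "Re (cnj h * (- h * \<omega>) * braket u v) = 0"
      unfolding e using \<omega>(2) by simp_all
  qed
  have nw: "(cmod (h * \<omega>))\<^sup>2 = 1 / 2" "(cmod (- h * \<omega>))\<^sup>2 = 1 / 2"
    using h(3) \<omega>(1) by (simp_all add: norm_mult)
  have "(norm ?x)\<^sup>2 = 1 / 2" "(norm ?y)\<^sup>2 = 1 / 2"
    unfolding norm_square_add_scaled r h(3) nw using takagi_norms[OF T assms(2)] by simp_all
  moreover have "cform ?x ?x = h * h * (complex_of_real l + \<omega>\<^sup>2 * complex_of_real m)"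
    "cform ?y ?y = h * h * (complex_of_real l + \<omega>\<^sup>2 * complex_of_real m)"
    unfolding cform_lincomb using T by (simp_all add: takagi_def power2_eq_square algebra_simps)
  then have "cmod (cform ?x ?x) = cmod (complex_of_real l + \<omega>\<^sup>2 * complex_of_real m) / 2"
    "cmod (cform ?y ?y) = cmod (complex_of_real l + \<omega>\<^sup>2 * complex_of_real m) / 2"
    unfolding h by (simp_all only: norm_mult) (simp_all add: norm_divide)
  ultimately show ?thesis
    unfolding balanced_def by blast
qed

text \<open>Only the coefficients p, q of the first vector are kept. The second vector has weights
  |q|^2 and |p|^2, so its triangle inequalities become the two bounds on p and q.\<close>

lemma balanced_coefficients:
  assumes T: "takagi \<psi> u v l m" and "norm \<psi> = 1" and "balanced \<psi> C"
  obtains p q where "(cmod p)\<^sup>2 + (cmod q)\<^sup>2 = 1"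
    "cmod (p\<^sup>2 * complex_of_real l + q\<^sup>2 * complex_of_real m) = C / 2"
    "C / 2 \<le> (cmod q)\<^sup>2 * l + (cmod p)\<^sup>2 * m" "\<bar>(cmod q)\<^sup>2 * l - (cmod p)\<^sup>2 * m\<bar> \<le> C / 2"
    "(cmod p)\<^sup>2 * (norm u)\<^sup>2 + (cmod q)\<^sup>2 * (norm v)\<^sup>2 + 2 * Re (cnj p * q * braket u v) = 1 / 2"
proof -
  obtain x y where LU: "LU_equivalent \<psi> (pencil x y)" and n: "(norm x)\<^sup>2 = 1 / 2"
    and c: "cmod (cform x x) = C / 2" "cmod (cform y y) = C / 2"
    using assms(3) unfolding balanced_def by blast
  have "LU_equivalent (pencil u v) (pencil x y)"
    using T LU LU_equivalent_sym LU_equivalent_trans unfolding takagi_def by blast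
  then obtain p q r s V W where U: "unitary (mat22 p q r s)" "unitary V" "unitary W" and
    xy: "pencil x y = pencil (p *s ((V \<otimes>\<^sub>m W) *v u) + q *s ((V \<otimes>\<^sub>m W) *v v))
            (r *s ((V \<otimes>\<^sub>m W) *v u) + s *s ((V \<otimes>\<^sub>m W) *v v))"
    by (rule LU_pencilE)
  have "x = p *s ((V \<otimes>\<^sub>m W) *v u) + q *s ((V \<otimes>\<^sub>m W) *v v)" "y = r *s ((V \<otimes>\<^sub>m W) *v u) + s *s ((V \<otimes>\<^sub>m W) *v v)"
    using arg_cong[OF xy, of "\<lambda>\<phi>. \<phi> $ (1, _)"] arg_cong[OF xy, of "\<lambda>\<phi>. \<phi> $ (2, _)"]
    by (simp_all add: vec_eq_iff del: split_paired_All)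
  then have x: "x = (V \<otimes>\<^sub>m W) *v (p *s u + q *s v)" and y: "y = (V \<otimes>\<^sub>m W) *v (r *s u + s *s v)"
    by (simp_all add: matrix_vector_right_distrib matrix_vector_vscale)
  have norm1: "(cmod p)\<^sup>2 * (norm u)\<^sup>2 + (cmod q)\<^sup>2 * (norm v)\<^sup>2 + 2 * Re (cnj p * q * braket u v) = 1 / 2"
    using n unfolding x norm_unitary[OF unitary_tensor[OF U(2,3)]] norm_square_add_scaled .
  have cf: "cmod (p\<^sup>2 * complex_of_real l + q\<^sup>2 * complex_of_real m) = C / 2"
    "cmod (r\<^sup>2 * complex_of_real l + s\<^sup>2 * complex_of_real m) = C / 2"
    using c T unfolding x y cform_tensor norm_mult cmod_det_unitary[OF U(2)] cmod_det_unitary[OF U(3)] cform_lincomb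
    by (simp_all add: takagi_def power2_eq_square)
  have lm: "l \<ge> 0" "m \<ge> 0" using T by (simp_all add: takagi_def)
  have rs: "cmod (r\<^sup>2 * complex_of_real l) = (cmod q)\<^sup>2 * l" "cmod (s\<^sup>2 * complex_of_real m) = (cmod p)\<^sup>2 * m"
    using unitary_mat22_second_row[OF U(1)] lm by (simp_all add: norm_mult norm_power)
  show thesis
  proof (rule that[OF _ cf(1) _ _ norm1])
    show "(cmod p)\<^sup>2 + (cmod q)\<^sup>2 = 1" using U(1) by (simp add: unitary_mat22_iff)
    show "C / 2 \<le> (cmod q)\<^sup>2 * l + (cmod p)\<^sup>2 * m"
      unfolding cf(2)[symmetric] rs[symmetric] by (rule norm_triangle_ineq)
    show "\<bar>(cmod q)\<^sup>2 * l - (cmod p)\<^sup>2 * m\<bar> \<le> C / 2"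
      unfolding cf(2)[symmetric] rs[symmetric] by (metis norm_triangle_ineq3 norm_minus_cancel diff_minus_eq_add)
  qed
qed

text \<open>The mixed term contains the real part of (p cnj q)^2. Together with
  \<open>cmod_square_cross\<close> this turns equality in a triangle inequality into a statement on
  the phase of p cnj q.\<close>

lemma cmod_square_weighted_sum:
  "(cmod (p\<^sup>2 * complex_of_real l + q\<^sup>2 * complex_of_real m))\<^sup>2 =
     ((cmod p)\<^sup>2 * l)\<^sup>2 + ((cmod q)\<^sup>2 * m)\<^sup>2 + 2 * l * m * ((Re (p * cnj q))\<^sup>2 - (Im (p * cnj q))\<^sup>2)"
  unfolding cmod_power2 by (simp add: power2_eq_square algebra_simps)

lemma cmod_square_cross: "(Re (p * cnj q))\<^sup>2 + (Im (p * cnj q))\<^sup>2 = (cmod p)\<^sup>2 * (cmod q)\<^sup>2"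
  unfolding cmod_power2[symmetric] by (simp add: norm_mult power_mult_distrib)

text \<open>The upper triangle bounds of the two vectors add up to l + m, exactly the sum of the
  values to be reached, so both are tight. This gives (2P - 1)(l - m) = 0 and Im z = 0. For l = m
  the weight P stays free, which explains the disjunction.\<close>

lemma balanced_sum:
  assumes T: "takagi \<psi> u v l m" and "norm \<psi> = 1" and bal: "balanced \<psi> (l + m)" and lm: "l > 0" "m > 0"
  shows "l = m \<or> Re (braket u v) = 0"
proof (rule disjCI)
  assume g: "Re (braket u v) \<noteq> 0"
  obtain p q where one: "(cmod p)\<^sup>2 + (cmod q)\<^sup>2 = 1"
    and c: "cmod (p\<^sup>2 * complex_of_real l + q\<^sup>2 * complex_of_real m) = (l + m) / 2"
    and le: "(l + m) / 2 \<le> (cmod q)\<^sup>2 * l + (cmod p)\<^sup>2 * m"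
    and "\<bar>(cmod q)\<^sup>2 * l - (cmod p)\<^sup>2 * m\<bar> \<le> (l + m) / 2"
    and n: "(cmod p)\<^sup>2 * (norm u)\<^sup>2 + (cmod q)\<^sup>2 * (norm v)\<^sup>2 + 2 * Re (cnj p * q * braket u v) = 1 / 2"
    by (rule balanced_coefficients[OF assms(1-3)])
  define P where "P = (cmod p)\<^sup>2"
  have Q: "(cmod q)\<^sup>2 = 1 - P" using one by (simp add: P_def)
  have "(l + m) / 2 \<le> cmod (p\<^sup>2 * complex_of_real l) + cmod (q\<^sup>2 * complex_of_real m)"
    unfolding c[symmetric] by (rule norm_triangle_ineq)
  then have "(l + m) / 2 \<le> P * l + (1 - P) * m"
    using lm by (simp add: norm_mult norm_power Q flip: P_def)
  then have "(l + m) / 2 \<le> P * l + m - P * m"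
    by (simp add: algebra_simps)
  moreover have "(l + m) / 2 \<le> l - P * l + P * m"
    using le unfolding Q P_def[symmetric] by (simp add: algebra_simps)
  ultimately have "P * l - P * m = (l - m) / 2" by argo
  then have eq: "P * l + (1 - P) * m = (l + m) / 2" "(2 * P - 1) * (l - m) = 0"
    by (simp_all add: field_simps)
  define z where "z = p * cnj q"
  have "((l + m) / 2)\<^sup>2 = (P * l)\<^sup>2 + ((1 - P) * m)\<^sup>2 + 2 * l * m * ((Re z)\<^sup>2 - (Im z)\<^sup>2)"
    using cmod_square_weighted_sum[of p l q m] unfolding c Q P_def[symmetric] z_def .
  then have "(P * l + (1 - P) * m)\<^sup>2 = (P * l)\<^sup>2 + ((1 - P) * m)\<^sup>2 + 2 * l * m * ((Re z)\<^sup>2 - (Im z)\<^sup>2)"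
    unfolding eq .
  then have "l * m * (P * (1 - P)) = l * m * ((Re z)\<^sup>2 - (Im z)\<^sup>2)"
    by (simp add: power2_eq_square algebra_simps)
  then have "P * (1 - P) = (Re z)\<^sup>2 - (Im z)\<^sup>2"
    using lm by simp
  moreover have cross: "(Re z)\<^sup>2 + (Im z)\<^sup>2 = P * (1 - P)"
    unfolding z_def cmod_square_cross Q P_def ..
  ultimately have Im: "Im z = 0" by simp
  show "l = m"
  proof (rule ccontr)
    assume "l \<noteq> m"
    \<comment> \<open>With equal weights the norms of \<open>u\<close> and \<open>v\<close> already
      contribute 1/2, so the cross term must vanish, and z is real and nonzero.\<close>
    then have P: "P = 1 / 2" using eq(2) by simp
    have "Re (cnj p * q * braket u v) = 0"
      using n takagi_norms[OF assms(1,2)] unfolding Q P_def[symmetric] P by simp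
    moreover have "Re (cnj p * q * braket u v) = Re z * Re (braket u v) + Im z * Im (braket u v)"
      by (simp add: z_def algebra_simps)
    ultimately have "Re z = 0"
      using g unfolding Im by simp
    then show False using cross unfolding Im P by simp
  qed
qed

text \<open>The reverse triangle inequalities of the two vectors bound P (l + m) from both sides by
  (l + m)/2. As l + m > 0, the weight is 1/2 also for l = m. Minimality of the modulus then makes z
  purely imaginary, and the norm condition concerns Im <u|v>.\<close>

lemma balanced_diff:
  assumes T: "takagi \<psi> u v l m" and "norm \<psi> = 1" and bal: "balanced \<psi> \<bar>l - m\<bar>" and lm: "l > 0" "m > 0"
  shows "Im (braket u v) = 0"
proof -
  obtain p q where one: "(cmod p)\<^sup>2 + (cmod q)\<^sup>2 = 1"
    and c: "cmod (p\<^sup>2 * complex_of_real l + q\<^sup>2 * complex_of_real m) = \<bar>l - m\<bar> / 2"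
    and "\<bar>l - m\<bar> / 2 \<le> (cmod q)\<^sup>2 * l + (cmod p)\<^sup>2 * m"
    and le: "\<bar>(cmod q)\<^sup>2 * l - (cmod p)\<^sup>2 * m\<bar> \<le> \<bar>l - m\<bar> / 2"
    and n: "(cmod p)\<^sup>2 * (norm u)\<^sup>2 + (cmod q)\<^sup>2 * (norm v)\<^sup>2 + 2 * Re (cnj p * q * braket u v) = 1 / 2"
    by (rule balanced_coefficients[OF assms(1-3)])
  define P where "P = (cmod p)\<^sup>2"
  have Q: "(cmod q)\<^sup>2 = 1 - P" using one by (simp add: P_def)
  have "\<bar>cmod (p\<^sup>2 * complex_of_real l) - cmod (q\<^sup>2 * complex_of_real m)\<bar> \<le> \<bar>l - m\<bar> / 2"
    unfolding c[symmetric] by (metis norm_triangle_ineq3 norm_minus_cancel diff_minus_eq_add)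
  then have "\<bar>P * l - (1 - P) * m\<bar> \<le> \<bar>l - m\<bar> / 2"
    using lm by (simp add: norm_mult norm_power Q flip: P_def)
  with le have "P * (l + m) = (1 / 2) * (l + m)"
    unfolding Q P_def[symmetric] by (simp add: algebra_simps abs_le_iff abs_if split: if_splits)
  then have P: "P = 1 / 2" using lm by simp
  define z where "z = p * cnj q"
  have "(\<bar>l - m\<bar> / 2)\<^sup>2 = (P * l)\<^sup>2 + ((1 - P) * m)\<^sup>2 + 2 * l * m * ((Re z)\<^sup>2 - (Im z)\<^sup>2)"
    using cmod_square_weighted_sum[of p l q m] unfolding c Q P_def[symmetric] z_def .
  then have "l * m * (- 1 / 4) = l * m * ((Re z)\<^sup>2 - (Im z)\<^sup>2)"
    unfolding P by (simp add: power2_eq_square field_simps)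
  then have "- 1 / 4 = (Re z)\<^sup>2 - (Im z)\<^sup>2"
    using lm by (simp only: mult_cancel_left) simp
  moreover have cross: "(Re z)\<^sup>2 + (Im z)\<^sup>2 = 1 / 4"
    unfolding z_def cmod_square_cross Q P_def[symmetric] P by simp
  ultimately have "(Re z)\<^sup>2 = 0" by linarith
  then have Re: "Re z = 0" by simp
  have "Re (cnj p * q * braket u v) = 0"
    using n takagi_norms[OF assms(1,2)] unfolding Q P_def[symmetric] P by simp
  moreover have "Re (cnj p * q * braket u v) = Re z * Re (braket u v) + Im z * Im (braket u v)"
    by (simp add: z_def algebra_simps)
  ultimately show ?thesis
    using cross unfolding Re by auto
qed

section \<open>The W-class\<close>

text \<open>Cayley's hyperdeterminant up to sign: the discriminant of the determinant on the pencil.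
  Its modulus is, up to a factor, the three-tangle.\<close>

definition hyperdet :: "three_qubit \<Rightarrow> complex" where
  "hyperdet \<psi> = (let u = (\<chi> jk. \<psi> $ (1, jk)); v = (\<chi> jk. \<psi> $ (2, jk)) in cform u u * cform v v - (cform u v)\<^sup>2)"

lemma hyperdet_pencil: "hyperdet (pencil u v) = cform u u * cform v v - (cform u v)\<^sup>2"
  by (simp add: hyperdet_def vec_nth_inverse)

text \<open>Invertible local operators contribute nonzero factors, so vanishing of
  \<open>hyperdet\<close> is constant on their orbits. The direction from the W-class to l m = 0
  rests on this.\<close>

lemma hyperdet_tensor:
  "hyperdet ((A \<otimes>\<^sub>m B \<otimes>\<^sub>m C) *v \<psi>) = (det A)\<^sup>2 * (det B * det C)\<^sup>2 * hyperdet \<psi>"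
proof -
  obtain p q r s where A: "A = mat22 p q r s" by (rule mat22_cases)
  obtain u v where psi: "\<psi> = pencil u v" by (rule pencil_cases)
  show ?thesis
    unfolding A psi tensor_pencil hyperdet_pencil cform_lincomb cform_tensor det_mat22
    by (simp add: power2_eq_square algebra_simps)
qed

lemma hyperdet_takagi:
  assumes "takagi \<psi> u v l m" shows "hyperdet \<psi> = 0 \<longleftrightarrow> l * m = 0"
proof -
  obtain A B C where U: "unitary A" "unitary B" "unitary C" and uv: "pencil u v = (A \<otimes>\<^sub>m B \<otimes>\<^sub>m C) *v \<psi>"
    using assms unfolding takagi_def LU_equivalent_def by blast
  have "det A \<noteq> 0" "det B \<noteq> 0" "det C \<noteq> 0"
    using U cmod_det_unitary by fastforce+
  then have "hyperdet \<psi> = 0 \<longleftrightarrow> hyperdet (pencil u v) = 0"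
    unfolding uv hyperdet_tensor by simp
  also have "\<dots> \<longleftrightarrow> l * m = 0"
    using assms by (simp add: hyperdet_pencil takagi_def)
  finally show ?thesis .
qed

lemma W_state_pencil:
  "ket0 \<otimes>\<^sub>v ket0 \<otimes>\<^sub>v ket1 + ket0 \<otimes>\<^sub>v ket1 \<otimes>\<^sub>v ket0 + ket1 \<otimes>\<^sub>v ket0 \<otimes>\<^sub>v ket0 =
     pencil (ket0 \<otimes>\<^sub>v ket1 + ket1 \<otimes>\<^sub>v ket0) (ket0 \<otimes>\<^sub>v ket0)"
  by (simp add: pencil_def vec_tensor_def vec_eq_iff algebra_simps)

lemma hyperdet_W_class:
  assumes "\<psi> \<in> W_class" shows "hyperdet \<psi> = 0"
proof -
  have "hyperdet (pencil (ket0 \<otimes>\<^sub>v ket1 + ket1 \<otimes>\<^sub>v ket0) (ket0 \<otimes>\<^sub>v ket0)) = 0"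
    by (simp add: hyperdet_pencil cform_def vec_tensor_def)
  then show ?thesis
    using assms unfolding W_class_def W_state_pencil by (auto simp: hyperdet_tensor)
qed

lemma invertible_unitary: "unitary A \<Longrightarrow> invertible A"
  unfolding unitary_def invertible_def by blast

lemma invertible_mat22: "invertible (mat22 a b c d) \<longleftrightarrow> a * d - b * c \<noteq> 0"
  by (simp add: invertible_det_nz det_mat22)

lemma W_class_LU:
  assumes LU: "LU_equivalent \<psi> \<psi>'" and W: "\<psi>' \<in> W_class" and "norm \<psi> = 1" "truly_tripartite_entangled \<psi>"
  shows "\<psi> \<in> W_class"
proof -
  obtain V\<^sub>1 V\<^sub>2 V\<^sub>3 where V: "unitary V\<^sub>1" "unitary V\<^sub>2" "unitary V\<^sub>3" "\<psi> = (V\<^sub>1 \<otimes>\<^sub>m V\<^sub>2 \<otimes>\<^sub>m V\<^sub>3) *v \<psi>'"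
    using LU_equivalent_sym[OF LU] unfolding LU_equivalent_def by blast
  obtain A\<^sub>1 A\<^sub>2 A\<^sub>3 where A: "invertible A\<^sub>1" "invertible A\<^sub>2" "invertible A\<^sub>3"
    "\<psi>' = (A\<^sub>1 \<otimes>\<^sub>m A\<^sub>2 \<otimes>\<^sub>m A\<^sub>3) *v
       (ket0 \<otimes>\<^sub>v ket0 \<otimes>\<^sub>v ket1 + ket0 \<otimes>\<^sub>v ket1 \<otimes>\<^sub>v ket0 + ket1 \<otimes>\<^sub>v ket0 \<otimes>\<^sub>v ket0)"
    using W unfolding W_class_def by blast
  have "invertible (V\<^sub>1 ** A\<^sub>1)" "invertible (V\<^sub>2 ** A\<^sub>2)" "invertible (V\<^sub>3 ** A\<^sub>3)"
    using V A by (simp_all add: invertible_mult invertible_unitary)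
  moreover have "\<psi> = ((V\<^sub>1 ** A\<^sub>1) \<otimes>\<^sub>m (V\<^sub>2 ** A\<^sub>2) \<otimes>\<^sub>m (V\<^sub>3 ** A\<^sub>3)) *v
       (ket0 \<otimes>\<^sub>v ket0 \<otimes>\<^sub>v ket1 + ket0 \<otimes>\<^sub>v ket1 \<otimes>\<^sub>v ket0 + ket1 \<otimes>\<^sub>v ket0 \<otimes>\<^sub>v ket0)"
    unfolding V A by (simp only: matrix_vector_mul_assoc mat_tensor_mult)
  ultimately show ?thesis
    unfolding W_class_def using assms(3,4) by blast
qed

lemma column_unitary_inverse:
  obtains V where "unitary V" "V *v x = complex_of_real (norm x) *s ket0"
proof -
  obtain F a where F: "unitary F" "a \<ge> 0" "x = complex_of_real a *s (F *v ket0)"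
    by (rule column_unitary)
  have "norm x = a"
    using F by (simp add: norm_vscale norm_unitary norm_ket0)
  moreover have "mat_adjoint F *v x = complex_of_real a *s ket0"
    using F by (simp add: matrix_vector_vscale matrix_vector_mul_assoc unitary_def)
  ultimately show thesis using that[of "mat_adjoint F"] F unitary_adjoint by blast
qed

text \<open>The vector v lies in the radical of the form, so it is a product and can be rotated to
  k|00>. Orthogonality to u removes the |11> component of u, which leaves |00>, |01> and |10>, the
  pattern of the W state.\<close>

lemma W_classI:
  assumes LU: "LU_equivalent \<psi> (pencil u v)" and "norm \<psi> = 1" "truly_tripartite_entangled \<psi>"
    and z: "cform v v = 0" "cform u v = 0"
  shows "\<psi> \<in> W_class"
proof -
  obtain f g where v: "v = f \<otimes>\<^sub>v g" using z(1) by (rule cform_self_zeroE)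
  obtain F where F: "unitary F" "F *v f = complex_of_real (norm f) *s ket0" by (rule column_unitary_inverse)
  obtain G where G: "unitary G" "G *v g = complex_of_real (norm g) *s ket0" by (rule column_unitary_inverse)
  define u' v' where "u' = (F \<otimes>\<^sub>m G) *v u" and "v' = (F \<otimes>\<^sub>m G) *v v"
  define k where "k = complex_of_real (norm f * norm g)"
  have "v' = (complex_of_real (norm f) *s ket0) \<otimes>\<^sub>v (complex_of_real (norm g) *s ket0)"
    by (simp only: v'_def v mat_tensor_vec_tensor F G)
  then have v': "v' = k *s (ket0 \<otimes>\<^sub>v ket0)"
    by (simp add: k_def vec_eq_iff vec_tensor_def mult_ac)
  have LU': "LU_equivalent \<psi> (pencil u' v')"
    unfolding u'_def v'_def using LU F G by (intro LU_pencil_local)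
  then have truly: "truly_tripartite_entangled (pencil u' v')"
    using assms(3) LU_truly_tripartite by blast
  have norm1: "norm (pencil u' v') = 1"
    using norm_LU[OF LU'] assms(2) by simp
  have "v' \<noteq> 0"
    using truly_tripartite_pencil_proportional[OF truly, of 1 u' 0] by auto
  then have k: "k \<noteq> 0" by (auto simp: v')
  have "cform u' v' = 0"
    unfolding u'_def v'_def cform_tensor z by simp
  then have u22: "u' $ (2,2) = 0"
    using k by (simp add: v' cform_def vec_tensor_def)
  \<comment> \<open>Otherwise qubit 3 would factor out; likewise qubit 2 if the component at (2,1)
    vanished.\<close>
  have "u' $ (1,2) \<noteq> 0"
  proof
    assume "u' $ (1,2) = 0"
    then have "u' = vector [u' $ (1,1), u' $ (2,1)] \<otimes>\<^sub>v ket0"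
      using u22 by (simp add: two_qubit_eq_iff vec_tensor_def)
    moreover have "v' = (k *s ket0) \<otimes>\<^sub>v ket0" by (simp add: v' two_qubit_eq_iff vec_tensor_def)
    ultimately show False using truly_tripartite_pencil_common_snd[OF truly] by blast
  qed
  moreover have "u' $ (2,1) \<noteq> 0"
  proof
    assume "u' $ (2,1) = 0"
    then have "u' = ket0 \<otimes>\<^sub>v vector [u' $ (1,1), u' $ (1,2)]"
      using u22 by (simp add: two_qubit_eq_iff vec_tensor_def)
    moreover have "v' = ket0 \<otimes>\<^sub>v (k *s ket0)" by (simp add: v' two_qubit_eq_iff vec_tensor_def)
    ultimately show False using truly_tripartite_pencil_common_fst[OF truly] by blast
  qed
  ultimately have inv: "invertible (mat22 1 (u' $ (1,1)) 0 k)" "invertible (mat22 1 0 0 (u' $ (2,1)))"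
    "invertible (mat22 1 0 0 (u' $ (1,2)))"
    using k by (simp_all add: invertible_mat22)
  let ?B = "mat22 1 0 0 (u' $ (2,1)) \<otimes>\<^sub>m mat22 1 0 0 (u' $ (1,2))"
  have B: "?B *v (ket0 \<otimes>\<^sub>v ket1 + ket1 \<otimes>\<^sub>v ket0) = u' $ (1,2) *s (ket0 \<otimes>\<^sub>v ket1) + u' $ (2,1) *s (ket1 \<otimes>\<^sub>v ket0)"
    "?B *v (ket0 \<otimes>\<^sub>v ket0) = ket0 \<otimes>\<^sub>v ket0"
    by (simp_all add: two_qubit_eq_iff vec_tensor_def matrix_vector_mult_def mat_tensor_def sum_two_qubit)
  \<comment> \<open>The diagonal operators on qubits 2, 3 scale |01> and |10> and fix |00>; the
    triangular one on qubit 1 supplies the |00> part of u' and the factor k.\<close>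
  have "(mat22 1 (u' $ (1,1)) 0 k \<otimes>\<^sub>m ?B) *v pencil (ket0 \<otimes>\<^sub>v ket1 + ket1 \<otimes>\<^sub>v ket0) (ket0 \<otimes>\<^sub>v ket0) =
      pencil (1 *s (u' $ (1,2) *s (ket0 \<otimes>\<^sub>v ket1) + u' $ (2,1) *s (ket1 \<otimes>\<^sub>v ket0)) + u' $ (1,1) *s (ket0 \<otimes>\<^sub>v ket0))
        (0 *s (u' $ (1,2) *s (ket0 \<otimes>\<^sub>v ket1) + u' $ (2,1) *s (ket1 \<otimes>\<^sub>v ket0)) + k *s (ket0 \<otimes>\<^sub>v ket0))"
    unfolding tensor_pencil B ..
  also have "\<dots> = pencil u' v'"
    by (rule arg_cong2[of _ _ _ _ pencil])
      (simp_all add: two_qubit_eq_iff vec_tensor_def u22 v')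
  finally have eq: "pencil u' v' = (mat22 1 (u' $ (1,1)) 0 k \<otimes>\<^sub>m ?B) *v pencil (ket0 \<otimes>\<^sub>v ket1 + ket1 \<otimes>\<^sub>v ket0) (ket0 \<otimes>\<^sub>v ket0)"
    by (rule sym)
  have "pencil u' v' \<in> W_class"
    unfolding W_class_def W_state_pencil
    by (intro CollectI conjI exI, rule norm1, rule truly, rule inv(1), rule inv(2), rule inv(3), rule eq)
  then show ?thesis
    using W_class_LU LU' assms(2,3) by blast
qed

lemma W_class_iff:
  assumes "takagi \<psi> u v l m" "norm \<psi> = 1" "truly_tripartite_entangled \<psi>"
  shows "\<psi> \<in> W_class \<longleftrightarrow> l * m = 0"
proof
  assume "l * m = 0"
  then consider "l = 0" | "m = 0" by auto
  then show "\<psi> \<in> W_class"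
  proof cases
    case 1
    then have "takagi \<psi> v u m 0" using takagi_swap assms(1) by blast
    then show ?thesis
      using assms(2,3) by (intro W_classI[of \<psi> v u]) (simp_all add: takagi_def)
  next
    case 2
    then show ?thesis
      using assms by (intro W_classI[of \<psi> u v]) (simp_all add: takagi_def)
  qed
qed (use hyperdet_W_class hyperdet_takagi[OF assms(1)] in blast)

section \<open>Sums of two product states\<close>

lemma phase_exists: "\<exists>\<zeta>. cmod \<zeta> = 1 \<and> z = \<zeta> * complex_of_real (cmod z) \<and> (Im z = 0 \<longrightarrow> Im \<zeta> = 0)"
proof (cases "z = 0")
  case True
  then show ?thesis by (intro exI[of _ 1]) simp
next
  case False
  then show ?thesis by (intro exI[of _ "z / complex_of_real (cmod z)"]) (simp add: norm_divide)
qed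

text \<open>If one factor vanishes, its phase is free and is chosen to cancel the other one.\<close>

lemma real_product_phases:
  assumes "Im (z * w) = 0"
  shows "\<exists>\<zeta> \<xi>. cmod \<zeta> = 1 \<and> cmod \<xi> = 1 \<and> z = \<zeta> * complex_of_real (cmod z) \<and> w = \<xi> * complex_of_real (cmod w) \<and>
    Im (\<zeta> * \<xi>) = 0"
proof -
  obtain \<zeta> where \<zeta>: "cmod \<zeta> = 1" "z = \<zeta> * complex_of_real (cmod z)" using phase_exists by blast
  obtain \<xi> where \<xi>: "cmod \<xi> = 1" "w = \<xi> * complex_of_real (cmod w)" using phase_exists by blast
  consider "z = 0" | "w = 0" | "z \<noteq> 0" "w \<noteq> 0" by blast
  then show ?thesis
  proof cases
    case 1
    have "Im (cnj \<xi> * \<xi>) = 0" by (simp add: mult.commute)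
    then show ?thesis using 1 \<xi> by (intro exI[of _ "cnj \<xi>"] exI[of _ \<xi>]) simp
  next
    case 2
    have "Im (\<zeta> * cnj \<zeta>) = 0" by (simp add: mult.commute)
    then show ?thesis using 2 \<zeta> by (intro exI[of _ \<zeta>] exI[of _ "cnj \<zeta>"]) simp
  next
    case 3
    have "z * w = (\<zeta> * \<xi>) * complex_of_real (cmod z * cmod w)"
      using \<zeta>(2) \<xi>(2) by (metis mult.assoc mult.left_commute of_real_mult)
    then have "Im (\<zeta> * \<xi>) * (cmod z * cmod w) = 0"
      using assms by (metis Im_complex_of_real Re_complex_of_real add.right_neutral mult_zero_right times_complex.sel(2) add_0)
    then show ?thesis using 3 \<zeta> \<xi> by (intro exI[of _ \<zeta>] exI[of _ \<xi>]) simp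
  qed
qed

text \<open>Once x is rotated to |0>, the phase of |1> is still free. The overlap forces the phase
  \<zeta> on the first component of the image of y, and the free phase gives the second component
  the same one; what remains is real.\<close>

lemma align_pair:
  assumes "y \<noteq> 0" "cmod \<zeta> = 1" "braket x y = \<zeta> * complex_of_real (cmod (braket x y))" "x \<noteq> 0"
  obtains V \<phi> where "unitary V" "real_unit_vec \<phi>" "V *v x = complex_of_real (norm x) *s ket0"
    "V *v y = (\<zeta> * complex_of_real (norm y)) *s \<phi>"
proof -
  obtain F where F: "unitary F" "F *v x = complex_of_real (norm x) *s ket0" by (rule column_unitary_inverse)
  define w where "w = F *v y"
  have "braket x y = braket (F *v x) (F *v y)" by (simp only: braket_unitary[OF F(1)])
  also have "\<dots> = complex_of_real (norm x) * w $ 1"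
    unfolding F w_def[symmetric] by (simp add: braket_scale_left braket_ket0)
  finally have b: "braket x y = complex_of_real (norm x) * w $ 1" .
  have "complex_of_real (norm x) * w $ 1 = complex_of_real (norm x) * (\<zeta> * complex_of_real (cmod (w $ 1)))"
    using assms(3) unfolding b by (simp add: norm_mult mult_ac)
  then have w1: "w $ 1 = \<zeta> * complex_of_real (cmod (w $ 1))" using assms(4) by simp
  obtain \<xi> where \<xi>: "cmod \<xi> = 1" "w $ 2 = \<xi> * complex_of_real (cmod (w $ 2))" using phase_exists by blast
  have \<xi>': "cnj \<xi> * \<xi> = 1" using \<xi>(1) complex_norm_square[of \<xi>] by (simp add: mult.commute)
  define V where "V = mat22 1 0 0 (\<zeta> * cnj \<xi>) ** F"
  define n where "n = norm y"
  have n: "n \<noteq> 0" using assms(1) by (simp add: n_def)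
  define \<phi> :: qubit where "\<phi> = vector [complex_of_real (cmod (w $ 1) / n), complex_of_real (cmod (w $ 2) / n)]"
  have V: "unitary V"
    unfolding V_def using F(1) assms(2) \<xi>(1) by (intro unitary_mult) (simp_all add: unitary_mat22_iff norm_mult)
  have Vx: "V *v x = complex_of_real (norm x) *s ket0"
    unfolding V_def matrix_vector_mul_assoc[symmetric] F(2)
    by (simp add: vec_eq_iff forall_2 mat22_mult_vec_nth)
  have "(\<zeta> * cnj \<xi>) * w $ 2 = \<zeta> * complex_of_real (cmod (w $ 2)) * (cnj \<xi> * \<xi>)"
    by (subst \<xi>(2)) (simp add: mult_ac)
  then have Vy: "V *v y = (\<zeta> * complex_of_real n) *s \<phi>"
    unfolding V_def matrix_vector_mul_assoc[symmetric] w_def[symmetric] \<xi>'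
    using n w1 by (simp add: vec_eq_iff forall_2 mat22_mult_vec_nth \<phi>_def)
  have "norm (V *v y) = n" unfolding n_def using V by (rule norm_unitary)
  then have "norm \<phi> = 1"
    using n assms(2) unfolding Vy norm_vscale by (simp add: norm_mult n_def)
  moreover have "\<forall>i. \<phi> $ i \<in> \<real>"
    by (simp add: \<phi>_def forall_2)
  ultimately show thesis using that[of V \<phi>] V Vx Vy unfolding real_unit_vec_def n_def by blast
qed

lemma propto_form_of_products:
  assumes LU: "LU_equivalent \<psi> (x\<^sub>1 \<otimes>\<^sub>v x\<^sub>2 \<otimes>\<^sub>v x\<^sub>3 + y\<^sub>1 \<otimes>\<^sub>v y\<^sub>2 \<otimes>\<^sub>v y\<^sub>3)" and "norm \<psi> = 1"
    and nz: "x\<^sub>1 \<noteq> 0" "x\<^sub>2 \<noteq> 0" "x\<^sub>3 \<noteq> 0" "y\<^sub>1 \<noteq> 0" "y\<^sub>2 \<noteq> 0" "y\<^sub>3 \<noteq> 0"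
    and \<zeta>: "cmod \<zeta>\<^sub>1 = 1" "cmod \<zeta>\<^sub>2 = 1" "cmod \<zeta>\<^sub>3 = 1"
    and b: "braket x\<^sub>1 y\<^sub>1 = \<zeta>\<^sub>1 * complex_of_real (cmod (braket x\<^sub>1 y\<^sub>1))"
      "braket x\<^sub>2 y\<^sub>2 = \<zeta>\<^sub>2 * complex_of_real (cmod (braket x\<^sub>2 y\<^sub>2))"
      "braket x\<^sub>3 y\<^sub>3 = \<zeta>\<^sub>3 * complex_of_real (cmod (braket x\<^sub>3 y\<^sub>3))"
  shows "propto_form \<psi> (\<zeta>\<^sub>1 * \<zeta>\<^sub>2 * \<zeta>\<^sub>3 *
    complex_of_real ((norm y\<^sub>1 * norm y\<^sub>2 * norm y\<^sub>3) / (norm x\<^sub>1 * norm x\<^sub>2 * norm x\<^sub>3)))"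
    (is "propto_form \<psi> ?z")
proof -
  obtain V\<^sub>1 \<phi>\<^sub>1 where V1: "unitary V\<^sub>1" "real_unit_vec \<phi>\<^sub>1" "V\<^sub>1 *v x\<^sub>1 = complex_of_real (norm x\<^sub>1) *s ket0"
    "V\<^sub>1 *v y\<^sub>1 = (\<zeta>\<^sub>1 * complex_of_real (norm y\<^sub>1)) *s \<phi>\<^sub>1" by (rule align_pair[OF nz(4) \<zeta>(1) b(1) nz(1)])
  obtain V\<^sub>2 \<phi>\<^sub>2 where V2: "unitary V\<^sub>2" "real_unit_vec \<phi>\<^sub>2" "V\<^sub>2 *v x\<^sub>2 = complex_of_real (norm x\<^sub>2) *s ket0"
    "V\<^sub>2 *v y\<^sub>2 = (\<zeta>\<^sub>2 * complex_of_real (norm y\<^sub>2)) *s \<phi>\<^sub>2" by (rule align_pair[OF nz(5) \<zeta>(2) b(2) nz(2)])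
  obtain V\<^sub>3 \<phi>\<^sub>3 where V3: "unitary V\<^sub>3" "real_unit_vec \<phi>\<^sub>3" "V\<^sub>3 *v x\<^sub>3 = complex_of_real (norm x\<^sub>3) *s ket0"
    "V\<^sub>3 *v y\<^sub>3 = (\<zeta>\<^sub>3 * complex_of_real (norm y\<^sub>3)) *s \<phi>\<^sub>3" by (rule align_pair[OF nz(6) \<zeta>(3) b(3) nz(3)])
  define X where "X = norm x\<^sub>1 * norm x\<^sub>2 * norm x\<^sub>3"
  have X: "X > 0" using nz by (simp add: X_def)
  define z where "z = ?z"
  let ?S = "ket0 \<otimes>\<^sub>v ket0 \<otimes>\<^sub>v ket0 + z *s (\<phi>\<^sub>1 \<otimes>\<^sub>v \<phi>\<^sub>2 \<otimes>\<^sub>v \<phi>\<^sub>3)"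
  have zX: "complex_of_real X * z = \<zeta>\<^sub>1 * \<zeta>\<^sub>2 * \<zeta>\<^sub>3 * complex_of_real (norm y\<^sub>1 * norm y\<^sub>2 * norm y\<^sub>3)"
    using X unfolding z_def X_def[symmetric] by simp
  have "(V\<^sub>1 \<otimes>\<^sub>m V\<^sub>2 \<otimes>\<^sub>m V\<^sub>3) *v (x\<^sub>1 \<otimes>\<^sub>v x\<^sub>2 \<otimes>\<^sub>v x\<^sub>3 + y\<^sub>1 \<otimes>\<^sub>v y\<^sub>2 \<otimes>\<^sub>v y\<^sub>3) =
      complex_of_real X *s (ket0 \<otimes>\<^sub>v ket0 \<otimes>\<^sub>v ket0) + (complex_of_real X * z) *s (\<phi>\<^sub>1 \<otimes>\<^sub>v \<phi>\<^sub>2 \<otimes>\<^sub>v \<phi>\<^sub>3)"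
    unfolding matrix_vector_right_distrib mat_tensor_vec_tensor V1 V2 V3 zX
    by (simp add: vec_eq_iff vec_tensor_def X_def mult_ac)
  also have "\<dots> = X *\<^sub>R ?S"
    by (simp add: vec_eq_iff scaleR_conv_of_real[where 'a=complex] algebra_simps)
  finally have LU': "LU_equivalent \<psi> (X *\<^sub>R ?S)"
    using LU_equivalent_trans[OF LU] V1(1) V2(1) V3(1) unfolding LU_equivalent_def by metis
  then have "norm (X *\<^sub>R ?S) = 1"
    using norm_LU assms(2) by metis
  then have "X * norm ?S = 1"
    using X by simp
  \<comment> \<open>The factor X pulled out of the sum is already the normalization, because \<psi>
    has norm one.\<close>
  then have "inverse (norm ?S) = X"
    by (metis inverse_unique mult.commute)
  then have "X *\<^sub>R ?S = sgn ?S"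
    by (simp only: sgn_div_norm)
  then show ?thesis
    unfolding propto_form_def z_def[symmetric] using LU' V1(2) V2(2) V3(2) by metis
qed

lemma propto_form_minus_one:
  assumes "propto_form \<psi> (- 1)" shows "propto_form \<psi> 1"
proof -
  obtain \<phi>\<^sub>1 \<phi>\<^sub>2 \<phi>\<^sub>3 where \<phi>: "real_unit_vec \<phi>\<^sub>1" "real_unit_vec \<phi>\<^sub>2" "real_unit_vec \<phi>\<^sub>3"
    and LU: "LU_equivalent \<psi> (sgn (ket0 \<otimes>\<^sub>v ket0 \<otimes>\<^sub>v ket0 + (- 1) *s (\<phi>\<^sub>1 \<otimes>\<^sub>v \<phi>\<^sub>2 \<otimes>\<^sub>v \<phi>\<^sub>3)))"
    using assms unfolding propto_form_def by blast
  have "real_unit_vec (- \<phi>\<^sub>1)" using \<phi>(1) by (simp add: real_unit_vec_def)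
  moreover have "(- 1) *s (\<phi>\<^sub>1 \<otimes>\<^sub>v \<phi>\<^sub>2 \<otimes>\<^sub>v \<phi>\<^sub>3) = 1 *s ((- \<phi>\<^sub>1) \<otimes>\<^sub>v \<phi>\<^sub>2 \<otimes>\<^sub>v \<phi>\<^sub>3)"
    by (simp add: vec_eq_iff vec_tensor_def)
  ultimately show ?thesis
    using \<phi>(2,3) LU unfolding propto_form_def by metis
qed

text \<open>The zeros of the concurrence form on the span of \<open>u\<close>, \<open>v\<close> are product vectors; \<open>\<psi>\<close> is a sum over the two of them.\<close>

lemma takagi_propto_form:
  assumes T: "takagi \<psi> u v l m" and lm: "l > 0" "m > 0" and "norm \<psi> = 1" "truly_tripartite_entangled \<psi>"
  shows "\<exists>z. propto_form \<psi> z \<and> (Re (braket u v) = 0 \<longrightarrow> Im z = 0) \<and> (Im (braket u v) = 0 \<longrightarrow> cmod z = 1)"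
proof -
  have LU: "LU_equivalent \<psi> (pencil u v)" using T by (simp add: takagi_def)
  then have truly: "truly_tripartite_entangled (pencil u v)"
    using assms(5) LU_truly_tripartite by blast
  define a b where "a = complex_of_real (sqrt m)" and "b = \<i> * complex_of_real (sqrt l)"
  have ab: "a \<noteq> 0" "b \<noteq> 0" using lm by (simp_all add: a_def b_def)
  have sq: "a * a = complex_of_real m" "b * b = - complex_of_real l"
    using lm by (simp_all add: a_def b_def algebra_simps flip: of_real_mult)
  let ?P = "a *s u + b *s v" and ?Q = "a *s u + (- b) *s v"
  have "cform ?P ?P = 0" "cform ?Q ?Q = 0"
    using T unfolding cform_lincomb by (simp_all add: takagi_def sq)
  then obtain x\<^sub>2 x\<^sub>3 y\<^sub>2 y\<^sub>3 where P: "?P = x\<^sub>2 \<otimes>\<^sub>v x\<^sub>3" and Q: "?Q = y\<^sub>2 \<otimes>\<^sub>v y\<^sub>3"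
    by (metis cform_self_zeroE)
  \<comment> \<open>Solving for the original pair: u = (P + Q)/(2a) and v = (P - Q)/(2b), with P and
    Q the two product vectors.\<close>
  define x\<^sub>1 y\<^sub>1 :: qubit where "x\<^sub>1 = vector [1 / (2 * a), 1 / (2 * b)]" and "y\<^sub>1 = vector [1 / (2 * a), - 1 / (2 * b)]"
  have "pencil u v = x\<^sub>1 \<otimes>\<^sub>v ?P + y\<^sub>1 \<otimes>\<^sub>v ?Q"
    using ab by (intro pencil_eqI[symmetric]) (simp_all add: vec_tensor_def x\<^sub>1_def y\<^sub>1_def field_simps)
  then have LU': "LU_equivalent \<psi> (x\<^sub>1 \<otimes>\<^sub>v x\<^sub>2 \<otimes>\<^sub>v x\<^sub>3 + y\<^sub>1 \<otimes>\<^sub>v y\<^sub>2 \<otimes>\<^sub>v y\<^sub>3)"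
    using LU P Q by simp
  have PQ: "?P \<noteq> 0" "?Q \<noteq> 0"
  proof -
    have "c *s v \<noteq> u" for c
      using truly_tripartite_pencil_proportional[OF truly, of c v 1] by auto
    then have "u - c *s v \<noteq> 0" for c by (metis eq_iff_diff_eq_0)
    from this[of "- b / a"] this[of "b / a"] have "a *s (u - (- b / a) *s v) \<noteq> 0" "a *s (u - (b / a) *s v) \<noteq> 0"
      using ab by (simp_all only: vec.scale_eq_0_iff) simp_all
    moreover have e: "a *s (u - (- b / a) *s v) = ?P" "a *s (u - (b / a) *s v) = ?Q"
      using ab by (simp_all add: vec_eq_iff field_simps)
    ultimately show "?P \<noteq> 0" "?Q \<noteq> 0" unfolding e by simp_all
  qed
  have nz: "x\<^sub>1 \<noteq> 0" "x\<^sub>2 \<noteq> 0" "x\<^sub>3 \<noteq> 0" "y\<^sub>1 \<noteq> 0" "y\<^sub>2 \<noteq> 0" "y\<^sub>3 \<noteq> 0"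
    using PQ ab unfolding P Q by (auto simp: vec_tensor_def vec_eq_iff x\<^sub>1_def y\<^sub>1_def forall_2)
  have n1: "norm x\<^sub>1 = norm y\<^sub>1"
    by (simp add: norm_vec_def L2_set_def sum_2 x\<^sub>1_def y\<^sub>1_def norm_divide)
  have cab: "cnj a = a" "cnj b = - b" by (simp_all add: a_def b_def)
  have "braket x\<^sub>1 y\<^sub>1 = 1 / (4 * (a * a)) + 1 / (4 * (b * b))"
    by (simp add: braket_def sum_2 x\<^sub>1_def y\<^sub>1_def cab)
  then have "Im (braket x\<^sub>1 y\<^sub>1) = 0"
    unfolding sq by (simp add: Im_divide)
  then obtain \<zeta>\<^sub>1 where z1: "cmod \<zeta>\<^sub>1 = 1" "braket x\<^sub>1 y\<^sub>1 = \<zeta>\<^sub>1 * complex_of_real (cmod (braket x\<^sub>1 y\<^sub>1))" "Im \<zeta>\<^sub>1 = 0"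
    using phase_exists by blast
  have "braket ?P ?Q = a * a * complex_of_real ((norm u)\<^sup>2) + b * b * complex_of_real ((norm v)\<^sup>2)
      - a * b * (braket u v + cnj (braket u v))"
    unfolding braket_lincomb by (simp add: cab algebra_simps)
  \<comment> \<open>The squares of a and b are real while a b is imaginary, so only the real part of
    <u|v> makes the overlap of the two product vectors non-real.\<close>
  then have "Im (braket ?P ?Q) = - Im (a * b * complex_of_real (2 * Re (braket u v)))"
    unfolding sq complex_add_cnj by simp
  then have ImPQ: "Im (braket x\<^sub>2 y\<^sub>2 * braket x\<^sub>3 y\<^sub>3) = 0" if "Re (braket u v) = 0"
    using that unfolding P Q braket_vec_tensor by simp
  have "\<exists>\<zeta> \<xi>. cmod \<zeta> = 1 \<and> cmod \<xi> = 1 \<and> braket x\<^sub>2 y\<^sub>2 = \<zeta> * complex_of_real (cmod (braket x\<^sub>2 y\<^sub>2)) \<and>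
      braket x\<^sub>3 y\<^sub>3 = \<xi> * complex_of_real (cmod (braket x\<^sub>3 y\<^sub>3)) \<and> (Re (braket u v) = 0 \<longrightarrow> Im (\<zeta> * \<xi>) = 0)"
  proof (cases "Re (braket u v) = 0")
    case True
    then show ?thesis using real_product_phases[OF ImPQ] by blast
  next
    case False
    then show ?thesis using phase_exists by blast
  qed
  then obtain \<zeta>\<^sub>2 \<zeta>\<^sub>3 where z23: "cmod \<zeta>\<^sub>2 = 1" "cmod \<zeta>\<^sub>3 = 1"
    "braket x\<^sub>2 y\<^sub>2 = \<zeta>\<^sub>2 * complex_of_real (cmod (braket x\<^sub>2 y\<^sub>2))" "braket x\<^sub>3 y\<^sub>3 = \<zeta>\<^sub>3 * complex_of_real (cmod (braket x\<^sub>3 y\<^sub>3))"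
    and Im23: "Re (braket u v) = 0 \<Longrightarrow> Im (\<zeta>\<^sub>2 * \<zeta>\<^sub>3) = 0"
    by blast
  define R where "R = (norm y\<^sub>1 * norm y\<^sub>2 * norm y\<^sub>3) / (norm x\<^sub>1 * norm x\<^sub>2 * norm x\<^sub>3)"
  have "propto_form \<psi> (\<zeta>\<^sub>1 * \<zeta>\<^sub>2 * \<zeta>\<^sub>3 * complex_of_real R)"
    unfolding R_def by (rule propto_form_of_products[OF LU' assms(4) nz z1(1) z23(1,2) z1(2) z23(3,4)])
  moreover have "Im (\<zeta>\<^sub>1 * \<zeta>\<^sub>2 * \<zeta>\<^sub>3 * complex_of_real R) = 0" if "Re (braket u v) = 0"
  proof -
    have "Im (\<zeta>\<^sub>1 * (\<zeta>\<^sub>2 * \<zeta>\<^sub>3) * complex_of_real R) = 0"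
      using z1(3) Im23[OF that] unfolding times_complex.sel by simp
    then show ?thesis by (simp only: mult.assoc)
  qed
  moreover have "cmod (\<zeta>\<^sub>1 * \<zeta>\<^sub>2 * \<zeta>\<^sub>3 * complex_of_real R) = 1" if "Im (braket u v) = 0"
  proof -
    \<comment> \<open>Here cnj a * b is purely imaginary, so a real <u|v> contributes nothing to the
      norms of the two product vectors.\<close>
    have "Re (cnj a * b * braket u v) = 0" "Re (cnj a * - b * braket u v) = 0"
      using that by (simp_all add: a_def b_def)
    then have "(norm ?P)\<^sup>2 = (norm ?Q)\<^sup>2"
      unfolding norm_square_add_scaled by simp
    then have "norm x\<^sub>2 * norm x\<^sub>3 = norm y\<^sub>2 * norm y\<^sub>3"
      unfolding P Q norm_vec_tensor by (simp add: power2_eq_iff_nonneg)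
    then have "R = 1"
      unfolding R_def n1 mult.assoc using nz by simp
    then show ?thesis using z1 z23 by (simp add: norm_mult)
  qed
  ultimately show ?thesis by blast
qed

section \<open>From the normal form back to the Takagi form\<close>

lemma real_unit_vecE:
  assumes "real_unit_vec \<phi>"
  obtains t where "\<phi> $ 1 = complex_of_real (cos (2 * t))" "\<phi> $ 2 = complex_of_real (sin (2 * t))"
proof -
  have re: "\<phi> $ 1 = complex_of_real (Re (\<phi> $ 1))" "\<phi> $ 2 = complex_of_real (Re (\<phi> $ 2))"
    using assms by (simp_all add: real_unit_vec_def of_real_Re)
  have "(cmod (\<phi> $ 1))\<^sup>2 + (cmod (\<phi> $ 2))\<^sup>2 = (norm \<phi>)\<^sup>2"
    by (simp add: norm_vec_def L2_set_def sum_2)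
  then have "(Re (\<phi> $ 1))\<^sup>2 + (Re (\<phi> $ 2))\<^sup>2 = 1"
    using assms re by (metis norm_of_real one_power2 power2_abs real_unit_vec_def)
  then obtain s where "Re (\<phi> $ 1) = cos s" "Re (\<phi> $ 2) = sin s"
    by (metis sincos_total_2pi)
  then show thesis using re by (intro that[of "s / 2"]) simp_all
qed

text \<open>The eigenvectors of the concurrence form are along the two bisectors of \<open>|0\<rangle>\<close> and \<open>|\<phi>\<^sub>1\<rangle>\<close>.\<close>

lemma propto_form_takagi:
  assumes "propto_form \<psi> z" "norm \<psi> = 1" "truly_tripartite_entangled \<psi>"
  obtains u v l m where "takagi \<psi> u v l m" "l > 0" "m > 0"
    "Im z = 0 \<longrightarrow> Re (braket u v) = 0" "cmod z = 1 \<longrightarrow> Im (braket u v) = 0"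
proof -
  obtain \<phi>\<^sub>1 \<phi>\<^sub>2 \<phi>\<^sub>3 where \<phi>: "real_unit_vec \<phi>\<^sub>1" "real_unit_vec \<phi>\<^sub>2" "real_unit_vec \<phi>\<^sub>3"
    and LU: "LU_equivalent \<psi> (sgn (ket0 \<otimes>\<^sub>v ket0 \<otimes>\<^sub>v ket0 + z *s (\<phi>\<^sub>1 \<otimes>\<^sub>v \<phi>\<^sub>2 \<otimes>\<^sub>v \<phi>\<^sub>3)))"
      (is "LU_equivalent \<psi> (sgn ?S)")
    using assms(1) unfolding propto_form_def by blast
  obtain t where t: "\<phi>\<^sub>1 $ 1 = complex_of_real (cos (2 * t))" "\<phi>\<^sub>1 $ 2 = complex_of_real (sin (2 * t))"
    using \<phi>(1) by (rule real_unit_vecE)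
  define k w where "k = ket0 \<otimes>\<^sub>v ket0" and "w = \<phi>\<^sub>2 \<otimes>\<^sub>v \<phi>\<^sub>3"
  define h where "h = complex_of_real (1 / norm ?S)"
  let ?p = "h *s (k + (z * cos (2 * t)) *s w)" and ?q = "(h * z * sin (2 * t)) *s w"
  have "sgn ?S = pencil ?p ?q"
    by (rule pencil_eqI)
      (simp_all add: sgn_div_norm scaleR_conv_of_real[where 'a=complex] vec_tensor_def t k_def w_def h_def divide_simps)
  with LU have LU0: "LU_equivalent \<psi> (pencil ?p ?q)" by simp
  then have truly: "truly_tripartite_entangled (pencil ?p ?q)"
    using assms(3) LU_truly_tripartite by blast
  \<comment> \<open>Each way for the two product terms to share a factor would split off a qubit;
    excluding all three makes the form nondegenerate on the pencil.\<close>
  have "?q \<noteq> 0"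
    using truly_tripartite_pencil_proportional[OF truly, of 1 ?p 0] by auto
  then have nz: "h \<noteq> 0" "z \<noteq> 0" "sin (2 * t) \<noteq> 0" by auto
  have "\<phi>\<^sub>2 $ 2 \<noteq> 0"
  proof
    assume "\<phi>\<^sub>2 $ 2 = 0"
    then have "?p = ket0 \<otimes>\<^sub>v (h *s ket0 + (h * z * cos (2 * t) * \<phi>\<^sub>2 $ 1) *s \<phi>\<^sub>3)"
      "?q = ket0 \<otimes>\<^sub>v ((h * z * sin (2 * t) * \<phi>\<^sub>2 $ 1) *s \<phi>\<^sub>3)"
      by (simp_all add: two_qubit_eq_iff vec_tensor_def k_def w_def algebra_simps)
    then show False using truly_tripartite_pencil_common_fst[OF truly] by blast
  qed
  moreover have "\<phi>\<^sub>3 $ 2 \<noteq> 0"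
  proof
    assume "\<phi>\<^sub>3 $ 2 = 0"
    then have "?p = (h *s ket0 + (h * z * cos (2 * t) * \<phi>\<^sub>3 $ 1) *s \<phi>\<^sub>2) \<otimes>\<^sub>v ket0"
      "?q = ((h * z * sin (2 * t) * \<phi>\<^sub>3 $ 1) *s \<phi>\<^sub>2) \<otimes>\<^sub>v ket0"
      by (simp_all add: two_qubit_eq_iff vec_tensor_def k_def w_def algebra_simps)
    then show False using truly_tripartite_pencil_common_snd[OF truly] by blast
  qed
  ultimately have "\<phi>\<^sub>2 $ 2 * \<phi>\<^sub>3 $ 2 \<noteq> 0" by simp
  moreover define X where "X = 2 * z * (\<phi>\<^sub>2 $ 2 * \<phi>\<^sub>3 $ 2)"
  ultimately have X: "X \<noteq> 0" using nz by simp
  have cf: "cform k k = 0" "cform w w = 0" "cform k w = \<phi>\<^sub>2 $ 2 * \<phi>\<^sub>3 $ 2"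
    by (simp_all add: k_def w_def cform_vec_tensor)
  define c s where "c = complex_of_real (cos t)" and "s = complex_of_real (sin t)"
  have cs: "complex_of_real (cos (2 * t)) = c * c - s * s" "complex_of_real (sin (2 * t)) = 2 * s * c" "c * c + s * s = 1"
    unfolding c_def s_def cos_double sin_double
    by (simp_all add: power2_eq_square) (metis of_real_1 of_real_add of_real_mult sin_cos_squared_add3)
  \<comment> \<open>Up to the factor h, |0> has bisector coordinates (cos t, -sin t) and the first
    factor vector has (cos t, sin t), so the components are multiples of k + z w and k - z w. These
    are orthogonal for the form, since k and w are isotropic.\<close>
  define \<beta> \<delta> where "\<beta> = h * c" and "\<delta> = - h * s"
  let ?u = "\<beta> *s k + (\<beta> * z) *s w" and ?v = "\<delta> *s k + (- \<delta> * z) *s w"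
  have "LU_equivalent \<psi> (pencil (c *s ?p + s *s ?q) (- s *s ?p + c *s ?q))"
    unfolding c_def s_def by (rule LU_pencil_recombine[OF LU0 unitary_mat22_real])
  moreover have "c *s ?p + s *s ?q = ?u"
  proof -
    have "c * (h * (z * (c * c - s * s))) + s * (h * z * (2 * s * c)) = h * c * z * (c * c + s * s)"
      by (simp add: algebra_simps)
    then have "c * (h * (z * (c * c - s * s))) + s * (h * z * (2 * s * c)) = \<beta> * z"
      unfolding cs by (simp add: \<beta>_def)
    moreover have "c *s ?p + s *s ?q = (c * h) *s k + (c * (h * (z * (c * c - s * s))) + s * (h * z * (2 * s * c))) *s w"
      unfolding cs by (simp add: vec_eq_iff algebra_simps)
    ultimately show ?thesis by (simp add: \<beta>_def mult.commute)
  qed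
  moreover have "- s *s ?p + c *s ?q = ?v"
  proof -
    have "- s * (h * (z * (c * c - s * s))) + c * (h * z * (2 * s * c)) = h * s * z * (c * c + s * s)"
      by (simp add: algebra_simps)
    then have "- s * (h * (z * (c * c - s * s))) + c * (h * z * (2 * s * c)) = - \<delta> * z"
      unfolding cs by (simp add: \<delta>_def)
    moreover have "- s *s ?p + c *s ?q = (- s * h) *s k + (- s * (h * (z * (c * c - s * s))) + c * (h * z * (2 * s * c))) *s w"
      unfolding cs by (simp add: vec_eq_iff algebra_simps)
    ultimately show ?thesis by (simp add: \<delta>_def mult.commute)
  qed
  ultimately have LU1: "LU_equivalent \<psi> (pencil ?u ?v)" by simp
  obtain \<omega> where \<omega>: "cmod \<omega> = 1" "\<omega>\<^sup>2 * X = complex_of_real (cmod X)" using phase_root by blast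
  define l m where "l = (Re \<beta>)\<^sup>2 * cmod X" and "m = (Re \<delta>)\<^sup>2 * cmod X"
  have real: "\<beta> = complex_of_real (Re \<beta>)" "\<delta> = complex_of_real (Re \<delta>)"
    by (simp_all add: \<beta>_def \<delta>_def h_def c_def s_def)
  have "s \<noteq> 0" "c \<noteq> 0" using nz(3) by (auto simp: sin_double s_def c_def)
  then have "\<beta> \<noteq> 0" "\<delta> \<noteq> 0" using nz by (simp_all add: \<beta>_def \<delta>_def)
  then have "Re \<beta> \<noteq> 0" "Re \<delta> \<noteq> 0"
    using real by (metis of_real_0)+
  then have lm: "l > 0" "m > 0"
    using X by (simp_all add: l_def m_def)
  \<comment> \<open>On k - z w the form has the opposite sign; the extra factor i corrects it, and
    also exchanges the roles of the real and imaginary parts of the overlap.\<close>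
  have LU2: "LU_equivalent \<psi> (pencil (\<omega> *s ?u) ((\<i> * \<omega>) *s ?v))"
    using \<omega>(1) by (intro LU_pencil_phases LU1) (simp_all add: norm_mult)
  have "cform ?u ?u = \<beta> * \<beta> * X" "cform ?v ?v = - (\<delta> * \<delta> * X)" "cform ?u ?v = 0"
    unfolding cform_lincomb cf X_def by (simp_all add: algebra_simps)
  then have "cform (\<omega> *s ?u) (\<omega> *s ?u) = \<beta> * \<beta> * (\<omega>\<^sup>2 * X)"
    "cform ((\<i> * \<omega>) *s ?v) ((\<i> * \<omega>) *s ?v) = \<delta> * \<delta> * (\<omega>\<^sup>2 * X)" "cform (\<omega> *s ?u) ((\<i> * \<omega>) *s ?v) = 0"
    unfolding cform_scale_left cform_scale_right by (simp_all add: power2_eq_square mult_ac)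
  then have "cform (\<omega> *s ?u) (\<omega> *s ?u) = complex_of_real l"
    "cform ((\<i> * \<omega>) *s ?v) ((\<i> * \<omega>) *s ?v) = complex_of_real m" "cform (\<omega> *s ?u) ((\<i> * \<omega>) *s ?v) = 0"
    unfolding \<omega> l_def m_def using real by (simp_all add: power2_eq_square)
  then have T: "takagi \<psi> (\<omega> *s ?u) ((\<i> * \<omega>) *s ?v) l m"
    using LU2 lm by (simp add: takagi_def)
  have kx: "norm k = 1" "norm w = 1" "braket k w \<in> \<real>"
    using \<phi> by (simp_all add: k_def w_def norm_vec_tensor braket_vec_tensor real_unit_vec_def norm_ket0 braket_ket0)
  then obtain r where r: "braket k w = complex_of_real r" by (auto elim: Reals_cases)
  have "braket (\<omega> *s ?u) ((\<i> * \<omega>) *s ?v) = \<i> * (\<omega> * cnj \<omega>) * braket ?u ?v"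
    by (simp only: braket_scale_left braket_scale_right mult_ac)
  also have "\<omega> * cnj \<omega> = 1" using \<omega>(1) complex_norm_square[of \<omega>] by simp
  also have "braket ?u ?v = \<beta> * \<delta> * (1 - z * cnj z - (z - cnj z) * complex_of_real r)"
  proof -
    have "cnj \<beta> = \<beta>" "cnj \<delta> = \<delta>" using real by (metis complex_cnj_complex_of_real)+
    then show ?thesis unfolding braket_lincomb kx r by (simp add: algebra_simps)
  qed
  also have "\<beta> * \<delta> = complex_of_real (Re \<beta> * Re \<delta>)"
    using real by simp
  also have "z * cnj z = complex_of_real ((cmod z)\<^sup>2)"
    by (simp only: complex_norm_square)
  also have "z - cnj z = 2 * \<i> * complex_of_real (Im z)"
    by (simp add: complex_eq_iff)
  finally have g: "braket (\<omega> *s ?u) ((\<i> * \<omega>) *s ?v) = complex_of_real (Re \<beta> * Re \<delta>) *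
      (\<i> * complex_of_real (1 - (cmod z)\<^sup>2) + 2 * complex_of_real (Im z) * complex_of_real r)"
    by (simp add: algebra_simps)
  have "Re (braket (\<omega> *s ?u) ((\<i> * \<omega>) *s ?v)) = (Re \<beta> * Re \<delta>) * (2 * Im z * r)"
    "Im (braket (\<omega> *s ?u) ((\<i> * \<omega>) *s ?v)) = (Re \<beta> * Re \<delta>) * (1 - (cmod z)\<^sup>2)"
    unfolding g by (simp_all del: of_real_power of_real_diff)
  then show thesis using that[OF T lm] by simp
qed

section \<open>The classification\<close>

text \<open>Fixing this choice for l = m removes the exceptional case of
  \<open>balanced_sum\<close>.\<close>

lemma takagi_normalized_exists:
  obtains u v l m where "takagi \<psi> u v l m" "l = m \<Longrightarrow> Re (braket u v) = 0"
proof -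
  obtain u v l m where T: "takagi \<psi> u v l m" using takagi_exists by blast
  show thesis
  proof (cases "l = m")
    case True
    with T have "takagi \<psi> u v l l" by simp
    then obtain u' v' where "takagi \<psi> u' v' l l" "Re (braket u' v') = 0"
      by (rule takagi_rotate)
    then show thesis by (rule that)
  qed (use T that in blast)
qed

lemma balanced_sumI:
  assumes "takagi \<psi> u v l m" "norm \<psi> = 1" "Re (braket u v) = 0" shows "balanced \<psi> (l + m)"
proof -
  have "cmod (complex_of_real l + 1\<^sup>2 * complex_of_real m) = l + m"
    using assms(1) by (simp add: takagi_def flip: of_real_add)
  then show ?thesis using balancedI[OF assms(1,2), of 1] assms(3) by simp
qed

lemma balanced_diffI:
  assumes "takagi \<psi> u v l m" "norm \<psi> = 1" "Im (braket u v) = 0" shows "balanced \<psi> \<bar>l - m\<bar>"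
proof -
  have "cmod (complex_of_real l + \<i>\<^sup>2 * complex_of_real m) = \<bar>l - m\<bar>"
    by (simp flip: of_real_diff)
  then show ?thesis using balancedI[OF assms(1,2), of \<i>] assms(3) by simp
qed

text \<open>With m = 0 the phase \<omega> drops out of the concurrence, so it is free to make
  \<omega> <u|v> purely imaginary.\<close>

lemma balanced_degenerate:
  assumes "takagi \<psi> u v l 0" "norm \<psi> = 1" shows "balanced \<psi> l"
proof -
  obtain \<zeta> where \<zeta>: "cmod \<zeta> = 1" "braket u v = \<zeta> * complex_of_real (cmod (braket u v))"
    using phase_exists by blast
  have "\<i> * cnj \<zeta> * braket u v = \<i> * complex_of_real (cmod (braket u v)) * (\<zeta> * cnj \<zeta>)"
    by (subst \<zeta>(2)) (simp add: mult_ac)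
  also have "\<zeta> * cnj \<zeta> = 1"
    using \<zeta>(1) complex_norm_square[of \<zeta>] by simp
  finally have e: "\<i> * cnj \<zeta> * braket u v = \<i> * complex_of_real (cmod (braket u v)) * 1" .
  have "Re (\<i> * cnj \<zeta> * braket u v) = 0"
    unfolding e by simp
  then show ?thesis
    using balancedI[OF assms, of "\<i> * cnj \<zeta>"] \<zeta>(1) assms(1) by (simp add: norm_mult takagi_def)
qed

theorem mainTheorem5:
  fixes \<psi> :: three_qubit
  assumes "norm \<psi> = 1"
    and "truly_tripartite_entangled \<psi>"
  shows
    "((\<exists>a b \<alpha> \<beta> \<gamma> \<beta>'. is_decomposition \<psi> a b \<alpha> \<beta> \<gamma> \<beta>' \<and>
          entanglement (psi_s a b) = EoC (C23 \<psi>) \<and> EoC (C23 \<psi>) = EoC (C23a \<psi>))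
        \<longleftrightarrow> \<psi> \<in> W_class)
     \<and>
     ((\<exists>a b \<alpha> \<beta> \<gamma> \<beta>'. is_decomposition \<psi> a b \<alpha> \<beta> \<gamma> \<beta>' \<and>
          entanglement (psi_s a b) = EoC (C23a \<psi>) \<and> EoC (C23a \<psi>) \<noteq> EoC (C23 \<psi>))
        \<longleftrightarrow> (\<exists>c :: real. propto_form \<psi> (complex_of_real c)))
     \<and>
     ((\<exists>a b \<alpha> \<beta> \<gamma> \<beta>'. is_decomposition \<psi> a b \<alpha> \<beta> \<gamma> \<beta>' \<and>
          entanglement (psi_s a b) = EoC (C23 \<psi>) \<and> EoC (C23 \<psi>) \<noteq> EoC (C23a \<psi>))
        \<longleftrightarrow> (\<exists>c :: real. propto_form \<psi> (exp (\<i> * complex_of_real c))))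
     \<and>
     ((EoC (C23 \<psi>) \<noteq> EoC (C23a \<psi>) \<and>
        (\<exists>a b \<alpha> \<beta> \<gamma> \<beta>'. is_decomposition \<psi> a b \<alpha> \<beta> \<gamma> \<beta>' \<and>
          entanglement (psi_s a b) = EoC (C23 \<psi>)) \<and>
        (\<exists>a b \<alpha> \<beta> \<gamma> \<beta>'. is_decomposition \<psi> a b \<alpha> \<beta> \<gamma> \<beta>' \<and>
          entanglement (psi_s a b) = EoC (C23a \<psi>)))
        \<longleftrightarrow> propto_form \<psi> 1)"
proof -
  note [simp] = assms(1)
  obtain u v l m where T: "takagi \<psi> u v l m" and deg: "l = m \<Longrightarrow> Re (braket u v) = 0"
    by (rule takagi_normalized_exists) blast
  have lm: "l \<ge> 0" "m \<ge> 0" "l + m \<le> 1"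
    using T takagi_le_one[OF T] by (simp_all add: takagi_def)
  have C: "C23 \<psi> = \<bar>l - m\<bar>" "C23a \<psi> = l + m"
    using takagi_concurrences[OF T assms(2,1)] by simp_all
  have C01: "0 \<le> C23 \<psi>" "C23 \<psi> \<le> 1" "0 \<le> C23a \<psi>" "C23a \<psi> \<le> 1"
    using lm by (simp_all add: C abs_le_iff)
  have EC: "EoC (C23 \<psi>) = EoC (C23a \<psi>) \<longleftrightarrow> l * m = 0"
  proof -
    have "EoC (C23 \<psi>) = EoC (C23a \<psi>) \<longleftrightarrow> C23 \<psi> = C23a \<psi>"
      by (rule EoC_inject[OF C01])
    also have "\<dots> \<longleftrightarrow> l * m = 0"
      unfolding C using lm by (auto simp: abs_if)
    finally show ?thesis .
  qed
  have dec: "(\<exists>a b \<alpha> \<beta> \<gamma> \<beta>'. is_decomposition \<psi> a b \<alpha> \<beta> \<gamma> \<beta>' \<and> entanglement (psi_s a b) = EoC (C23 \<psi>)) \<longleftrightarrow> balanced \<psi> \<bar>l - m\<bar>"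
    "(\<exists>a b \<alpha> \<beta> \<gamma> \<beta>'. is_decomposition \<psi> a b \<alpha> \<beta> \<gamma> \<beta>' \<and> entanglement (psi_s a b) = EoC (C23a \<psi>)) \<longleftrightarrow> balanced \<psi> (l + m)"
    using decomposition_iff_balanced[OF C01(1,2)] decomposition_iff_balanced[OF C01(3,4)] unfolding C by blast+
  have pos: "l > 0" "m > 0" if "l * m \<noteq> 0"
    using that lm by (simp_all add: less_le)
  have W: "\<psi> \<in> W_class \<longleftrightarrow> l * m = 0"
    using W_class_iff[OF T assms] .
  have sum: "Re (braket u v) = 0" if "l * m \<noteq> 0" "balanced \<psi> (l + m)"
    using balanced_sum[OF T assms(1) that(2) pos[OF that(1)]] deg by blast
  have diff: "Im (braket u v) = 0" if "l * m \<noteq> 0" "balanced \<psi> \<bar>l - m\<bar>"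
    using balanced_diff[OF T assms(1) that(2) pos[OF that(1)]] .
  have form: "\<exists>z. propto_form \<psi> z \<and> (Re (braket u v) = 0 \<longrightarrow> Im z = 0) \<and> (Im (braket u v) = 0 \<longrightarrow> cmod z = 1)"
    if "l * m \<noteq> 0"
    using takagi_propto_form[OF T pos[OF that] assms] .
  have W_balanced: "balanced \<psi> \<bar>l - m\<bar>" if "l * m = 0"
  proof (cases "m = 0")
    case True
    then show ?thesis using balanced_degenerate T lm by simp
  next
    case False
    then have "l = 0" using that by simp
    then show ?thesis using balanced_degenerate takagi_swap[OF T] lm by simp
  qed
  have propto: "l * m \<noteq> 0 \<and> (Im z = 0 \<longrightarrow> balanced \<psi> (l + m)) \<and> (cmod z = 1 \<longrightarrow> balanced \<psi> \<bar>l - m\<bar>)"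
    if z: "propto_form \<psi> z" for z
  proof -
    obtain u' v' l' m' where T': "takagi \<psi> u' v' l' m'" and pos': "l' > 0" "m' > 0"
      and g: "Im z = 0 \<longrightarrow> Re (braket u' v') = 0" "cmod z = 1 \<longrightarrow> Im (braket u' v') = 0"
      by (rule propto_form_takagi[OF z assms])
    \<comment> \<open>The Takagi form built from the normal form may differ from the fixed one; both
      compute the same two concurrences.\<close>
    have eq: "\<bar>l' - m'\<bar> = \<bar>l - m\<bar>" "l' + m' = l + m"
      using takagi_concurrences[OF T' assms(2,1)] C by simp_all
    have "l * m \<noteq> 0"
      using EC W W_class_iff[OF T' assms] pos' by simp
    then show ?thesis
      using balanced_sumI[OF T' assms(1)] balanced_diffI[OF T' assms(1)] g unfolding eq by blast
  qed
  have real: "l * m \<noteq> 0 \<and> balanced \<psi> (l + m) \<longleftrightarrow> (\<exists>c :: real. propto_form \<psi> (complex_of_real c))"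
  proof
    assume *: "l * m \<noteq> 0 \<and> balanced \<psi> (l + m)"
    then obtain z where "propto_form \<psi> z" "Im z = 0" using form sum by blast
    then have "propto_form \<psi> (complex_of_real (Re z))" by (simp add: complex_is_Real_iff of_real_Re)
    then show "\<exists>c :: real. propto_form \<psi> (complex_of_real c)" ..
  next
    assume "\<exists>c :: real. propto_form \<psi> (complex_of_real c)"
    then show "l * m \<noteq> 0 \<and> balanced \<psi> (l + m)" using propto Im_complex_of_real by blast
  qed
  have phase: "l * m \<noteq> 0 \<and> balanced \<psi> \<bar>l - m\<bar> \<longleftrightarrow> (\<exists>c :: real. propto_form \<psi> (exp (\<i> * complex_of_real c)))"
  proof
    assume *: "l * m \<noteq> 0 \<and> balanced \<psi> \<bar>l - m\<bar>"
    then obtain z where z: "propto_form \<psi> z" "cmod z = 1" using form diff by blast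
    then have "z = exp (\<i> * complex_of_real (Arg z))"
      using rcis_cmod_Arg[of z] by (simp add: rcis_def cis_conv_exp)
    then show "\<exists>c :: real. propto_form \<psi> (exp (\<i> * complex_of_real c))" using z(1) by metis
  next
    assume "\<exists>c :: real. propto_form \<psi> (exp (\<i> * complex_of_real c))"
    then show "l * m \<noteq> 0 \<and> balanced \<psi> \<bar>l - m\<bar>" using propto norm_exp_i_times by blast
  qed
  have both: "l * m \<noteq> 0 \<and> balanced \<psi> \<bar>l - m\<bar> \<and> balanced \<psi> (l + m) \<longleftrightarrow> propto_form \<psi> 1"
  proof
    assume *: "l * m \<noteq> 0 \<and> balanced \<psi> \<bar>l - m\<bar> \<and> balanced \<psi> (l + m)"
    then obtain z where z: "propto_form \<psi> z" "Im z = 0" "cmod z = 1" using form sum diff by blast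
    \<comment> \<open>The same Takagi form provides one z that is both real and of modulus
      one.\<close>
    then have "z = 1 \<or> z = - 1"
      by (auto simp: complex_eq_iff cmod_def)
    then show "propto_form \<psi> 1" using z(1) propto_form_minus_one by blast
  qed (use propto[of 1] in simp)
  \<comment> \<open>Rewriting backwards expresses the right-hand sides through decompositions and
    \<open>EoC\<close>. What remains is the existence of a decomposition in the W-class, supplied by
    \<open>W_balanced\<close>.\<close>
  show ?thesis
    unfolding real[symmetric] phase[symmetric] both[symmetric] W dec[symmetric] EC[symmetric]
    using W_balanced unfolding dec[symmetric] EC[symmetric] by (intro conjI; metis)
qed

end
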